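(* Suppose that $\mu=\mathcal N(0,I_{d_y})$ on $\mathbb{R}^{d_y}$ and that $\nu=\mathcal N\big((0^\top,m_Y^\top)^\top,\Sigma\big)$ on $\mathbb{R}^{d_x+d_y}$ is the law of $(X,Y)$, where $m_Y:=\mathbb{E}[Y]$ and $\Sigma=\begin{pmatrix}\Sigma_{XX}&\Sigma_{XY}\\ \Sigma_{YX}&\Sigma_{YY}\end{pmatrix}$ is nonsingular. For $\varepsilon>0$ let $\pi^\varepsilon$ be the optimal coupling for the entropic vector quantile regression problem, and let $\pi^o=\mathcal N(m,\Gamma_o)$ with $$m:=\begin{pmatrix}0\\ 0\\ m_Y\end{pmatrix},\quad \Gamma_o:=\begin{pmatrix}I_{d_y}&O&\Lambda_o\\ O&\Sigma_{XX}&\Sigma_{XY}\\ \Lambda_o&\Sigma_{YX}&\Sigma_{YY}\end{pmatrix},\quad \Lambda_o:=(\Sigma_{YY}-\Sigma_{YX}\Sigma_{XX}^{-1}\Sigma_{XY})^{1/2}.$$ Then, as $\varepsilon\to0+$, $$\mathsf W_2^2(\pi^\varepsilon,\pi^o)=\varepsilon\,\mathrm{tr}(L^{-1}\Lambda_o)+O(\varepsilon^2)\quad\text{with}\quad L:=I_{d_y}+\Lambda_o^2+\Sigma_{YX}\Sigma_{XX}^{-2}\Sigma_{XY}.$$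
   Context: $\Pi(\mu,\nu)$ is the set of couplings of $\mu$ and $\nu$ (Borel probability measures on $\mathbb{R}^{d_y}\times\mathbb{R}^{d_x+d_y}$, points written $(u,x,y)$, with marginals $\mu,\nu$). For $\pi\in\Pi(\mu,\nu)$, $\pi_u$ is the conditional law of $(\tilde X,\tilde Y)$ given $U=u$ when $(U,\tilde X,\tilde Y)\sim\pi$. $\mathsf{KL}(P\|Q)=\int\log\frac{dP}{dQ}\,dP$ if $P\ll Q$ and $\infty$ otherwise. The entropic vector quantile regression problem is: minimize $\int\frac12\|u-y\|^2\,d\pi(u,x,y)+\varepsilon\,\mathsf{KL}(\pi\|\mu\otimes\nu)$ over $\pi\in\Pi(\mu,\nu)$ with $\int x\,d\pi_u(x,y)=0$ for $\mu$-a.e. $u$; it has a unique optimal solution $\pi^\varepsilon$. $\mathsf W_2(\rho_0,\rho_1)=\big(\inf_{\gamma\in\Pi(\rho_0,\rho_1)}\int\|w-w'\|^2\,d\gamma(w,w')\big)^{1/2}$ is the $2$-Wasserstein distance on $\mathbb{R}^{d_x+2d_y}$ for the Euclidean metric. $O$ inside a matrix denotes a zero block; $A^{1/2}$ is the symmetric positive semidefinite square root. *)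

theory Defs
  imports "HOL-Probability.Probability" "HOL-Library.Landau_Symbols"
begin

section \<open>Normal distributions\<close>

definition std_gaussian :: "'a::euclidean_space measure" where
  "std_gaussian = density lborel (\<lambda>z. ennreal (\<Prod>b\<in>Basis. std_normal_density (z \<bullet> b)))"

text \<open>
  The measure \<open>M\<close> is the normal distribution with mean \<open>m\<close> and covariance \<open>C\<close>, i.e. the law of
  \<open>m + A Z\<close> where \<open>Z\<close> is standard normal and \<open>A A\<^sup>T = C\<close>. The covariance is given as a linear
  operator, so that the definition applies to product spaces such as
  \<open>real^'y \<times> real^'x \<times> real^'y\<close>, and it may be singular. The law depends on \<open>A\<close> only through
  \<open>A A\<^sup>T\<close>; existence of \<open>A\<close> forces \<open>C\<close> to be symmetric and positive semidefinite.
\<close>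
definition is_gaussian ::
    "'a::euclidean_space measure \<Rightarrow> 'a \<Rightarrow> ('a \<Rightarrow> 'a) \<Rightarrow> bool" where
  "is_gaussian M m C \<longleftrightarrow>
     (\<exists>A. linear A \<and> A \<circ> adjoint A = C \<and>
          M = distr (std_gaussian :: 'a measure) borel (\<lambda>z. m + A z))"

section \<open>Matrices\<close>

text \<open>The linear operators on product spaces given by block matrices, listed row by row.\<close>

definition block2 ::
    "real^'a^'a \<Rightarrow> real^'b^'a \<Rightarrow>
     real^'a^'b \<Rightarrow> real^'b^'b \<Rightarrow>
     (real^'a) \<times> (real^'b) \<Rightarrow> (real^'a) \<times> (real^'b)" where
  "block2 A11 A12 A21 A22 =
     (\<lambda>(v, w). (A11 *v v + A12 *v w,
                A21 *v v + A22 *v w))"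

definition block3 ::
    "real^'a^'a \<Rightarrow> real^'b^'a \<Rightarrow> real^'c^'a \<Rightarrow>
     real^'a^'b \<Rightarrow> real^'b^'b \<Rightarrow> real^'c^'b \<Rightarrow>
     real^'a^'c \<Rightarrow> real^'b^'c \<Rightarrow> real^'c^'c \<Rightarrow>
     (real^'a) \<times> (real^'b) \<times> (real^'c) \<Rightarrow> (real^'a) \<times> (real^'b) \<times> (real^'c)" where
  "block3 A11 A12 A13 A21 A22 A23 A31 A32 A33 =
     (\<lambda>(u, v, w). (A11 *v u + A12 *v v + A13 *v w,
                   A21 *v u + A22 *v v + A23 *v w,
                   A31 *v u + A32 *v v + A33 *v w))"

definition psd_sqrt :: "real^'n^'n \<Rightarrow> real^'n^'n" where
  "psd_sqrt A = (THE B. transpose B = B \<and> (\<forall>v. 0 \<le> v \<bullet> (B *v v)) \<and> B ** B = A)"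

section \<open>Couplings, Wasserstein distance, relative entropy\<close>

definition couplings ::
    "'a::topological_space measure \<Rightarrow> 'b::topological_space measure \<Rightarrow> ('a \<times> 'b) measure set" where
  "couplings \<mu> \<nu> =
     {\<pi>. sets \<pi> = sets borel \<and> prob_space \<pi> \<and> distr \<pi> borel fst = \<mu> \<and> distr \<pi> borel snd = \<nu>}"

text \<open>
  For measures with finite second moments the infimum is finite, so the conversion to a real number
  loses nothing. On product types \<open>dist\<close> is the Euclidean metric.
\<close>
definition W2 :: "'a::euclidean_space measure \<Rightarrow> 'a measure \<Rightarrow> real" where
  "W2 \<rho>0 \<rho>1 =
     sqrt (enn2real (INF \<gamma>\<in>couplings \<rho>0 \<rho>1. \<integral>\<^sup>+ (w, w'). ennreal ((dist w w')\<^sup>2) \<partial>\<gamma>))"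

text \<open>
  \<open>KL P Q\<close> is the divergence of \<open>P\<close> from \<open>Q\<close>; the library's \<open>KL_divergence b Q P\<close> takes its
  arguments in the other order and is \<open>0\<close> when the integral diverges. For probability measures with
  \<open>P\<close> absolutely continuous with respect to \<open>Q\<close>, the negative part of \<open>ln (dP/dQ)\<close> is always
  \<open>P\<close>-integrable, so non-integrability means that the integral is \<open>\<infinity>\<close>.
\<close>
definition KL :: "'a measure \<Rightarrow> 'a measure \<Rightarrow> ereal" where
  "KL P Q =
     (if absolutely_continuous Q P \<and> integrable P (entropy_density (exp 1) Q P)
      then ereal (KL_divergence (exp 1) Q P) else \<infinity>)"

section \<open>Entropic vector quantile regression\<close>

text \<open>\<open>\<kappa> u\<close> is a regular version of the conditional law of the second component given that the
  first component is \<open>u\<close>; it is unique up to a \<open>\<mu>\<close>-null set of \<open>u\<close>.\<close>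
definition is_conditional_law ::
    "('a::topological_space \<times> 'b::topological_space) measure \<Rightarrow> 'a measure \<Rightarrow> ('a \<Rightarrow> 'b measure) \<Rightarrow> bool"
  where
  "is_conditional_law \<pi> \<mu> \<kappa> \<longleftrightarrow>
     \<kappa> \<in> borel \<rightarrow>\<^sub>M prob_algebra borel \<and>
     (\<forall>A\<in>sets borel. \<forall>B\<in>sets borel. emeasure \<pi> (A \<times> B) = (\<integral>\<^sup>+u\<in>A. emeasure (\<kappa> u) B \<partial>\<mu>))"

definition evqr_feasible ::
    "(real^'y) measure \<Rightarrow> ((real^'x) \<times> (real^'y)) measure \<Rightarrow>
     ((real^'y) \<times> (real^'x) \<times> (real^'y)) measure set" where
  "evqr_feasible \<mu> \<nu> =
     {\<pi> \<in> couplings \<mu> \<nu>.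
        \<exists>\<kappa>. is_conditional_law \<pi> \<mu> \<kappa> \<and>
            (AE u in \<mu>. integrable (\<kappa> u) fst \<and> (\<integral>(x, y). x \<partial>\<kappa> u) = 0)}"

definition evqr_objective ::
    "real \<Rightarrow> (real^'y) measure \<Rightarrow> ((real^'x) \<times> (real^'y)) measure \<Rightarrow>
     ((real^'y) \<times> (real^'x) \<times> (real^'y)) measure \<Rightarrow> ereal" where
  "evqr_objective \<epsilon> \<mu> \<nu> \<pi> =
     enn2ereal (\<integral>\<^sup>+ (u, x, y). ennreal (1/2 * (norm (u - y))\<^sup>2) \<partial>\<pi>)
     + ereal \<epsilon> * KL \<pi> (\<mu> \<Otimes>\<^sub>M \<nu>)"

definition evqr_optimal ::
    "real \<Rightarrow> (real^'y) measure \<Rightarrow> ((real^'x) \<times> (real^'y)) measure \<Rightarrow>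
     ((real^'y) \<times> (real^'x) \<times> (real^'y)) measure \<Rightarrow> bool" where
  "evqr_optimal \<epsilon> \<mu> \<nu> \<pi> \<longleftrightarrow>
     \<pi> \<in> evqr_feasible \<mu> \<nu> \<and>
     (\<forall>\<pi>'\<in>evqr_feasible \<mu> \<nu>. evqr_objective \<epsilon> \<mu> \<nu> \<pi> \<le> evqr_objective \<epsilon> \<mu> \<nu> \<pi>')"

end

theory Submission
  imports Defs
begin

text \<open>
  Write \<open>F = \<Sigma>YX \<Sigma>XX\<^sup>-\<^sup>1\<close>, \<open>r = y - mY - F x\<close> for the regression residual of \<open>y\<close> on \<open>x\<close>, and \<open>S\<close> for
  its covariance, the Schur complement; thus \<open>\<Lambda>o\<^sup>2 = S\<close>.

  \<^emph>\<open>The optimal coupling is Gaussian.\<close> Let \<open>\<Lambda>\<close> be the positive definite solution of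
  \<open>\<Lambda>\<^sup>2 + \<epsilon> \<Lambda> = S\<close>, that is \<open>\<Lambda> = (S + \<epsilon>\<^sup>2/4)\<^sup>1\<^sup>/\<^sup>2 - \<epsilon>/2\<close>. Take \<open>U\<close> and \<open>X\<close> independent and let the
  residual be \<open>\<Lambda> U\<close> plus independent noise of covariance \<open>\<epsilon> \<Lambda>\<close>. This coupling is feasible, and its
  density with respect to \<open>\<mu> \<otimes> \<nu>\<close> is \<open>exp (u \<bullet> r / \<epsilon> + a u + b (x, y))\<close> (lemma \<open>opt_density\<close>). For every
  feasible \<open>\<pi>\<close> the conditional mean constraint gives \<open>\<integral> u \<bullet> F x d\<pi> = 0\<close>, so that the transport cost
  plus \<open>\<epsilon>\<close> times the integral of the log-density is the same constant for all feasible \<open>\<pi>\<close>. Hence the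
  objective at \<open>\<pi>\<close> is that constant plus \<open>\<epsilon>\<close> times the relative entropy of \<open>\<pi>\<close> with respect to the
  Gaussian coupling, and the latter is the unique minimizer (lemma \<open>evqr_optimal_eq_opt\<close>).

  \<^emph>\<open>The distance to the limit.\<close> The limit law \<open>\<pi>o\<close> is concentrated on the subspace (up to the mean)
  \<open>y = F x + \<Lambda>o u\<close>, so \<open>W\<^sub>2\<^sup>2\<close> is at least the expected squared distance of the optimal coupling from
  this subspace, which is \<open>tr (L\<^sup>-\<^sup>1 ((\<Lambda> - \<Lambda>o)\<^sup>2 + \<epsilon> \<Lambda>)) = \<epsilon> tr (L\<^sup>-\<^sup>1 \<Lambda>o) + O(\<epsilon>\<^sup>2)\<close>; here \<open>L\<close> is the Gram
  operator of the normals \<open>(- \<Lambda>o v, - F\<^sup>T v, v)\<close>. For the upper bound both laws are images \<open>A z\<close> and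
  \<open>A\<^sub>0 z\<close> of the same standard normal \<open>z\<close>, and \<open>z\<close> may be rotated in the second one. The tangential
  part of \<open>A - A\<^sub>0\<close> has order \<open>\<surd>\<epsilon>\<close>, and its leading part equals \<open>A\<^sub>0 S'\<close> for a skew operator \<open>S'\<close> of
  order \<open>\<surd>\<epsilon>\<close>. The Cayley transform of \<open>S'\<close> is a rotation that agrees with \<open>id + S'\<close> up to \<open>O(\<epsilon>)\<close>; with
  it the tangential error is \<open>O(\<epsilon>)\<close> pointwise, hence contributes \<open>O(\<epsilon>\<^sup>2)\<close> to the squared distance
  (lemma \<open>W2_opt_limit\<close>).
\<close>


section \<open>Lebesgue measure under linear bijections\<close>

lemma nn_integral_lborel_reflect:
  fixes f :: "'a::euclidean_space \<Rightarrow> ennreal"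
  assumes [measurable]: "f \<in> borel_measurable borel"
  shows "(\<integral>\<^sup>+y. f (x - y) \<partial>lborel) = (\<integral>\<^sup>+y. f y \<partial>lborel)"
proof -
  have "(\<integral>\<^sup>+y. f y \<partial>lborel) = (\<integral>\<^sup>+y. f y \<partial>density (distr lborel borel (\<lambda>y. x + (-1) *\<^sub>R y)) (\<lambda>_. 1))"
    using lborel_affine[of "-1" x] by simp
  also have "\<dots> = (\<integral>\<^sup>+y. f (x - y) \<partial>lborel)"
    by (simp add: density_1 nn_integral_distr)
  finally show ?thesis by simp
qed

lemma nn_integral_lborel_translate:
  fixes f :: "'a::euclidean_space \<Rightarrow> ennreal"
  assumes [measurable]: "f \<in> borel_measurable borel"
  shows "(\<integral>\<^sup>+y. f (x + y) \<partial>lborel) = (\<integral>\<^sup>+y. f y \<partial>lborel)"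
proof -
  have "(\<integral>\<^sup>+y. f y \<partial>lborel) = (\<integral>\<^sup>+y. f y \<partial>density (distr lborel borel (\<lambda>y. x + 1 *\<^sub>R y)) (\<lambda>_. 1))"
    using lborel_affine[of "1" x] by simp
  also have "\<dots> = (\<integral>\<^sup>+y. f (x + y) \<partial>lborel)"
    by (simp add: density_1 nn_integral_distr)
  finally show ?thesis by simp
qed

text \<open>Uniqueness of Haar measure, in product form: by Fubini the integral of
  \<open>1\<^sub>A x * 1\<^sub>B (x - y)\<close> over \<open>x\<close> and \<open>y\<close> can be evaluated in two ways.\<close>
lemma translation_invariant_proportional:
  fixes M :: "'a::euclidean_space measure"
  assumes sets [measurable_cong]: "sets M = sets borel" and "sigma_finite_measure M"
    and invariant: "\<And>a. distr M borel (\<lambda>x. a + x) = M"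
    and A [measurable]: "A \<in> sets borel" and B [measurable]: "B \<in> sets borel"
  shows "emeasure lborel B * emeasure M A = emeasure M B * emeasure lborel A"
proof -
  interpret M: sigma_finite_measure M by fact
  interpret pair_sigma_finite M "lborel :: 'a measure" ..
  have "emeasure lborel B * emeasure M A = (\<integral>\<^sup>+x. indicator A x * emeasure lborel B \<partial>M)"
    by (simp add: nn_integral_multc mult.commute)
  also have "\<dots> = (\<integral>\<^sup>+x. \<integral>\<^sup>+y. indicator A x * indicator B (x - y) \<partial>lborel \<partial>M)"
    by (simp add: nn_integral_cmult nn_integral_lborel_reflect)
  also have "\<dots> = (\<integral>\<^sup>+y. \<integral>\<^sup>+x. indicator A x * indicator B (x - y) \<partial>M \<partial>lborel)"
    by (intro Fubini'[symmetric]) measurable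
  also have "\<dots> = (\<integral>\<^sup>+y. \<integral>\<^sup>+x. indicator A (y + x) * indicator B x \<partial>M \<partial>lborel)"
  proof (rule nn_integral_cong)
    fix y
    have "(\<integral>\<^sup>+x. indicator A x * indicator B (x - y) \<partial>M)
        = (\<integral>\<^sup>+x. indicator A x * indicator B (x - y) \<partial>distr M borel (\<lambda>x. y + x))"
      by (simp add: invariant)
    also have "\<dots> = (\<integral>\<^sup>+x. indicator A (y + x) * indicator B x \<partial>M)"
      by (subst nn_integral_distr) (auto intro!: measurable_compose[OF _ borel_measurable_indicator])
    finally show "(\<integral>\<^sup>+x. indicator A x * indicator B (x - y) \<partial>M)
        = (\<integral>\<^sup>+x. indicator A (y + x) * indicator B x \<partial>M)" .
  qed
  also have "\<dots> = (\<integral>\<^sup>+x. \<integral>\<^sup>+y. indicator A (x + y) * indicator B x \<partial>lborel \<partial>M)"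
    by (subst Fubini') (auto simp: add.commute)
  also have "\<dots> = (\<integral>\<^sup>+x. emeasure lborel A * indicator B x \<partial>M)"
    by (simp add: nn_integral_multc nn_integral_lborel_translate)
  also have "\<dots> = emeasure M B * emeasure lborel A"
    by (simp add: nn_integral_cmult) (simp add: mult.commute)
  finally show ?thesis .
qed

text \<open>The factor \<open>c\<close> is the inverse absolute determinant, but only its existence and its value for
  orthogonal \<open>T\<close> are needed; the last equation yields \<open>c = 1\<close> in that case.\<close>
lemma distr_lborel_linear:
  fixes T :: "'a::euclidean_space \<Rightarrow> 'a"
  assumes T: "linear T" "bij T"
  obtains c where "c > 0" "distr lborel borel T = density lborel (\<lambda>_. ennreal c)"
    "ennreal c * emeasure lborel (ball 0 1 :: 'a set) = emeasure lborel (T -` ball 0 1)"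
proof -
  have [measurable]: "T \<in> borel_measurable borel"
    using T(1) by (simp add: borel_measurable_continuous_onI linear_continuous_on linear_conv_bounded_linear)
  let ?M = "distr lborel borel T"
  define B where "B = (ball 0 1 :: 'a set)"
  obtain R where R: "linear R" "R \<circ> T = id" "T \<circ> R = id"
  proof -
    have "linear (inv T)" using T by (simp add: bij_def inj_linear_imp_inv_linear)
    moreover have "inv T \<circ> T = id" "T \<circ> inv T = id"
      using T(2) by (auto simp: bij_def inj_iff surj_iff)
    ultimately show ?thesis using that by blast
  qed
  have vim: "T -` X = R ` X" for X
  proof -
    have "T (R y) = y" "R (T y) = y" for y
      using R(2,3) by (auto simp: fun_eq_iff)
    then show ?thesis by (auto simp: image_iff) metis
  qed
  have bounded: "bounded (T -` cball 0 r)" for r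
    unfolding vim using R(1) by (simp add: bounded_linear_image linear_conv_bounded_linear)
  have fin: "emeasure ?M (cball 0 r) < \<infinity>" for r
  proof -
    have "emeasure ?M (cball 0 r) = emeasure lborel (T -` cball 0 r)"
      by (simp add: emeasure_distr)
    also have "\<dots> < \<infinity>" using bounded by (rule emeasure_bounded_finite)
    finally show ?thesis .
  qed
  have sf: "sigma_finite_measure ?M"
  proof
    show "\<exists>A. countable A \<and> A \<subseteq> sets ?M \<and> \<Union> A = space ?M \<and> (\<forall>a\<in>A. emeasure ?M a \<noteq> \<infinity>)"
    proof (intro exI[of _ "range (\<lambda>n::nat. cball 0 (real n))"] conjI ballI)
      show "\<Union> (range (\<lambda>n::nat. cball 0 (real n))) = space ?M"
        by (auto simp: real_arch_simple)
      fix a :: "'a set" assume "a \<in> range (\<lambda>n::nat. cball 0 (real n))"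
      with fin show "emeasure ?M a \<noteq> \<infinity>" by (metis imageE less_irrefl)
    qed auto
  qed
  have inv: "distr ?M borel (\<lambda>x. a + x) = ?M" for a
  proof -
    have "distr ?M borel (\<lambda>x. a + x) = distr lborel borel (\<lambda>x. a + T x)"
      by (subst distr_distr) (auto simp: comp_def)
    also have "(\<lambda>x. a + T x) = T \<circ> (\<lambda>x. R a + x)"
    proof
      fix x
      have "T (R a) = a" using R(3) by (metis comp_apply id_apply)
      then show "a + T x = (T \<circ> (\<lambda>x. R a + x)) x" using T(1) by (simp add: linear_add)
    qed
    also have "distr lborel borel (T \<circ> (\<lambda>x. R a + x)) = distr (distr lborel borel (\<lambda>x. R a + x)) borel T"
      by (subst distr_distr) auto
    also have "distr lborel borel (\<lambda>x. R a + x) = lborel"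
      using lborel_affine[of 1 "R a"] by (simp add: density_1)
    finally show ?thesis .
  qed
  have proportional: "emeasure lborel B * emeasure ?M A = emeasure ?M B * emeasure lborel A" if "A \<in> sets borel" for A
    by (rule translation_invariant_proportional[OF _ sf inv that]) (auto simp: B_def)
  have "T 0 = 0" using T(1) by (rule linear_0)
  have cont: "continuous_on UNIV T"
    using T(1) by (simp add: linear_continuous_on linear_conv_bounded_linear)
  have posM: "emeasure ?M B > 0"
  proof -
    have "open (T -` B)" using cont unfolding B_def by (intro open_vimage) auto
    moreover have "0 \<in> T -` B" using \<open>T 0 = 0\<close> by (simp add: B_def)
    ultimately obtain e where e: "e > 0" "ball 0 e \<subseteq> T -` B" using openE by blast
    have "0 < emeasure lborel (ball (0::'a) e)" 
      using emeasure_lborel_ball_finite[of "0::'a" e] content_ball_pos[OF e(1), of "0::'a"]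
      by (auto simp: zero_less_iff_neq_zero measure_def)
    also have "\<dots> \<le> emeasure lborel (T -` B)"
      using e(2) \<open>open (T -` B)\<close> by (intro emeasure_mono) auto
    finally show ?thesis by (simp add: emeasure_distr B_def)
  qed
  have finM: "emeasure ?M B < \<infinity>"
    using fin[of 1] emeasure_mono[of B "cball 0 1" ?M] by (auto simp: B_def ball_subset_cball)
  have b1: "0 < measure lborel B"
    unfolding B_def by (simp add: content_ball_pos)
  have b2: "emeasure lborel B = ennreal (measure lborel B)"
    unfolding B_def by (rule emeasure_eq_ennreal_measure) (use emeasure_lborel_ball_finite[of "0::'a" 1] in auto)
  note b = b1 b2
  have m1: "emeasure ?M B = ennreal (measure ?M B)"
    using finM by (simp add: emeasure_eq_ennreal_measure top.not_eq_extremum)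
  then have m2: "measure ?M B > 0"
    using posM by simp
  note m = m1 m2
  define c where "c = measure ?M B / measure lborel B"
  show ?thesis
  proof
    show "c > 0" using b m by (simp add: c_def)
    show "distr lborel borel T = density lborel (\<lambda>_. ennreal c)"
    proof (rule measure_eqI)
      fix A assume "A \<in> sets (distr lborel borel T)"
      then have A [measurable]: "A \<in> sets borel" by simp
      have "ennreal c * emeasure lborel A = ennreal (1 / measure lborel B) * (emeasure ?M B * emeasure lborel A)"
        using b(1) unfolding m(1) c_def by (simp add: ennreal_mult'[symmetric] mult.assoc[symmetric])
      also have "\<dots> = ennreal (1 / measure lborel B) * (ennreal (measure lborel B) * emeasure ?M A)"
        using proportional[OF A] b(2) by simp
      also have "\<dots> = emeasure ?M A"
        using b(1) by (simp add: ennreal_mult'[symmetric] mult.assoc[symmetric])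
      finally show "emeasure ?M A = emeasure (density lborel (\<lambda>_. ennreal c)) A"
        by (simp add: emeasure_density_const)
    qed simp
    have "ennreal c * emeasure lborel B = emeasure ?M B"
      unfolding b(2) m(1) c_def using b(1) by (simp add: ennreal_mult'[symmetric])
    then show "ennreal c * emeasure lborel (ball 0 1 :: 'a set) = emeasure lborel (T -` ball 0 1)"
      by (simp add: emeasure_distr B_def)
  qed
qed

section \<open>The standard Gaussian\<close>

lemma std_gaussian_radial:
  "(std_gaussian :: 'a::euclidean_space measure) =
     density lborel (\<lambda>z. ennreal ((1 / sqrt (2 * pi)) ^ DIM('a) * exp (- (norm z)\<^sup>2 / 2)))"
proof -
  have "(\<Prod>b\<in>Basis. std_normal_density (z \<bullet> b)) = (1 / sqrt (2 * pi)) ^ DIM('a) * exp (- (norm z)\<^sup>2 / 2)" for z :: 'a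
  proof -
    have "(norm z)\<^sup>2 = (\<Sum>b\<in>Basis. (z \<bullet> b)\<^sup>2)"
      by (simp add: norm_eq_sqrt_inner euclidean_inner[of z z] power2_eq_square sum_nonneg)
    then have "exp (- (norm z)\<^sup>2 / 2) = (\<Prod>b\<in>Basis. exp (- (z \<bullet> b)\<^sup>2 / 2))"
      by (simp add: exp_sum[symmetric] sum_negf sum_divide_distrib)
    then show ?thesis
      by (simp add: std_normal_density_def prod_dividef power_one_over)
  qed
  then show ?thesis unfolding std_gaussian_def by simp
qed

lemma sets_std_gaussian [simp, measurable_cong]: "sets std_gaussian = sets borel"
  and space_std_gaussian [simp]: "space std_gaussian = UNIV"
  by (simp_all add: std_gaussian_def)

lemma nn_integral_std_gaussian_prod:
  fixes f :: "'a::euclidean_space \<Rightarrow> real \<Rightarrow> ennreal"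
  assumes [measurable]: "\<And>b. b \<in> Basis \<Longrightarrow> f b \<in> borel_measurable borel"
  shows "(\<integral>\<^sup>+z. (\<Prod>b\<in>Basis. f b (z \<bullet> b)) \<partial>std_gaussian) =
         (\<Prod>b\<in>Basis. \<integral>\<^sup>+t. f b t \<partial>density lborel std_normal_density)"
proof -
  have "(\<integral>\<^sup>+z. (\<Prod>b\<in>Basis. f b (z \<bullet> b)) \<partial>std_gaussian) =
     (\<integral>\<^sup>+z. (\<Prod>b\<in>Basis. ennreal (std_normal_density (z \<bullet> b)) * f b (z \<bullet> b)) \<partial>lborel)"
    unfolding std_gaussian_def
    by (subst nn_integral_density) (auto simp: prod_ennreal prod.distrib)
  also have "\<dots> = (\<Prod>b\<in>Basis. \<integral>\<^sup>+t. ennreal (std_normal_density t) * f b t \<partial>lborel)"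
    by (rule nn_integral_lborel_prod) auto
  also have "\<dots> = (\<Prod>b\<in>Basis. \<integral>\<^sup>+t. f b t \<partial>density lborel std_normal_density)"
    by (intro prod.cong refl) (simp add: nn_integral_density)
  finally show ?thesis .
qed

lemma prob_space_std_gaussian: "prob_space (std_gaussian :: 'a::euclidean_space measure)"
proof
  interpret prob_space "density lborel std_normal_density"
    by (rule prob_space_normal_density) simp
  have "(\<integral>\<^sup>+z. (\<Prod>b\<in>Basis. (\<lambda>_ _. 1) b (z \<bullet> b)) \<partial>(std_gaussian :: 'a measure)) = 1"
    using emeasure_space_1 by (subst nn_integral_std_gaussian_prod) auto
  then show "emeasure (std_gaussian :: 'a measure) (space std_gaussian) = 1"
    by simp
qed

lemma linear_measurable [measurable (raw)]:
  fixes T :: "'a::euclidean_space \<Rightarrow> 'b::euclidean_space"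
  assumes "linear T"
  shows "T \<in> borel_measurable borel"
  using assms by (simp add: borel_measurable_continuous_onI linear_continuous_on linear_conv_bounded_linear)

lemma std_gaussian_orthogonal:
  fixes Q :: "'a::euclidean_space \<Rightarrow> 'a"
  assumes Q: "orthogonal_transformation Q"
  shows "distr std_gaussian borel Q = std_gaussian"
proof -
  have lin: "linear Q" and bij: "bij Q"
    using Q by (auto intro: orthogonal_transformation_linear orthogonal_transformation_bij)
  note [measurable] = linear_measurable[OF lin]
  obtain c where c: "c > 0" "distr lborel borel Q = density lborel (\<lambda>_. ennreal c)"
    "ennreal c * emeasure lborel (ball 0 1 :: 'a set) = emeasure lborel (Q -` ball 0 1)"
    using distr_lborel_linear[OF lin bij] by blast
  have "Q -` ball 0 1 = ball 0 1"
    using Q by (auto simp: orthogonal_transformation_norm)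
  moreover have "emeasure lborel (ball 0 1 :: 'a set) = ennreal (measure lborel (ball 0 1 :: 'a set))"
    by (rule emeasure_eq_ennreal_measure) (use emeasure_lborel_ball_finite[of "0::'a" 1] in auto)
  moreover have "measure lborel (ball 0 1 :: 'a set) > 0"
    by (simp add: content_ball_pos)
  ultimately have "c = 1"
    using c(1,3) by (simp add: ennreal_mult'[symmetric])
  then have inv: "distr lborel borel Q = lborel"
    using c(2) by (simp add: density_1)
  show ?thesis
  proof (rule measure_eqI)
    fix A assume "A \<in> sets (distr std_gaussian borel Q)"
    then have [measurable]: "A \<in> sets borel" by simp
    let ?g = "\<lambda>z :: 'a. ennreal ((1 / sqrt (2 * pi)) ^ DIM('a) * exp (- (norm z)\<^sup>2 / 2))"
    have "emeasure (std_gaussian :: 'a measure) A = (\<integral>\<^sup>+z. ?g z * indicator A z \<partial>distr lborel borel Q)"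
      unfolding std_gaussian_radial inv by (simp add: emeasure_density)
    also have "\<dots> = (\<integral>\<^sup>+z. ?g z * indicator (Q -` A) z \<partial>lborel)"
      using Q by (subst nn_integral_distr) (auto simp: orthogonal_transformation_norm indicator_def)
    also have "\<dots> = emeasure (distr std_gaussian borel Q) A"
      unfolding std_gaussian_radial
      using measurable_sets_borel[of Q borel A] by (subst emeasure_distr) (auto simp: emeasure_density)
    finally show "emeasure (distr std_gaussian borel Q) A = emeasure (std_gaussian :: 'a measure) A" ..
  qed simp
qed

text \<open>The constant \<open>c\<close> depends on \<open>T\<close> only, not on the mean \<open>v\<close>.\<close>
lemma distr_std_gaussian_density:
  fixes T R :: "'a::euclidean_space \<Rightarrow> 'a"
  assumes T: "linear T" and R: "linear R" and TR: "\<And>z. R (T z) = z" "\<And>z. T (R z) = z"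
  obtains c where "c > 0"
    "\<And>v. distr std_gaussian borel (\<lambda>z. v + T z) =
       density lborel (\<lambda>y. ennreal (c * exp (- (norm (R (y - v)))\<^sup>2 / 2)))"
proof -
  have bij: "bij T" using TR by (metis bijI')
  note [measurable] = linear_measurable[OF T] linear_measurable[OF R]
  obtain c where c: "c > 0" "distr lborel borel T = density lborel (\<lambda>_. ennreal c)"
    using distr_lborel_linear[OF T bij] by blast
  let ?k = "(1 / sqrt (2 * pi)) ^ DIM('a)"
  have kpos: "?k > 0" by simp
  show ?thesis
  proof
    show "c * ?k > 0" using c(1) by simp
    fix v
    show "distr std_gaussian borel (\<lambda>z. v + T z) =
       density lborel (\<lambda>y. ennreal (c * ?k * exp (- (norm (R (y - v)))\<^sup>2 / 2)))" (is "?l = ?r")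
    proof (rule measure_eqI)
      fix A assume "A \<in> sets ?l"
      then have [measurable]: "A \<in> sets borel" by simp
      let ?g = "\<lambda>z :: 'a. ennreal (?k * exp (- (norm z)\<^sup>2 / 2))"
      have "(\<lambda>z. v + T z) -` A \<in> sets lborel"
        using measurable_sets_borel[of "\<lambda>z. v + T z" borel A] by simp
      then have "emeasure ?l A = (\<integral>\<^sup>+z. ?g z * indicator ((\<lambda>z. v + T z) -` A) z \<partial>lborel)"
        unfolding std_gaussian_radial
        by (subst emeasure_distr) (auto simp: emeasure_density)
      also have "\<dots> = (\<integral>\<^sup>+z. ?g (R (T z)) * indicator A (v + T z) \<partial>lborel)"
        by (simp add: TR indicator_def)
      also have "\<dots> = (\<integral>\<^sup>+y. ?g (R y) * indicator A (v + y) \<partial>distr lborel borel T)"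
        by (subst nn_integral_distr) auto
      also have "\<dots> = (\<integral>\<^sup>+y. ennreal c * (?g (R y) * indicator A (v + y)) \<partial>lborel)"
        unfolding c(2) by (subst nn_integral_density) auto
      also have "\<dots> = (\<integral>\<^sup>+y. ennreal c * (?g (R (v + y - v)) * indicator A (v + y)) \<partial>lborel)"
        by simp
      also have "\<dots> = (\<integral>\<^sup>+y. ennreal c * (?g (R (y - v)) * indicator A y) \<partial>lborel)"
        by (rule nn_integral_lborel_translate[where f="\<lambda>y. ennreal c * (?g (R (y - v)) * indicator A y)"]) measurable
      also have "\<dots> = emeasure ?r A"
        using c(1) kpos by (subst emeasure_density) (auto simp: ennreal_mult'[symmetric] mult.assoc[symmetric] intro!: nn_integral_cong)
      finally show "emeasure ?l A = emeasure ?r A" .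
    qed simp
  qed
qed

lemma std_gaussian_prod:
  "(std_gaussian :: ('a::euclidean_space \<times> 'b::euclidean_space) measure) = std_gaussian \<Otimes>\<^sub>M std_gaussian"
proof -
  interpret a: prob_space "std_gaussian :: 'a measure" by (rule prob_space_std_gaussian)
  interpret b: prob_space "std_gaussian :: 'b measure" by (rule prob_space_std_gaussian)
  have b': "sigma_finite_measure (std_gaussian :: 'b measure)" ..
  let ?g = "\<lambda>z :: 'a. ennreal ((1 / sqrt (2 * pi)) ^ DIM('a) * exp (- (norm z)\<^sup>2 / 2))"
  let ?h = "\<lambda>z :: 'b. ennreal ((1 / sqrt (2 * pi)) ^ DIM('b) * exp (- (norm z)\<^sup>2 / 2))"
  have "(std_gaussian :: 'a measure) \<Otimes>\<^sub>M (std_gaussian :: 'b measure) = density (lborel \<Otimes>\<^sub>M lborel) (\<lambda>(x, y). ?g x * ?h y)"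
    unfolding std_gaussian_radial
    by (rule pair_measure_density)
       (use b' in \<open>auto simp: sigma_finite_lborel std_gaussian_radial\<close>)
  also have "\<dots> = std_gaussian"
    unfolding std_gaussian_radial lborel_prod
    by (intro arg_cong[of _ _ "density lborel"] ext)
      (auto simp: ennreal_mult'[symmetric] power_add norm_Pair exp_add[symmetric] field_simps)
  finally show ?thesis ..
qed

section \<open>Second moments of the standard Gaussian\<close>

lemma std_gaussian_coordinate_moment:
  fixes i :: "'a::euclidean_space"
  assumes i: "i \<in> Basis"
  shows "integrable std_gaussian (\<lambda>z. (z \<bullet> i)\<^sup>2)" and "(\<integral>z. (z \<bullet> i)\<^sup>2 \<partial>std_gaussian) = 1"
proof -
  let ?f = "\<lambda>b t. if b = i then ennreal (t\<^sup>2) else 1"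
  interpret g: prob_space "density lborel std_normal_density"
    by (rule prob_space_normal_density) simp
  have "(\<integral>\<^sup>+t. ennreal (t\<^sup>2) \<partial>density lborel std_normal_density) = (\<integral>\<^sup>+t. ennreal (std_normal_density t * t\<^sup>2) \<partial>lborel)"
    by (subst nn_integral_density) (auto simp: ennreal_mult')
  also have "\<dots> = ennreal (\<integral>t. std_normal_density t * t\<^sup>2 \<partial>lborel)"
    using integrable_std_normal_moment[of 2] by (intro nn_integral_eq_integral) auto
  also have "\<dots> = 1"
    using integral_std_normal_moment_even[of 1] by (simp add: fact_numeral)
  finally have one: "(\<integral>\<^sup>+t. ennreal (t\<^sup>2) \<partial>density lborel std_normal_density) = 1" .
  have "(\<Prod>b\<in>Basis. ?f b (z \<bullet> b)) = ennreal ((z \<bullet> i)\<^sup>2)" for z :: 'a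
    using i by (simp add: prod.delta)
  then have "(\<integral>\<^sup>+z. ennreal ((z \<bullet> i)\<^sup>2) \<partial>std_gaussian) = (\<integral>\<^sup>+z. (\<Prod>b\<in>Basis. ?f b (z \<bullet> b)) \<partial>std_gaussian)"
    by simp
  also have "\<dots> = (\<Prod>b\<in>Basis. \<integral>\<^sup>+t. ?f b t \<partial>density lborel std_normal_density)"
    by (rule nn_integral_std_gaussian_prod) auto
  also have "\<dots> = (\<Prod>b\<in>(Basis::'a set). 1)"
  proof (intro prod.cong refl)
    fix b :: 'a
    show "(\<integral>\<^sup>+t. ?f b t \<partial>density lborel std_normal_density) = 1"
      using g.emeasure_space_1 by (cases "b = i") (simp_all add: one)
  qed
  finally have "(\<integral>\<^sup>+z. ennreal ((z \<bullet> i)\<^sup>2) \<partial>std_gaussian) = 1" by simp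
  then show "integrable std_gaussian (\<lambda>z. (z \<bullet> i)\<^sup>2)" "(\<integral>z. (z \<bullet> i)\<^sup>2 \<partial>std_gaussian) = 1"
    by (auto intro!: integrableI_nonneg simp: integral_eq_nn_integral)
qed

lemma integrable_std_gaussian_norm: "integrable std_gaussian (\<lambda>z::'a::euclidean_space. (norm z)\<^sup>2)"
proof -
  have "(norm z)\<^sup>2 = (\<Sum>b\<in>Basis. (z \<bullet> b)\<^sup>2)" for z :: 'a
    by (simp add: norm_eq_sqrt_inner euclidean_inner[of z z] power2_eq_square sum_nonneg)
  then show ?thesis by (simp add: std_gaussian_coordinate_moment(1))
qed

lemma integrable_std_gaussian_linear:
  fixes f g :: "'a::euclidean_space \<Rightarrow> 'b::euclidean_space"
  assumes f: "linear f" and g: "linear g"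
  shows "integrable std_gaussian (\<lambda>z. f z \<bullet> g z)"
proof -
  note [measurable] = linear_measurable[OF f] linear_measurable[OF g]
  obtain a where a: "\<And>z. norm (f z) \<le> a * norm z"
    using linear_bounded[OF f] by (metis mult.commute)
  obtain b where b: "\<And>z. norm (g z) \<le> b * norm z"
    using linear_bounded[OF g] by (metis mult.commute)
  show ?thesis
  proof (rule Bochner_Integration.integrable_bound)
    show "integrable std_gaussian (\<lambda>z::'a. \<bar>a * b\<bar> * (norm z)\<^sup>2)"
      by (intro integrable_mult_right integrable_std_gaussian_norm)
    have "\<bar>f z \<bullet> g z\<bar> \<le> \<bar>a * b\<bar> * (norm z)\<^sup>2" for z
    proof -
      have "\<bar>f z \<bullet> g z\<bar> \<le> norm (f z) * norm (g z)" by (rule Cauchy_Schwarz_ineq2)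
      also have "\<dots> \<le> (a * norm z) * (b * norm z)"
        using a b order_trans[OF norm_ge_zero a[of z]] by (intro mult_mono) auto
      also have "\<dots> = (a * b) * (norm z)\<^sup>2" by (simp add: power2_eq_square)
      also have "\<dots> \<le> \<bar>a * b\<bar> * (norm z)\<^sup>2" by (intro mult_right_mono) auto
      finally show ?thesis .
    qed
    then show "AE z in std_gaussian. norm (f z \<bullet> g z) \<le> norm (\<bar>a * b\<bar> * (norm z)\<^sup>2)" by auto
  qed measurable
qed

lemma integral_std_gaussian_orthogonal:
  fixes Q :: "'a::euclidean_space \<Rightarrow> 'a" and f :: "'a \<Rightarrow> real"
  assumes Q: "orthogonal_transformation Q" and [measurable]: "f \<in> borel_measurable borel"
  shows "(\<integral>z. f (Q z) \<partial>std_gaussian) = (\<integral>z. f z \<partial>std_gaussian)"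
proof -
  note [measurable] = linear_measurable[OF orthogonal_transformation_linear[OF Q]]
  have "(\<integral>z. f z \<partial>distr std_gaussian borel Q) = (\<integral>z. f (Q z) \<partial>std_gaussian)"
    by (rule integral_distr) auto
  then show ?thesis by (simp add: std_gaussian_orthogonal[OF Q])
qed

lemma integral_std_gaussian_coordinates:
  fixes i j :: "'a::euclidean_space"
  assumes "i \<in> Basis" "j \<in> Basis"
  shows "(\<integral>z. (z \<bullet> i) * (z \<bullet> j) \<partial>std_gaussian) = (if i = j then 1 else 0)"
proof (cases "i = j")
  case True
  then show ?thesis using std_gaussian_coordinate_moment(2)[OF assms(1)] by (simp add: power2_eq_square)
next
  case False
  then have ij: "j \<bullet> i = 0" "i \<bullet> j = 0" "i \<bullet> i = 1" using assms by (auto simp: inner_Basis)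
  \<comment> \<open>the reflection in the hyperplane orthogonal to \<open>i\<close> changes the sign of the integrand\<close>
  let ?Q = "\<lambda>z :: 'a. z - (2 * (z \<bullet> i)) *\<^sub>R i"
  have "linear ?Q" by (intro linearI) (auto simp: inner_add_left algebra_simps)
  moreover have "?Q v \<bullet> ?Q w = v \<bullet> w" for v w
    by (simp add: inner_diff_left inner_diff_right ij inner_commute[of i w])
  ultimately have "orthogonal_transformation ?Q" by (simp add: orthogonal_transformation_def)
  from integral_std_gaussian_orthogonal[OF this, of "\<lambda>z. (z \<bullet> i) * (z \<bullet> j)"]
  show ?thesis using False by (simp add: inner_diff_left ij)
qed

lemma integral_std_gaussian_quadratic:
  fixes T :: "'a::euclidean_space \<Rightarrow> 'a"
  assumes T: "linear T"
  shows "(\<integral>z. z \<bullet> T z \<partial>std_gaussian) = (\<Sum>b\<in>Basis. b \<bullet> T b)"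
proof -
  have int: "integrable std_gaussian (\<lambda>z. (z \<bullet> i) * (z \<bullet> j))" for i j :: 'a
    using integrable_std_gaussian_linear[of "\<lambda>z. z \<bullet> i" "\<lambda>z. z \<bullet> j"]
    by (simp add: bounded_linear_inner_left bounded_linear.linear)
  have "z \<bullet> T z = (\<Sum>i\<in>Basis. \<Sum>j\<in>Basis. (i \<bullet> T j) * ((z \<bullet> i) * (z \<bullet> j)))" for z
  proof -
    have "T z = T (\<Sum>j\<in>Basis. (z \<bullet> j) *\<^sub>R j)" by (simp add: euclidean_representation)
    also have "\<dots> = (\<Sum>j\<in>Basis. (z \<bullet> j) *\<^sub>R T j)" using T by (simp add: linear_sum linear_scale)
    finally have "z \<bullet> T z = (\<Sum>j\<in>Basis. (z \<bullet> j) * (z \<bullet> T j))" by (simp add: inner_sum_right)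
    also have "\<dots> = (\<Sum>j\<in>Basis. (z \<bullet> j) * (\<Sum>i\<in>Basis. (z \<bullet> i) * (T j \<bullet> i)))"
      by (simp add: euclidean_inner[symmetric])
    also have "\<dots> = (\<Sum>j\<in>Basis. \<Sum>i\<in>Basis. (i \<bullet> T j) * ((z \<bullet> i) * (z \<bullet> j)))"
      by (simp add: sum_distrib_left inner_commute[of "T j" i for i j] mult_ac)
    finally show ?thesis by (subst sum.swap)
  qed
  then have "(\<integral>z. z \<bullet> T z \<partial>std_gaussian) =
      (\<Sum>i\<in>Basis. \<Sum>j\<in>Basis. (i \<bullet> T j) * (\<integral>z. (z \<bullet> i) * (z \<bullet> j) \<partial>std_gaussian))"
    by (simp add: int)
  also have "\<dots> = (\<Sum>i\<in>Basis. \<Sum>j\<in>Basis. if i = j then i \<bullet> T i else 0)"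
    by (intro sum.cong refl) (simp add: integral_std_gaussian_coordinates)
  finally show ?thesis by simp
qed


section \<open>Self-adjoint operators\<close>

text \<open>The quadratic form of \<open>f\<close> attains its maximum over the unit sphere of an invariant subspace at an
  eigenvector.\<close>
lemma selfadjoint_max_eigenvector:
  fixes f :: "'a::euclidean_space \<Rightarrow> 'a"
  assumes f: "linear f" and sym: "\<And>v w. f v \<bullet> w = v \<bullet> f w"
    and V: "subspace V" "V \<noteq> {0}" and inv: "\<And>v. v \<in> V \<Longrightarrow> f v \<in> V"
  shows "\<exists>v\<in>V. norm v = 1 \<and> (\<exists>c. f v = c *\<^sub>R v)"
proof -
  let ?S = "V \<inter> sphere 0 1"
  have cont: "continuous_on ?S (\<lambda>v. v \<bullet> f v)"
    using f by (intro continuous_intros linear_continuous_on) (simp add: linear_conv_bounded_linear)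
  obtain w where w: "w \<in> V" "w \<noteq> 0" using V subspace_0 by blast
  then have "(1 / norm w) *\<^sub>R w \<in> ?S" using V(1) by (auto simp: subspace_scale)
  then have ne: "?S \<noteq> {}" by blast
  have "compact ?S" using V(1) by (intro closed_Int_compact closed_subspace) auto
  then obtain v where v: "v \<in> ?S" "\<And>w. w \<in> ?S \<Longrightarrow> w \<bullet> f w \<le> v \<bullet> f v"
    using continuous_attains_sup[OF _ ne cont] by blast
  define c where "c = v \<bullet> f v"
  have vv: "v \<bullet> v = 1" using v(1) by (simp add: norm_eq_1)
  have le: "w \<bullet> f w \<le> c * (w \<bullet> w)" if "w \<in> V" for w
  proof (cases "w = 0")
    case False
    then have "(1 / norm w) *\<^sub>R w \<in> ?S" using V(1) that by (auto simp: subspace_scale)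
    from v(2)[OF this] have "(w \<bullet> f w) / (norm w)\<^sup>2 \<le> c"
      using f by (simp add: linear_scale c_def power2_eq_square)
    with False show ?thesis by (simp add: divide_le_eq power2_norm_eq_inner)
  qed (use f in \<open>simp add: linear_0\<close>)
  define d where "d = f v - c *\<^sub>R v"
  have dV: "d \<in> V" using v(1) V(1) inv by (simp add: d_def subspace_diff subspace_scale)
  \<comment> \<open>first-order condition: the quadratic form is maximal at \<open>v\<close> in the direction \<open>d\<close>\<close>
  have quad: "2 * t * (d \<bullet> d) \<le> t\<^sup>2 * (c * (d \<bullet> d) - d \<bullet> f d)" for t
  proof -
    define p q r where "p = d \<bullet> f v" and "q = d \<bullet> v" and "r = d \<bullet> f d"
    have p': "v \<bullet> f d = p" using sym[of v d] by (simp add: p_def inner_commute)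
    have "v + t *\<^sub>R d \<in> V" using v(1) dV V(1) by (simp add: subspace_add subspace_scale)
    from le[OF this] have "(v + t *\<^sub>R d) \<bullet> f (v + t *\<^sub>R d) \<le> c * ((v + t *\<^sub>R d) \<bullet> (v + t *\<^sub>R d))" .
    moreover have "(v + t *\<^sub>R d) \<bullet> f (v + t *\<^sub>R d) = c + 2 * t * p + t\<^sup>2 * r"
      using f by (simp add: linear_add linear_scale inner_left_distrib inner_right_distrib
          c_def[symmetric] p_def[symmetric] r_def[symmetric] p')
        (simp add: power2_eq_square algebra_simps)
    moreover have "(v + t *\<^sub>R d) \<bullet> (v + t *\<^sub>R d) = 1 + 2 * t * q + t\<^sup>2 * (d \<bullet> d)"
      by (simp add: vv inner_left_distrib inner_right_distrib q_def[symmetric] inner_commute[of v d])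
        (simp add: power2_eq_square algebra_simps)
    moreover have "d \<bullet> d = p - c * q"
      by (subst (2) d_def) (simp add: inner_diff_right p_def q_def)
    ultimately have "c + 2 * t * p + t\<^sup>2 * r \<le> c * (1 + 2 * t * q + t\<^sup>2 * (d \<bullet> d))" and "p = d \<bullet> d + c * q"
      by simp_all
    then show ?thesis by (simp add: r_def[symmetric] algebra_simps)
  qed
  have "d \<bullet> d = 0"
  proof (rule ccontr)
    assume "d \<bullet> d \<noteq> 0"
    then have dd: "d \<bullet> d > 0" by (simp add: less_le)
    define k where "k = \<bar>c * (d \<bullet> d) - d \<bullet> f d\<bar> + 1"
    have k: "k > 0" "c * (d \<bullet> d) - d \<bullet> f d \<le> k" by (auto simp: k_def)
    have "2 * (d \<bullet> d / k) * (d \<bullet> d) \<le> (d \<bullet> d / k)\<^sup>2 * k"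
      using quad[of "d \<bullet> d / k"] mult_left_mono[OF k(2), of "(d \<bullet> d / k)\<^sup>2"] by simp
    then have "(d \<bullet> d) * (d \<bullet> d) \<le> 0" using k(1) by (simp add: power2_eq_square field_simps)
    with mult_pos_pos[OF dd dd] show False by linarith
  qed
  then have "f v = c *\<^sub>R v" by (simp add: d_def)
  with v(1) show ?thesis by auto
qed

text \<open>\<open>B\<close> is an orthonormal basis of the whole space that consists of eigenvectors of \<open>f\<close>. The
  eigenvalue belonging to \<open>b \<in> B\<close> is \<open>b \<bullet> f b\<close>.\<close>
definition eigenbasis :: "('a::euclidean_space \<Rightarrow> 'a) \<Rightarrow> 'a set \<Rightarrow> bool" where
  "eigenbasis f B \<longleftrightarrow> pairwise orthogonal B \<and> (\<forall>b\<in>B. norm b = 1 \<and> (\<exists>c. f b = c *\<^sub>R b)) \<and> span B = UNIV"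

lemma eigenbasis_exists:
  fixes f :: "'a::euclidean_space \<Rightarrow> 'a"
  assumes f: "linear f" and sym: "\<And>v w. f v \<bullet> w = v \<bullet> f w"
  shows "\<exists>B. eigenbasis f B"
proof -
  have "subspace V \<Longrightarrow> (\<And>v. v \<in> V \<Longrightarrow> f v \<in> V) \<Longrightarrow>
     \<exists>B. pairwise orthogonal B \<and> (\<forall>b\<in>B. norm b = 1 \<and> (\<exists>c. f b = c *\<^sub>R b)) \<and> span B = V" for V
  proof (induction "dim V" arbitrary: V rule: less_induct)
    case less
    show ?case
    proof (cases "V = {0}")
      case True
      then show ?thesis by (intro exI[of _ "{}"]) auto
    next
      case False
      obtain v c where v: "v \<in> V" "norm v = 1" "f v = c *\<^sub>R v"
        using selfadjoint_max_eigenvector[OF f sym less.prems(1) False less.prems(2)] by blast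
      have vv: "v \<bullet> v = 1" using v(2) by (simp add: norm_eq_1)
      define W where "W = {w \<in> V. orthogonal v w}"
      have W: "subspace W"
        unfolding W_def using less.prems(1)
        by (auto simp: subspace_def orthogonal_def inner_add_right)
      have Winv: "f w \<in> W" if "w \<in> W" for w
        using that less.prems(2) sym[of v w] v(3) by (auto simp: W_def orthogonal_def)
      have "v \<notin> W" using vv by (simp add: W_def orthogonal_def)
      then have "W \<subset> V" using v(1) by (auto simp: W_def)
      then have "dim W < dim V"
        by (intro dim_psubset)
          (simp only: span_eq_iff[THEN iffD2, OF W] span_eq_iff[THEN iffD2, OF less.prems(1)])
      from less.hyps[OF this W Winv] obtain B where B: "pairwise orthogonal B"
        "\<And>b. b \<in> B \<Longrightarrow> norm b = 1 \<and> (\<exists>c. f b = c *\<^sub>R b)" "span B = W" by blast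
      have BW: "B \<subseteq> W" using B(3) span_superset by blast
      show ?thesis
      proof (intro exI[of _ "insert v B"] conjI ballI)
        show "pairwise orthogonal (insert v B)"
          using B(1) BW by (auto simp: pairwise_insert W_def orthogonal_commute)
        show "norm b = 1" "\<exists>c. f b = c *\<^sub>R b" if "b \<in> insert v B" for b
          using that B(2) v vv by auto
        show "span (insert v B) = V"
        proof
          show "span (insert v B) \<subseteq> V"
            using v(1) BW less.prems(1) by (intro span_minimal) (auto simp: W_def)
          show "V \<subseteq> span (insert v B)"
          proof
            fix x assume x: "x \<in> V"
            have "x - (v \<bullet> x) *\<^sub>R v \<in> W"
              using x v(1) vv less.prems(1)
              by (auto simp: W_def orthogonal_def inner_diff_right subspace_diff subspace_scale)
            then show "x \<in> span (insert v B)" using B(3) by (auto simp: span_insert)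
          qed
        qed
      qed
    qed
  qed
  from this[of UNIV] show ?thesis by (auto simp: eigenbasis_def)
qed

lemma eigenbasis_eigenvalue:
  assumes "eigenbasis f B" "b \<in> B"
  shows "f b = (b \<bullet> f b) *\<^sub>R b"
proof -
  obtain c where c: "f b = c *\<^sub>R b" "norm b = 1" using assms by (auto simp: eigenbasis_def)
  then have "b \<bullet> f b = c" by (simp add: norm_eq_1)
  with c show ?thesis by simp
qed

lemma eigenbasis_finite: "eigenbasis f B \<Longrightarrow> finite B"
  by (auto simp: eigenbasis_def intro!: pairwise_orthogonal_imp_finite)

lemma eigenbasis_inner:
  assumes "eigenbasis f B" "b \<in> B" "b' \<in> B"
  shows "b \<bullet> b' = (if b = b' then 1 else 0)"
  using assms by (auto simp: eigenbasis_def pairwise_def orthogonal_def norm_eq_1)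

lemma eigenbasis_expand:
  assumes "eigenbasis f B"
  shows "(\<Sum>b\<in>B. (v \<bullet> b) *\<^sub>R b) = v"
proof -
  have "v \<in> span B" using assms by (simp add: eigenbasis_def)
  then show ?thesis
  proof (induction rule: span_induct_alt)
    case base
    show ?case by simp
  next
    case (step c b v)
    have "(\<Sum>b'\<in>B. ((c *\<^sub>R b + v) \<bullet> b') *\<^sub>R b')
        = (\<Sum>b'\<in>B. (if b' = b then c *\<^sub>R b else 0)) + (\<Sum>b'\<in>B. (v \<bullet> b') *\<^sub>R b')"
      unfolding sum.distrib[symmetric] using step(1)
      by (intro sum.cong refl) (auto simp: inner_add_left eigenbasis_inner[OF assms] scaleR_add_left)
    also have "\<dots> = c *\<^sub>R b + v"
      using step eigenbasis_finite[OF assms] by simp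
    finally show ?case .
  qed
qed

text \<open>The functional calculus: \<open>\<phi> f\<close> is the operator that multiplies each eigenvector \<open>b \<in> B\<close> of \<open>f\<close> by
  the value of \<open>\<phi>\<close> at its eigenvalue.\<close>
definition fun_calc :: "('a::euclidean_space \<Rightarrow> 'a) \<Rightarrow> 'a set \<Rightarrow> (real \<Rightarrow> real) \<Rightarrow> 'a \<Rightarrow> 'a" where
  "fun_calc f B \<phi> v = (\<Sum>b\<in>B. (\<phi> (b \<bullet> f b) * (v \<bullet> b)) *\<^sub>R b)"

lemma linear_fun_calc: "linear (fun_calc f B \<phi>)"
  unfolding fun_calc_def
  by (intro linearI) (auto simp: inner_add_left algebra_simps sum.distrib scaleR_sum_right)

lemma fun_calc_basis:
  assumes "eigenbasis f B" "b \<in> B"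
  shows "fun_calc f B \<phi> b = \<phi> (b \<bullet> f b) *\<^sub>R b"
proof -
  have "fun_calc f B \<phi> b = (\<Sum>b'\<in>B. if b' = b then \<phi> (b \<bullet> f b) *\<^sub>R b else 0)"
    unfolding fun_calc_def using assms(2)
    by (intro sum.cong refl) (auto simp: eigenbasis_inner[OF assms(1)])
  then show ?thesis using assms(2) eigenbasis_finite[OF assms(1)] by simp
qed

lemma eigenbasis_eq:
  assumes B: "eigenbasis f B" and "linear g" "linear h" "\<And>b. b \<in> B \<Longrightarrow> g b = h b"
  shows "g = h"
proof
  fix v
  have "g v = g (\<Sum>b\<in>B. (v \<bullet> b) *\<^sub>R b)" by (simp add: eigenbasis_expand[OF B])
  also have "\<dots> = h (\<Sum>b\<in>B. (v \<bullet> b) *\<^sub>R b)"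
    using assms(2-) by (simp add: linear_sum linear_scale)
  also have "\<dots> = h v" by (simp add: eigenbasis_expand[OF B])
  finally show "g v = h v" .
qed

lemma fun_calc_id: "eigenbasis f B \<Longrightarrow> linear f \<Longrightarrow> fun_calc f B (\<lambda>t. t) = f"
  by (rule eigenbasis_eq) (auto simp: linear_fun_calc fun_calc_basis eigenbasis_eigenvalue[symmetric])

lemma fun_calc_one: "eigenbasis f B \<Longrightarrow> fun_calc f B (\<lambda>t. 1) v = v"
  by (simp add: fun_calc_def eigenbasis_expand)

lemma fun_calc_compose:
  assumes "eigenbasis f B"
  shows "fun_calc f B \<phi> (fun_calc f B \<psi> v) = fun_calc f B (\<lambda>t. \<phi> t * \<psi> t) v"
proof -
  have "fun_calc f B \<phi> \<circ> fun_calc f B \<psi> = fun_calc f B (\<lambda>t. \<phi> t * \<psi> t)"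
    using assms by (intro eigenbasis_eq[OF assms])
      (auto simp: linear_fun_calc linear_compose fun_calc_basis linear_scale mult.commute)
  then show ?thesis by (metis comp_apply)
qed

lemma fun_calc_add:
  "fun_calc f B \<phi> v + fun_calc f B \<psi> v = fun_calc f B (\<lambda>t. \<phi> t + \<psi> t) v"
  by (simp add: fun_calc_def sum.distrib[symmetric] algebra_simps)

lemma fun_calc_diff:
  "fun_calc f B \<phi> v - fun_calc f B \<psi> v = fun_calc f B (\<lambda>t. \<phi> t - \<psi> t) v"
  by (simp add: fun_calc_def sum_subtractf[symmetric] algebra_simps)

lemma fun_calc_scale:
  "c *\<^sub>R fun_calc f B \<phi> v = fun_calc f B (\<lambda>t. c * \<phi> t) v"
  by (simp add: fun_calc_def scaleR_sum_right algebra_simps)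

lemma fun_calc_cong:
  assumes "\<And>b. b \<in> B \<Longrightarrow> \<phi> (b \<bullet> f b) = \<psi> (b \<bullet> f b)"
  shows "fun_calc f B \<phi> v = fun_calc f B \<psi> v"
  unfolding fun_calc_def using assms by (intro sum.cong) auto

lemma fun_calc_inner:
  "fun_calc f B \<phi> v \<bullet> w = (\<Sum>b\<in>B. \<phi> (b \<bullet> f b) * (v \<bullet> b) * (w \<bullet> b))"
  by (simp add: fun_calc_def inner_sum_left inner_commute[of w])

lemma fun_calc_selfadjoint: "fun_calc f B \<phi> v \<bullet> w = v \<bullet> fun_calc f B \<phi> w"
  unfolding inner_commute[of v "fun_calc f B \<phi> w"] by (simp only: fun_calc_inner mult.assoc mult.commute[of "w \<bullet> b" for b])

lemma fun_calc_psd: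
  assumes "\<And>b. b \<in> B \<Longrightarrow> 0 \<le> \<phi> (b \<bullet> f b)"
  shows "0 \<le> v \<bullet> fun_calc f B \<phi> v"
  unfolding inner_commute[of v "fun_calc f B \<phi> v"] fun_calc_inner mult.assoc
  using assms by (intro sum_nonneg mult_nonneg_nonneg[OF _ zero_le_square]) auto

lemma fun_calc_norm_le:
  assumes B: "eigenbasis f B" and "\<And>b. b \<in> B \<Longrightarrow> \<bar>\<phi> (b \<bullet> f b)\<bar> \<le> c" "0 \<le> c"
  shows "norm (fun_calc f B \<phi> v) \<le> c * norm v"
proof -
  have "(norm v)\<^sup>2 = fun_calc f B (\<lambda>_. 1) v \<bullet> v"
    by (simp only: fun_calc_one[OF B] power2_norm_eq_inner)
  then have n: "(norm v)\<^sup>2 = (\<Sum>b\<in>B. (v \<bullet> b)\<^sup>2)"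
    by (simp only: fun_calc_inner power2_eq_square[of "v \<bullet> b" for b] mult_1)
  have "(norm (fun_calc f B \<phi> v))\<^sup>2 = fun_calc f B \<phi> (fun_calc f B \<phi> v) \<bullet> v"
    by (simp only: power2_norm_eq_inner fun_calc_selfadjoint[of f B \<phi> "fun_calc f B \<phi> v" v])
  also have "\<dots> = (\<Sum>b\<in>B. (\<phi> (b \<bullet> f b))\<^sup>2 * (v \<bullet> b)\<^sup>2)"
    by (simp only: fun_calc_compose[OF B] fun_calc_inner power2_eq_square mult.assoc)
  also have "\<dots> \<le> (\<Sum>b\<in>B. c\<^sup>2 * (v \<bullet> b)\<^sup>2)"
    using assms(2,3) by (intro sum_mono mult_right_mono) (auto simp: abs_le_square_iff[symmetric])
  also have "\<dots> = (c * norm v)\<^sup>2"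
    by (simp add: n sum_distrib_left power_mult_distrib)
  finally show ?thesis by (rule power2_le_imp_le) (use assms(3) in simp)
qed

text \<open>If \<open>f b = c b\<close> with \<open>c \<ge> 0\<close> then \<open>d = g b - c b\<close> satisfies \<open>g d = - c d\<close>, which positivity of \<open>g\<close>
  excludes unless \<open>c = 0\<close> or \<open>d = 0\<close>. Hence \<open>g\<close> agrees with \<open>f\<close> on an eigenbasis of \<open>f\<close>.\<close>
lemma psd_sqrt_unique:
  fixes f g :: "'a::euclidean_space \<Rightarrow> 'a"
  assumes f: "linear f" "\<And>v w. f v \<bullet> w = v \<bullet> f w" "\<And>v. 0 \<le> v \<bullet> f v"
    and g: "linear g" "\<And>v w. g v \<bullet> w = v \<bullet> g w" "\<And>v. 0 \<le> v \<bullet> g v"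
    and eq: "\<And>v. f (f v) = g (g v)"
  shows "f = g"
proof -
  obtain B where B: "eigenbasis f B" using eigenbasis_exists[OF f(1,2)] by blast
  show ?thesis
  proof (rule eigenbasis_eq[OF B f(1) g(1)])
    fix b assume b: "b \<in> B"
    define c where "c = b \<bullet> f b"
    have fb: "f b = c *\<^sub>R b" unfolding c_def by (rule eigenbasis_eigenvalue[OF B b])
    have c: "c \<ge> 0" using f(3) by (simp add: c_def)
    have gg: "g (g b) = (c * c) *\<^sub>R b" using eq[of b] f(1) by (simp add: fb linear_scale)
    define d where "d = g b - c *\<^sub>R b"
    have "g d = - c *\<^sub>R d"
      using g(1) gg by (simp add: d_def linear_diff linear_scale scaleR_diff_right)
    then have "0 \<le> - c * (d \<bullet> d)" using g(3)[of d] by simp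
    have "d = 0"
    proof (cases "c = 0")
      case True
      have "g b \<bullet> g b = b \<bullet> g (g b)" using g(2) by blast
      then show ?thesis using gg True by (simp add: d_def)
    next
      case False
      with c \<open>0 \<le> - c * (d \<bullet> d)\<close> have "d \<bullet> d \<le> 0" by (simp add: mult_le_0_iff)
      then show ?thesis by (metis inner_ge_zero inner_eq_zero_iff order_antisym)
    qed
    then show "f b = g b" by (simp add: d_def fb)
  qed
qed

lemma psd_sqrt_eqI:
  fixes A R :: "real^'n^'n"
  assumes "transpose R = R" "\<And>v. 0 \<le> v \<bullet> (R *v v)" "R ** R = A"
  shows "psd_sqrt A = R"
  unfolding psd_sqrt_def
proof (rule the_equality)
  fix B :: "real^'n^'n"
  assume B: "transpose B = B \<and> (\<forall>v. 0 \<le> v \<bullet> (B *v v)) \<and> B ** B = A"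
  have sym: "(M *v v) \<bullet> w = v \<bullet> (M *v w)" if "transpose M = M" for M :: "real^'n^'n" and v w
    using that dot_lmul_matrix[of v M w] by (simp add: transpose_matrix_vector[symmetric])
  have "(*v) B = (*v) R"
  proof (rule psd_sqrt_unique)
    show "B *v (B *v v) = R *v (R *v v)" for v
      using assms(3) B by (simp add: matrix_vector_mul_assoc)
  qed (use assms B sym[of B] sym[of R] in \<open>simp_all only: matrix_vector_mul_linear\<close>)
  then show "B = R" by (simp add: matrix_eq)
qed (use assms in auto)

section \<open>Two factors of the same operator differ by an orthogonal transformation\<close>

text \<open>Since \<open>A w\<close> and \<open>B w\<close> always have the same norm, \<open>A w \<mapsto> B w\<close> is a well-defined linear isometry
  between the ranges.\<close>
lemma equal_gram_intertwine:
  fixes A B :: "'b::euclidean_space \<Rightarrow> 'a::euclidean_space"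
  assumes A: "linear A" and B: "linear B" and n: "\<And>w. norm (A w) = norm (B w)"
  obtains \<psi> where "linear \<psi>" "\<And>w. \<psi> (A w) = B w"
proof -
  obtain s where s: "linear s" "\<And>y. y \<in> range A \<Longrightarrow> A (s y) = y"
    using linear_exists_right_inverse_on[OF A subspace_UNIV] by blast
  show ?thesis
  proof
    show "linear (B \<circ> s)" using s(1) B by (rule linear_compose)
    fix w
    have "norm (B (s (A w)) - B w) = norm (A (s (A w)) - A w)"
      using n[of "s (A w) - w"] A B by (simp add: linear_diff)
    then show "(B \<circ> s) (A w) = B w" using s(2) by simp
  qed
qed

text \<open>The isometry between the ranges extends to the whole space, because the orthogonal complements of
  the ranges have equal dimension.\<close>
lemma equal_gram_orthogonal:
  fixes A B :: "'b::euclidean_space \<Rightarrow> 'a::euclidean_space"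
  assumes A: "linear A" and B: "linear B" and n: "\<And>w. norm (A w) = norm (B w)"
  obtains R where "orthogonal_transformation R" "\<And>w. R (A w) = B w"
proof -
  obtain \<psi> where \<psi>: "linear \<psi>" "\<And>w. \<psi> (A w) = B w" using equal_gram_intertwine[OF A B n] by blast
  obtain \<psi>' where \<psi>': "linear \<psi>'" "\<And>w. \<psi>' (B w) = A w" using equal_gram_intertwine[OF B A n[symmetric]] by blast
  define U V where "U = range A" and "V = range B"
  define U' V' where "U' = {y. \<forall>x\<in>U. orthogonal x y}" and "V' = {y. \<forall>x\<in>V. orthogonal x y}"
  have sub: "subspace U" "subspace V"
    using A B by (auto simp: U_def V_def intro!: linear_subspace_image)
  have sub': "subspace U'" "subspace V'"
    unfolding U'_def V'_def by (rule subspace_orthogonal_to_vectors)+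
  have "V = \<psi> ` U" "U = \<psi>' ` V" by (auto simp: U_def V_def \<psi> \<psi>' image_image)
  then have "dim U = dim V" using \<psi>(1) \<psi>'(1) dim_image_le[of \<psi> U] dim_image_le[of \<psi>' V] by simp
  moreover have "dim U' + dim U = DIM('a)" "dim V' + dim V = DIM('a)"
    using dim_subspace_orthogonal_to_vectors[OF sub(1) subspace_UNIV] 
      dim_subspace_orthogonal_to_vectors[OF sub(2) subspace_UNIV] by (auto simp: U'_def V'_def)
  ultimately have "dim U' = dim V'" by simp
  then obtain h where h: "linear h" "h ` U' = V'" "\<And>x. x \<in> U' \<Longrightarrow> norm (h x) = norm x"
    using isometry_subspaces[OF sub'] by blast
  obtain BU where BU: "BU \<subseteq> U" "pairwise orthogonal BU" "\<And>x. x \<in> BU \<Longrightarrow> norm x = 1" "span BU = U"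
    using orthonormal_basis_subspace[OF sub(1)] by metis
  obtain BU' where BU': "BU' \<subseteq> U'" "pairwise orthogonal BU'" "\<And>x. x \<in> BU' \<Longrightarrow> norm x = 1" "span BU' = U'"
    using orthonormal_basis_subspace[OF sub'(1)] by metis
  have disj: "BU \<inter> BU' = {}"
  proof (rule ccontr)
    assume "BU \<inter> BU' \<noteq> {}"
    then obtain b where "b \<in> BU" "b \<in> BU'" by blast
    then have "orthogonal b b" "norm b = 1" using BU(1,3) BU'(1) by (auto simp: U'_def)
    then show False by (simp add: orthogonal_def)
  qed
  have "pairwise orthogonal (BU \<union> BU')"
  proof (rule pairwiseI)
    fix x y assume "x \<in> BU \<union> BU'" "y \<in> BU \<union> BU'" "x \<noteq> y"
    moreover have "orthogonal x y" if "x \<in> BU" "y \<in> BU'" for x y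
      using that BU(1) BU'(1) by (auto simp: U'_def)
    moreover have "orthogonal x y" if "x \<in> BU'" "y \<in> BU" for x y
      using that BU(1) BU'(1) by (auto simp: U'_def orthogonal_commute)
    ultimately show "orthogonal x y"
      using BU(2) BU'(2) by (auto simp: pairwise_def)
  qed
  moreover have "0 \<notin> BU \<union> BU'" using BU(3) BU'(3) by force
  ultimately have "independent (BU \<union> BU')" by (rule pairwise_orthogonal_independent)
  then obtain R where R: "linear R" "\<And>x. x \<in> BU \<union> BU' \<Longrightarrow> R x = (if x \<in> BU then \<psi> x else h x)"
    using linear_independent_extend[of "BU \<union> BU'" "\<lambda>x. if x \<in> BU then \<psi> x else h x"] by blast
  have RU: "R u = \<psi> u" if "u \<in> U" for u
    using that BU(4) R by (intro linear_eq_on[OF R(1) \<psi>(1), of u BU]) auto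
  have RU': "R u = h u" if "u \<in> U'" for u
    using that BU'(4) R disj by (intro linear_eq_on[OF R(1) h(1), of u BU']) auto
  have RA: "R (A w) = B w" for w using RU[of "A w"] \<psi>(2) by (simp add: U_def)
  have "norm (R x) = norm x" for x
  proof -
    obtain y z where yz: "y \<in> span U" "\<And>w. w \<in> span U \<Longrightarrow> orthogonal z w" "x = y + z"
      using orthogonal_subspace_decomp_exists[of U x] by metis
    have spU: "span U = U" using sub(1) by (rule span_eq_iff[THEN iffD2])
    have y: "y \<in> U" and z: "z \<in> U'" using yz(1,2) by (auto simp: spU U'_def orthogonal_commute)
    obtain w where w: "y = A w" using y by (auto simp: U_def)
    have "R y = B w" using RA by (simp add: w)
    moreover have "R z \<in> V'" "norm (R z) = norm z" using RU'[OF z] h z by auto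
    ultimately have o: "orthogonal (R y) (R z)" "norm (R y) = norm y"
      using n[of w] by (auto simp: V'_def V_def w)
    have "(norm (R x))\<^sup>2 = (norm (R y))\<^sup>2 + (norm (R z))\<^sup>2"
      using R(1) o(1) by (simp add: yz(3) linear_add norm_add_Pythagorean)
    also have "\<dots> = (norm x)\<^sup>2"
      using yz(2)[OF yz(1)] o(2) \<open>norm (R z) = norm z\<close>
      by (simp add: yz(3) norm_add_Pythagorean orthogonal_commute)
    finally show ?thesis by (simp add: power2_eq_iff_nonneg)
  qed
  then show ?thesis using R(1) RA by (intro that[of R]) (auto simp: orthogonal_transformation)
qed

lemma equal_covariance_factor:
  fixes A B :: "'a::euclidean_space \<Rightarrow> 'b::euclidean_space"
  assumes A: "linear A" and B: "linear B" and eq: "A \<circ> adjoint A = B \<circ> adjoint B"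
  obtains Q where "orthogonal_transformation Q" "B = A \<circ> Q"
proof -
  have "norm (adjoint A w) = norm (adjoint B w)" for w
  proof -
    have "adjoint A w \<bullet> adjoint A w = adjoint B w \<bullet> adjoint B w"
      using fun_cong[OF eq, of w] by (simp add: adjoint_works[OF A] adjoint_works[OF B])
    then show ?thesis by (simp add: norm_eq_sqrt_inner)
  qed
  then obtain R where R: "orthogonal_transformation R" "\<And>w. R (adjoint A w) = adjoint B w"
    using equal_gram_orthogonal[OF adjoint_linear[OF A] adjoint_linear[OF B]] by blast
  have RR: "R (inv R z) = z" for z
    using orthogonal_transformation_surj[OF R(1)] by (rule surj_f_inv_f)
  show ?thesis
  proof
    show "orthogonal_transformation (inv R)" using R(1) by (rule orthogonal_transformation_inv)
    show "B = A \<circ> inv R"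
    proof
      fix z
      have "B z \<bullet> w = A (inv R z) \<bullet> w" for w
      proof -
        have "B z \<bullet> w = R (inv R z) \<bullet> R (adjoint A w)"
          by (simp add: RR R(2) adjoint_works[OF B])
        also have "\<dots> = inv R z \<bullet> adjoint A w"
          using R(1) by (simp add: orthogonal_transformation_def)
        also have "\<dots> = A (inv R z) \<bullet> w" by (rule adjoint_works[OF A])
        finally show ?thesis .
      qed
      then show "B z = (A \<circ> inv R) z" by (metis comp_apply vector_eq_rdot)
    qed
  qed
qed


section \<open>The entropic optimal coupling\<close>

lemma linear_continuous_on_compose:
  fixes f :: "'a::euclidean_space \<Rightarrow> 'b::euclidean_space"
  assumes "linear f" "continuous_on S g"
  shows "continuous_on S (\<lambda>x. f (g x))"
  using assms by (auto simp: linear_conv_bounded_linear intro: bounded_linear.continuous_on)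

text \<open>A Gaussian law may be represented with any square factor of its covariance, including a singular
  one: two factors differ by an orthogonal transformation, and \<open>std_gaussian\<close> is invariant under it.\<close>
lemma is_gaussian_eq_distr:
  fixes M :: "'a::euclidean_space measure" and B C :: "'a \<Rightarrow> 'a"
  assumes "is_gaussian M m C" and B: "linear B" "\<And>x. B (adjoint B x) = C x"
  shows "M = distr std_gaussian borel (\<lambda>z. m + B z)"
proof -
  obtain A :: "'a \<Rightarrow> 'a" where A: "linear A" "A \<circ> adjoint A = C" "M = distr std_gaussian borel (\<lambda>z. m + A z)"
    using assms(1) unfolding is_gaussian_def by blast
  have "A \<circ> adjoint A = B \<circ> adjoint B" using A(2) B(2) by auto
  then obtain Q where Q: "orthogonal_transformation Q" "B = A \<circ> Q"
    using equal_covariance_factor[OF A(1) B(1)] by blast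
  note [measurable] = linear_measurable[OF A(1)] linear_measurable[OF orthogonal_transformation_linear[OF Q(1)]]
  have "distr std_gaussian borel (\<lambda>z. m + A z) = distr (distr std_gaussian borel Q) borel (\<lambda>z. m + A z)"
    by (simp add: std_gaussian_orthogonal[OF Q(1)])
  also have "\<dots> = distr std_gaussian borel (\<lambda>z. m + B z)"
    by (subst distr_distr) (auto simp: comp_def Q(2))
  finally show ?thesis using A(3) by simp
qed

text \<open>
  The data of the problem, as operators. \<open>H H\<^sup>T\<close> is the covariance of \<open>X\<close> and \<open>F\<close> the regression operator
  of \<open>Y\<close> on \<open>X\<close>; \<open>Lo\<close> is the symmetric root of the residual covariance and \<open>Le\<close> the cross covariance of
  \<open>U\<close> and \<open>Y\<close> under the optimal coupling for the parameter \<open>e\<close>, with symmetric root \<open>Th\<close>. The operators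
  \<open>Hi\<close>, \<open>Loi\<close>, \<open>Thi\<close> are the inverses of \<open>H\<close>, \<open>Lo\<close>, \<open>Th\<close>. Standard normal noise is written
  \<open>(u, z3, z2)\<close>, where \<open>z3\<close> drives \<open>X\<close> and \<open>z2\<close> drives the residual.
\<close>
locale entropic_gaussian =
  fixes H Hi :: "'x::euclidean_space \<Rightarrow> 'x" and F :: "'x \<Rightarrow> 'u::euclidean_space"
    and Lo Loi Le Th Thi :: "'u \<Rightarrow> 'u" and m :: 'u and e :: real
  assumes linear: "linear H" "linear Hi" "linear F" "linear Lo" "linear Loi" "linear Le" "linear Th" "linear Thi"
    and inverse: "\<And>x. H (Hi x) = x" "\<And>x. Hi (H x) = x" "\<And>v. Lo (Loi v) = v" "\<And>v. Loi (Lo v) = v"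
      "\<And>v. Th (Thi v) = v" "\<And>v. Thi (Th v) = v"
    and selfadjoint: "\<And>v w. Lo v \<bullet> w = v \<bullet> Lo w" "\<And>v w. Le v \<bullet> w = v \<bullet> Le w" "\<And>v w. Th v \<bullet> w = v \<bullet> Th w"
    and Th_Th: "\<And>v. Th (Th v) = Le v"
    and Le_eq: "\<And>v. Le (Le v) + e *\<^sub>R Le v = Lo (Lo v)"
    and e: "e > 0"
begin

lemmas linear_simps = linear[THEN linear_add] linear[THEN linear_diff] linear[THEN linear_scale] linear[THEN linear_0]

lemmas linear_continuous [continuous_intros] = linear[THEN linear_continuous_on_compose]

text \<open>\<open>nu\<close> is the law of \<open>(X, Y)\<close>, with \<open>regressor\<close> a factor of its covariance.\<close>
definition regressor :: "'x \<times> 'u \<Rightarrow> 'x \<times> 'u" where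
  "regressor = (\<lambda>(z3, z2). (H z3, F (H z3) + Lo z2))"

definition nu :: "('x \<times> 'u) measure" where
  "nu = distr std_gaussian borel (\<lambda>z. (0, m) + regressor z)"

text \<open>Under the optimal coupling \<open>opt\<close> the conditional law of \<open>(X, Y)\<close> given \<open>U = u\<close> is \<open>kern u\<close>; its
  covariance, with factor \<open>cond_factor\<close>, does not depend on \<open>u\<close>.\<close>
definition cond_factor :: "'x \<times> 'u \<Rightarrow> 'x \<times> 'u" where
  "cond_factor = (\<lambda>(z3, z2). (H z3, F (H z3) + sqrt e *\<^sub>R Th z2))"

definition kern :: "'u \<Rightarrow> ('x \<times> 'u) measure" where
  "kern u = distr std_gaussian borel (\<lambda>z. (0, m + Le u) + cond_factor z)"

definition opt :: "('u \<times> 'x \<times> 'u) measure" where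
  "opt = distr std_gaussian borel (\<lambda>(u, z). (u, (0, m + Le u) + cond_factor z))"

text \<open>The regression residual of \<open>y\<close> on \<open>x\<close>.\<close>
definition resid :: "'x \<times> 'u \<Rightarrow> 'u" where
  "resid = (\<lambda>(x, y). y - m - F x)"

text \<open>The logarithm, up to an additive constant, of the density of \<open>kern u\<close> with respect to \<open>nu\<close>. The
  point is that \<open>u\<close> and \<open>(x, y)\<close> interact only through \<open>u \<bullet> resid (x, y) / e\<close>.\<close>
definition log_ratio :: "'u \<Rightarrow> 'x \<times> 'u \<Rightarrow> real" where
  "log_ratio u w = (u \<bullet> resid w - u \<bullet> Le u / 2 - (norm (Thi (resid w)))\<^sup>2 / 2) / e + (norm (Loi (resid w)))\<^sup>2 / 2"

lemma linear_regressor: "linear regressor" and linear_cond_factor: "linear cond_factor"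
  unfolding regressor_def cond_factor_def
  by (auto intro!: linearI simp: linear_simps algebra_simps scaleR_add_right)

lemma continuous_resid [continuous_intros]: "continuous_on S g \<Longrightarrow> continuous_on S (\<lambda>x. resid (g x))"
  unfolding resid_def case_prod_beta by (intro continuous_intros)

lemma continuous_regressor [continuous_intros]: "continuous_on S g \<Longrightarrow> continuous_on S (\<lambda>x. regressor (g x))"
  by (rule linear_continuous_on_compose[OF linear_regressor])

lemma continuous_cond_factor [continuous_intros]: "continuous_on S g \<Longrightarrow> continuous_on S (\<lambda>x. cond_factor (g x))"
  by (rule linear_continuous_on_compose[OF linear_cond_factor])

lemma continuous_log_ratio [continuous_intros]:
  "continuous_on S f \<Longrightarrow> continuous_on S g \<Longrightarrow> continuous_on S (\<lambda>x. log_ratio (f x) (g x))"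
  unfolding log_ratio_def using e by (intro continuous_intros) auto

lemma measurable_factors [measurable]: "regressor \<in> borel_measurable borel" "cond_factor \<in> borel_measurable borel"
  by (intro linear_measurable linear_regressor linear_cond_factor)+

lemma measurable_log_ratio [measurable]: "(\<lambda>(u, w). log_ratio u w) \<in> borel_measurable borel"
  "log_ratio u \<in> borel_measurable borel"
  unfolding case_prod_beta
  by (intro borel_measurable_continuous_onI continuous_intros continuous_on_fst continuous_on_snd)+

text \<open>The normalizing constant \<open>C\<close> does not depend on \<open>u\<close>.\<close>
lemma kern_density: "\<exists>C. \<forall>u. kern u = density nu (\<lambda>w. ennreal (exp (C + log_ratio u w)))"
proof -
  define R1 :: "'x \<times> 'u \<Rightarrow> 'x \<times> 'u" where "R1 = (\<lambda>(x, y). (Hi x, (1 / sqrt e) *\<^sub>R Thi (y - F x)))"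
  define R0 :: "'x \<times> 'u \<Rightarrow> 'x \<times> 'u" where "R0 = (\<lambda>(x, y). (Hi x, Loi (y - F x)))"
  have lin: "linear R1" "linear R0"
    unfolding R1_def R0_def
    by (auto intro!: linearI simp: linear_simps algebra_simps scaleR_add_right)
  have inv1: "R1 (cond_factor z) = z" "cond_factor (R1 z) = z" for z
    using e by (auto simp: R1_def cond_factor_def case_prod_beta inverse linear_simps)
  have inv0: "R0 (regressor z) = z" "regressor (R0 z) = z" for z
    by (auto simp: R0_def regressor_def case_prod_beta inverse linear_simps)
  obtain c1 where c1: "c1 > 0" "\<And>v. distr std_gaussian borel (\<lambda>z. v + cond_factor z) =
       density lborel (\<lambda>y. ennreal (c1 * exp (- (norm (R1 (y - v)))\<^sup>2 / 2)))"
    using distr_std_gaussian_density[OF linear_cond_factor lin(1) inv1] by metis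
  obtain c0 where c0: "c0 > 0" "\<And>v. distr std_gaussian borel (\<lambda>z. v + regressor z) =
       density lborel (\<lambda>y. ennreal (c0 * exp (- (norm (R0 (y - v)))\<^sup>2 / 2)))"
    using distr_std_gaussian_density[OF linear_regressor lin(2) inv0] by metis
  \<comment> \<open>cross terms: \<open>Thi r \<bullet> Thi (Le u) = r \<bullet> u\<close> because \<open>Th\<close> is a symmetric root of \<open>Le\<close>\<close>
  have expand: "(norm (R1 (w - (0, m + Le u))))\<^sup>2 / 2 = (norm (R0 (w - (0, m))))\<^sup>2 / 2 - log_ratio u w" for u w
  proof -
    obtain x y where w: "w = (x, y)" by (cases w)
    define r where "r = resid w"
    have r: "y - (m + Le u) - F x = r - Le u" "y - m - F x = r" by (auto simp: r_def resid_def w)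
    have "Thi (r - Le u) = Thi r - Th u"
      using Th_Th[of u] inverse(6)[of "Th u"] by (simp add: linear_simps)
    moreover have "Thi r \<bullet> Th u = r \<bullet> u" using selfadjoint(3)[of "Thi r" u] by (simp add: inverse)
    moreover have "Th u \<bullet> Th u = u \<bullet> Le u" using selfadjoint(3)[of u "Th u"] Th_Th by simp
    ultimately have n: "(norm (Thi (r - Le u)))\<^sup>2 = (norm (Thi r))\<^sup>2 - 2 * (r \<bullet> u) + u \<bullet> Le u"
      by (simp add: power2_norm_eq_inner inner_diff_left inner_diff_right inner_commute[of "Th u" "Thi r"])
    have "(norm (R1 (w - (0, m + Le u))))\<^sup>2 = (norm (Hi x))\<^sup>2 + (norm (Thi (r - Le u)))\<^sup>2 / e"
      using e by (simp add: R1_def w norm_Pair r(1) power_divide)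
    moreover have "(norm (R0 (w - (0, m))))\<^sup>2 = (norm (Hi x))\<^sup>2 + (norm (Loi r))\<^sup>2"
      by (simp add: R0_def w norm_Pair r(2))
    ultimately show ?thesis
      using e unfolding log_ratio_def r_def[symmetric] n inner_commute[of u r] by (simp add: field_simps)
  qed
  have "kern u = density nu (\<lambda>w. ennreal (exp (ln (c1 / c0) + log_ratio u w)))" for u
  proof -
    have m0 [measurable]: "R0 \<in> borel_measurable borel" using lin(2) by (rule linear_measurable)
    have "density nu (\<lambda>w. ennreal (exp (ln (c1 / c0) + log_ratio u w))) =
      density lborel (\<lambda>w. ennreal (c0 * exp (- (norm (R0 (w - (0, m))))\<^sup>2 / 2)) * ennreal (exp (ln (c1 / c0) + log_ratio u w)))"
      unfolding nu_def c0(2) by (rule density_density_eq) measurable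
    also have "\<dots> = density lborel (\<lambda>w. ennreal (c1 * exp (- (norm (R1 (w - (0, m + Le u))))\<^sup>2 / 2)))"
    proof (intro arg_cong[of _ _ "density lborel"] ext)
      fix w
      show "ennreal (c0 * exp (- (norm (R0 (w - (0, m))))\<^sup>2 / 2)) * ennreal (exp (ln (c1 / c0) + log_ratio u w))
          = ennreal (c1 * exp (- (norm (R1 (w - (0, m + Le u))))\<^sup>2 / 2))"
        using c0(1) c1(1) unfolding minus_divide_left[symmetric] expand
        by (simp add: ennreal_mult'[symmetric] exp_add[symmetric] exp_diff exp_minus exp_add field_simps)
    qed
    finally show ?thesis by (simp add: kern_def c1(2))
  qed
  then show ?thesis by blast
qed

lemma prob_space_nu: "prob_space nu" and prob_space_kern: "prob_space (kern u)"
  unfolding nu_def kern_def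
  by (auto intro!: prob_space.prob_space_distr prob_space_std_gaussian)

lemma sets_nu [simp, measurable_cong]: "sets nu = sets borel" and space_nu [simp]: "space nu = UNIV"
  and sets_opt [simp, measurable_cong]: "sets opt = sets borel"
  and sets_kern [simp, measurable_cong]: "sets (kern u) = sets borel" 
  by (auto simp: nu_def opt_def kern_def)

lemma nn_integral_opt:
  assumes [measurable]: "f \<in> borel_measurable borel"
  shows "(\<integral>\<^sup>+w. f w \<partial>opt) = (\<integral>\<^sup>+u. \<integral>\<^sup>+w. f (u, w) \<partial>kern u \<partial>std_gaussian)"
proof -
  interpret g: prob_space "std_gaussian :: ('x \<times> 'u) measure" by (rule prob_space_std_gaussian)
  have c: "(\<lambda>(u, z). (u, (0, m + Le u) + cond_factor z)) \<in> borel_measurable borel"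
    unfolding case_prod_beta
    by (intro borel_measurable_continuous_onI continuous_intros continuous_on_fst continuous_on_snd)
  then have c': "(\<lambda>(u, z). (u, (0, m + Le u) + cond_factor z)) \<in> (std_gaussian \<Otimes>\<^sub>M std_gaussian) \<rightarrow>\<^sub>M borel"
    by (simp only: std_gaussian_prod[symmetric] measurable_cong_sets[OF sets_std_gaussian refl])
  have ck: "(\<lambda>z. (0, m + Le u) + cond_factor z) \<in> borel_measurable borel" for u
    by (intro borel_measurable_continuous_onI continuous_intros)
  have fu: "(\<lambda>w. f (u, w)) \<in> borel_measurable borel" for u
    by measurable
  have "(\<integral>\<^sup>+w. f w \<partial>opt) = (\<integral>\<^sup>+z. f ((\<lambda>(u, z). (u, (0, m + Le u) + cond_factor z)) z) \<partial>(std_gaussian \<Otimes>\<^sub>M std_gaussian))"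
    unfolding opt_def std_gaussian_prod[where 'a='u and 'b="'x \<times> 'u"] using c' by (subst nn_integral_distr) auto
  also have "\<dots> = (\<integral>\<^sup>+u. \<integral>\<^sup>+z. f (u, (0, m + Le u) + cond_factor z) \<partial>std_gaussian \<partial>std_gaussian)"
    using c' by (subst g.nn_integral_fst[symmetric]) (auto simp: case_prod_beta cong: measurable_cong_sets)
  also have "\<dots> = (\<integral>\<^sup>+u. \<integral>\<^sup>+w. f (u, w) \<partial>kern u \<partial>std_gaussian)"
    unfolding kern_def using ck fu by (subst nn_integral_distr) auto
  finally show ?thesis .
qed

lemma opt_density:
  obtains C where "opt = density (std_gaussian \<Otimes>\<^sub>M nu) (\<lambda>(u, w). ennreal (exp (C + log_ratio u w)))"
proof -
  obtain C where C: "\<And>u. kern u = density nu (\<lambda>w. ennreal (exp (C + log_ratio u w)))"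
    using kern_density by blast
  interpret nu: prob_space nu by (rule prob_space_nu)
  have sets: "sets (std_gaussian \<Otimes>\<^sub>M nu) = sets (borel :: ('u \<times> 'x \<times> 'u) measure)"
    using sets_pair_measure_cong[OF sets_std_gaussian sets_nu] by (simp only: borel_prod)
  have m1: "(\<lambda>(u, w). ennreal (exp (C + log_ratio u w))) \<in> borel_measurable (std_gaussian \<Otimes>\<^sub>M nu)"
    unfolding measurable_cong_sets[OF sets refl]
    using measurable_log_ratio(1) unfolding case_prod_beta by measurable
  have "opt = density (std_gaussian \<Otimes>\<^sub>M nu) (\<lambda>(u, w). ennreal (exp (C + log_ratio u w)))" (is "_ = ?r")
  proof (rule measure_eqI)
    show "sets opt = sets ?r" by (simp only: sets sets_density sets_opt)
    fix A assume "A \<in> sets opt"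
    then have A [measurable]: "A \<in> sets borel" by simp
    have "emeasure opt A = (\<integral>\<^sup>+w. indicator A w \<partial>opt)" by simp
    also have "\<dots> = (\<integral>\<^sup>+u. \<integral>\<^sup>+w. indicator A (u, w) \<partial>kern u \<partial>std_gaussian)"
      by (rule nn_integral_opt) measurable
    also have "\<dots> = (\<integral>\<^sup>+u. \<integral>\<^sup>+w. ennreal (exp (C + log_ratio u w)) * indicator A (u, w) \<partial>nu \<partial>std_gaussian)"
    proof (rule nn_integral_cong)
      fix u
      have "(\<lambda>w. indicator A (u, w) :: ennreal) \<in> borel_measurable borel" by measurable
      then show "(\<integral>\<^sup>+w. indicator A (u, w) \<partial>kern u) = (\<integral>\<^sup>+w. ennreal (exp (C + log_ratio u w)) * indicator A (u, w) \<partial>nu)"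
        unfolding C by (intro nn_integral_density) auto
    qed
    also have "\<dots> = (\<integral>\<^sup>+p. (case p of (u, w) \<Rightarrow> ennreal (exp (C + log_ratio u w))) * indicator A p \<partial>(std_gaussian \<Otimes>\<^sub>M nu))"
    proof (subst nu.nn_integral_fst[symmetric])
      have "A \<in> sets (std_gaussian \<Otimes>\<^sub>M nu)" using A by (simp only: sets)
      with m1 show "(\<lambda>p. (case p of (u, w) \<Rightarrow> ennreal (exp (C + log_ratio u w))) * indicator A p)
          \<in> borel_measurable (std_gaussian \<Otimes>\<^sub>M nu)" by measurable
    qed simp
    also have "\<dots> = emeasure ?r A"
      using m1 A sets by (subst emeasure_density) simp_all
    finally show "emeasure opt A = emeasure ?r A" .
  qed
  then show ?thesis by (rule that)
qed

end


section \<open>Relative entropy and optimality\<close>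

text \<open>Gibbs' variational principle: with \<open>M = density \<rho> (exp h)\<close> one has
  \<open>KL \<pi> M = KL \<pi> \<rho> - \<integral> h d\<pi>\<close>, and relative entropy is positive unless its arguments coincide.\<close>
lemma KL_le_imp_eq:
  fixes \<rho> \<pi> :: "'a measure" and h :: "'a \<Rightarrow> real"
  assumes \<rho>: "prob_space \<rho>" and \<pi>: "prob_space \<pi>" and sets: "sets \<pi> = sets \<rho>"
    and h [measurable]: "h \<in> borel_measurable \<rho>"
    and opt: "prob_space (density \<rho> (\<lambda>x. ennreal (exp (h x))))"
    and int_h: "integrable \<pi> h"
    and fin: "KL \<pi> \<rho> \<noteq> \<infinity>" and le: "KL \<pi> \<rho> \<le> ereal (\<integral>x. h x \<partial>\<pi>)"
  shows "\<pi> = density \<rho> (\<lambda>x. ennreal (exp (h x)))"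
proof -
  interpret \<rho>: prob_space \<rho> by fact
  interpret \<pi>: prob_space \<pi> by fact
  define M where "M = density \<rho> (\<lambda>x. ennreal (exp (h x)))"
  interpret M: prob_space M using opt by (simp add: M_def)
  interpret M: information_space M "exp 1" by standard simp
  have ac: "absolutely_continuous \<rho> \<pi>" and int: "integrable \<pi> (entropy_density (exp 1) \<rho> \<pi>)"
    and KL: "KL \<pi> \<rho> = ereal (KL_divergence (exp 1) \<rho> \<pi>)"
    using fin by (auto simp: KL_def split: if_splits)
  obtain D where D [measurable]: "D \<in> borel_measurable \<rho>" "AE x in \<rho>. RN_deriv \<rho> \<pi> x = ennreal (D x)"
    "\<And>x. 0 \<le> D x"
    using \<rho>.real_RN_deriv[OF \<pi>.finite_measure_axioms ac sets] by blast
  have "density \<rho> (\<lambda>x. ennreal (D x)) = density \<rho> (RN_deriv \<rho> \<pi>)"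
    using D(2) by (intro density_cong) auto
  also have "\<dots> = \<pi>" using ac sets by (rule \<rho>.density_RN_deriv)
  finally have \<pi>_eq: "density \<rho> (\<lambda>x. ennreal (D x)) = \<pi>" .
  define D' where "D' x = D x * exp (- h x)" for x
  have D' [measurable]: "D' \<in> borel_measurable \<rho>" unfolding D'_def by measurable
  have "density M (\<lambda>x. ennreal (D' x)) = density \<rho> (\<lambda>x. ennreal (exp (h x)) * ennreal (D' x))"
    unfolding M_def by (rule density_density_eq) measurable
  also have "\<dots> = density \<rho> (\<lambda>x. ennreal (D x))"
    using D(3) by (intro arg_cong[of _ _ "density \<rho>"] ext)
      (simp add: D'_def ennreal_mult'[symmetric] exp_minus)
  finally have dens: "density M (\<lambda>x. ennreal (D' x)) = \<pi>" using \<pi>_eq by simp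
  have AE\<pi>: "AE x in \<pi>. entropy_density (exp 1) \<rho> \<pi> x = ln (D x)"
  proof -
    have "AE x in \<rho>. entropy_density (exp 1) \<rho> \<pi> x = ln (D x)"
      using D(2) by (elim AE_mp) (intro AE_I2, simp add: entropy_density_def D(3) log_def)
    then show ?thesis using ac sets by (metis absolutely_continuous_AE)
  qed
  have D0: "AE x in \<pi>. 0 < D x"
  proof -
    have "AE x in density \<rho> (\<lambda>x. ennreal (D x)). 0 < D x"
      by (subst AE_density) (auto simp: less_le D(3) ennreal_eq_0_iff)
    then show ?thesis unfolding \<pi>_eq .
  qed
  have log_eq: "AE x in \<pi>. log (exp 1) (D' x) = entropy_density (exp 1) \<rho> \<pi> x - h x"
    using AE\<pi> D0 by eventually_elim (simp add: D'_def log_def ln_mult)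
  have m1 [measurable]: "entropy_density (exp 1) \<rho> \<pi> \<in> borel_measurable \<pi>"
    using int by (rule borel_measurable_integrable)
  have m2: "(\<lambda>x. log (exp 1) (D' x)) \<in> borel_measurable M"
    unfolding M_def by measurable
  have m3: "(\<lambda>x. log (exp 1) (D' x)) \<in> borel_measurable \<pi>" 
    using m2 by (simp add: M_def sets cong: measurable_cong_sets)
  have int': "integrable \<pi> (\<lambda>x. log (exp 1) (D' x))"
    using log_eq int int_h m3 by (subst integrable_cong_AE[OF _ _ log_eq]) auto
  have D'0: "0 \<le> D' x" for x using D(3) by (simp add: D'_def)
  have D'M: "D' \<in> borel_measurable M" unfolding M_def by measurable
  have intM: "integrable M (\<lambda>x. D' x * log (exp 1) (D' x))"
    using int' m2 D'0 D'M unfolding dens[symmetric] by (subst (asm) integrable_real_density) auto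
  have KLM: "KL_divergence (exp 1) M \<pi> = KL_divergence (exp 1) \<rho> \<pi> - (\<integral>x. h x \<partial>\<pi>)"
  proof -
    have "KL_divergence (exp 1) M \<pi> = (\<integral>x. D' x * log (exp 1) (D' x) \<partial>M)"
      unfolding dens[symmetric] using D'0 D'M by (intro M.KL_density) auto
    also have "\<dots> = (\<integral>x. log (exp 1) (D' x) \<partial>\<pi>)"
      unfolding dens[symmetric] using D'0 D'M m2 by (subst integral_real_density) auto
    also have "\<dots> = (\<integral>x. entropy_density (exp 1) \<rho> \<pi> x - h x \<partial>\<pi>)"
      using log_eq int_h m3 by (intro integral_cong_AE) auto
    also have "\<dots> = KL_divergence (exp 1) \<rho> \<pi> - (\<integral>x. h x \<partial>\<pi>)"
      using int int_h by (simp add: KL_divergence_def)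
    finally show ?thesis .
  qed
  have "\<not> 0 < KL_divergence (exp 1) M \<pi>" using le KL KLM by simp
  then have "density M D' = M"
    using M.KL_gt_0[of D'] dens \<pi> D'0 D'M intM by auto
  then have "\<pi> = M" by (simp only: dens)
  then show ?thesis unfolding M_def .
qed

lemma KL_exp_density:
  fixes \<rho> :: "'a measure" and h :: "'a \<Rightarrow> real"
  assumes \<rho>: "prob_space \<rho>" and h [measurable]: "h \<in> borel_measurable \<rho>"
    and int_h: "integrable (density \<rho> (\<lambda>x. ennreal (exp (h x)))) h"
  shows "KL (density \<rho> (\<lambda>x. ennreal (exp (h x)))) \<rho> = ereal (\<integral>x. h x \<partial>density \<rho> (\<lambda>x. ennreal (exp (h x))))"
proof -
  interpret \<rho>: prob_space \<rho> by fact
  define M where "M = density \<rho> (\<lambda>x. ennreal (exp (h x)))"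
  have ac: "absolutely_continuous \<rho> M"
    unfolding M_def by (intro absolutely_continuousI_density) measurable
  have "density \<rho> (RN_deriv \<rho> M) = density \<rho> (\<lambda>x. ennreal (exp (h x)))"
    unfolding M_def by (intro density_RN_deriv_density) measurable
  then have "AE x in \<rho>. RN_deriv \<rho> M x = ennreal (exp (h x))"
    by (intro \<rho>.density_unique) auto
  then have "AE x in \<rho>. entropy_density (exp 1) \<rho> M x = h x"
    by eventually_elim (simp add: entropy_density_def log_def)
  then have AE: "AE x in M. entropy_density (exp 1) \<rho> M x = h x"
    using ac by (intro absolutely_continuous_AE[of M \<rho>]) (auto simp: M_def)
  have m: "entropy_density (exp 1) \<rho> M \<in> borel_measurable M" "h \<in> borel_measurable M"
    by (auto simp: M_def)
  have "integrable M (entropy_density (exp 1) \<rho> M)"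
    using int_h by (subst integrable_cong_AE[OF m AE]) (simp add: M_def)
  moreover have "KL_divergence (exp 1) \<rho> M = (\<integral>x. h x \<partial>M)"
    unfolding KL_divergence_def by (rule integral_cong_AE[OF m AE])
  ultimately show ?thesis using ac by (simp add: KL_def M_def)
qed

text \<open>The defining identity on rectangles extends to all nonnegative measurable functions.\<close>
lemma nn_integral_conditional_law:
  fixes \<pi> :: "('a::second_countable_topology \<times> 'b::second_countable_topology) measure"
  assumes sets: "sets \<pi> = sets borel" and \<pi>: "prob_space \<pi>" and \<mu>: "sets \<mu> = sets borel"
    and cond: "is_conditional_law \<pi> \<mu> \<kappa>" and f: "f \<in> borel_measurable borel"
  shows "(\<integral>\<^sup>+p. f p \<partial>\<pi>) = (\<integral>\<^sup>+u. \<integral>\<^sup>+w. f (u, w) \<partial>\<kappa> u \<partial>\<mu>)"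
proof -
  interpret \<pi>: prob_space \<pi> by fact
  have \<kappa>: "\<kappa> \<in> borel \<rightarrow>\<^sub>M subprob_algebra borel"
    using cond by (auto simp: is_conditional_law_def intro: measurable_prob_algebraD)
  have sets\<kappa>: "sets (\<kappa> u) = sets borel" for u using \<kappa> by (rule sets_kernel) simp
  define K where "K u = distr (\<kappa> u) (borel \<Otimes>\<^sub>M borel) (Pair u)" for u
  have "K \<in> borel \<rightarrow>\<^sub>M subprob_algebra (borel \<Otimes>\<^sub>M borel)"
    unfolding K_def using \<kappa> by (intro measurable_distr2[where M=borel]) auto
  then have K: "K \<in> \<mu> \<rightarrow>\<^sub>M subprob_algebra (borel \<Otimes>\<^sub>M borel)"
    by (simp add: measurable_cong_sets[OF \<mu> refl])
  have sp: "space \<mu> = UNIV" using sets_eq_imp_space_eq[OF \<mu>] by simp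
  have setsb: "sets (\<mu> \<bind> K) = sets (borel \<Otimes>\<^sub>M borel)"
    by (rule sets_bind) (auto simp: K_def sp)
  have "\<pi> = \<mu> \<bind> K"
  proof (rule measure_eqI_generator_eq[OF Int_stable_pair_measure_generator[of borel borel], where \<Omega>=UNIV and A="\<lambda>_. UNIV"])
    show "sets \<pi> = sigma_sets UNIV {a \<times> b | a b. a \<in> sets borel \<and> b \<in> sets borel}"
      unfolding sets borel_prod[symmetric] sets_pair_measure by simp
    show "sets (\<mu> \<bind> K) = sigma_sets UNIV {a \<times> b | a b. a \<in> sets borel \<and> b \<in> sets borel}"
      unfolding setsb sets_pair_measure by simp
    show "range (\<lambda>_::nat. UNIV) \<subseteq> {a \<times> b | a b. a \<in> sets borel \<and> b \<in> sets borel}"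
      by (auto intro!: exI[of _ UNIV])
    show "emeasure \<pi> UNIV \<noteq> \<infinity>" by simp
    fix X :: "('a \<times> 'b) set" assume "X \<in> {a \<times> b | a b. a \<in> sets borel \<and> b \<in> sets borel}"
    then obtain a b where X: "X = a \<times> b" and ab [measurable]: "a \<in> sets borel" "b \<in> sets borel" by blast
    have "emeasure (\<mu> \<bind> K) X = (\<integral>\<^sup>+u. emeasure (K u) X \<partial>\<mu>)"
      by (rule emeasure_bind[OF _ K]) (auto simp: X sp)
    also have "\<dots> = (\<integral>\<^sup>+u\<in>a. emeasure (\<kappa> u) b \<partial>\<mu>)"
    proof (rule nn_integral_cong)
      fix u
      have m: "Pair u \<in> \<kappa> u \<rightarrow>\<^sub>M borel \<Otimes>\<^sub>M borel"
        by (simp add: measurable_cong_sets[OF sets\<kappa> refl])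
      have "Pair u -` (a \<times> b) \<inter> space (\<kappa> u) = (if u \<in> a then b else {})"
        using sets_eq_imp_space_eq[OF sets\<kappa>[of u]] by auto
      then show "emeasure (K u) X = emeasure (\<kappa> u) b * indicator a u"
        unfolding K_def X by (subst emeasure_distr[OF m]) auto
    qed
    also have "\<dots> = emeasure \<pi> X"
      using cond ab by (simp add: is_conditional_law_def X)
    finally show "emeasure \<pi> X = emeasure (\<mu> \<bind> K) X" ..
  qed auto
  moreover have "(\<integral>\<^sup>+p. f p \<partial>(\<mu> \<bind> K)) = (\<integral>\<^sup>+u. \<integral>\<^sup>+p. f p \<partial>K u \<partial>\<mu>)"
    using f by (intro nn_integral_bind[OF _ K]) (simp add: borel_prod)
  moreover have "(\<integral>\<^sup>+p. f p \<partial>K u) = (\<integral>\<^sup>+w. f (u, w) \<partial>\<kappa> u)" for u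
    unfolding K_def using f
    by (subst nn_integral_distr) (auto simp: borel_prod measurable_cong_sets[OF sets\<kappa> refl])
  ultimately show ?thesis by simp
qed

text \<open>A function with vanishing conditional expectation has vanishing expectation. The disintegration is
  applied to its positive and negative parts separately.\<close>
lemma integral_conditional_law_zero:
  fixes \<pi> :: "('a::second_countable_topology \<times> 'b::second_countable_topology) measure" and f :: "'a \<times> 'b \<Rightarrow> real"
  assumes sets: "sets \<pi> = sets borel" and \<pi>: "prob_space \<pi>" and \<mu>: "sets \<mu> = sets borel"
    and cond: "is_conditional_law \<pi> \<mu> \<kappa>" and f: "f \<in> borel_measurable borel" and int: "integrable \<pi> f"
    and zero: "AE u in \<mu>. integrable (\<kappa> u) (\<lambda>w. f (u, w)) \<and> (\<integral>w. f (u, w) \<partial>\<kappa> u) = 0"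
  shows "(\<integral>p. f p \<partial>\<pi>) = 0"
proof -
  have "AE u in \<mu>. (\<integral>\<^sup>+w. ennreal (f (u, w)) \<partial>\<kappa> u) = (\<integral>\<^sup>+w. ennreal (- f (u, w)) \<partial>\<kappa> u)"
    using zero
  proof eventually_elim
    fix u assume u: "integrable (\<kappa> u) (\<lambda>w. f (u, w)) \<and> (\<integral>w. f (u, w) \<partial>\<kappa> u) = 0"
    then have "enn2real (\<integral>\<^sup>+w. ennreal (f (u, w)) \<partial>\<kappa> u) = enn2real (\<integral>\<^sup>+w. ennreal (- f (u, w)) \<partial>\<kappa> u)"
      using real_lebesgue_integral_def[of "\<kappa> u" "\<lambda>w. f (u, w)"] by simp
    moreover have "(\<integral>\<^sup>+w. ennreal (f (u, w)) \<partial>\<kappa> u) \<noteq> \<infinity>" "(\<integral>\<^sup>+w. ennreal (- f (u, w)) \<partial>\<kappa> u) \<noteq> \<infinity>"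
      using u by (auto simp: real_integrable_def)
    ultimately show "(\<integral>\<^sup>+w. ennreal (f (u, w)) \<partial>\<kappa> u) = (\<integral>\<^sup>+w. ennreal (- f (u, w)) \<partial>\<kappa> u)"
      by (metis ennreal_enn2real infinity_ennreal_def top.not_eq_extremum)
  qed
  then have "(\<integral>\<^sup>+u. \<integral>\<^sup>+w. ennreal (f (u, w)) \<partial>\<kappa> u \<partial>\<mu>) = (\<integral>\<^sup>+u. \<integral>\<^sup>+w. ennreal (- f (u, w)) \<partial>\<kappa> u \<partial>\<mu>)"
    by (rule nn_integral_cong_AE)
  then have "(\<integral>\<^sup>+p. ennreal (f p) \<partial>\<pi>) = (\<integral>\<^sup>+p. ennreal (- f p) \<partial>\<pi>)"
    using f by (subst (1 2) nn_integral_conditional_law[OF sets \<pi> \<mu> cond]) auto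
  then show ?thesis using int by (simp add: real_lebesgue_integral_def)
qed

lemma integrable_std_gaussian_affine:
  fixes f g :: "'a::euclidean_space \<Rightarrow> 'b::euclidean_space"
  assumes f: "linear f" and g: "linear g"
  shows "integrable std_gaussian (\<lambda>z. (c + f z) \<bullet> (d + g z))"
proof -
  interpret prob_space "std_gaussian :: 'a measure" by (rule prob_space_std_gaussian)
  have lin: "integrable std_gaussian (\<lambda>z. f z \<bullet> d)" if f: "linear f" for f :: "'a \<Rightarrow> 'b" and d
  proof (rule Bochner_Integration.integrable_bound)
    show "integrable std_gaussian (\<lambda>z. f z \<bullet> f z + d \<bullet> d)"
      using integrable_std_gaussian_linear[OF f f] by simp
    show "(\<lambda>z. f z \<bullet> d) \<in> borel_measurable std_gaussian"
      using linear_measurable[OF f] by measurable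
    have "\<bar>f z \<bullet> d\<bar> \<le> f z \<bullet> f z + d \<bullet> d" for z
      using inner_ge_zero[of "f z + d"] inner_ge_zero[of "f z - d"] inner_ge_zero[of "f z"] inner_ge_zero[of d]
      by (simp add: inner_add_left inner_add_right inner_diff_left inner_diff_right inner_commute[of d "f z"])
    then show "AE z in std_gaussian. norm (f z \<bullet> d) \<le> norm (f z \<bullet> f z + d \<bullet> d)" by auto
  qed
  have "(c + f z) \<bullet> (d + g z) = c \<bullet> d + g z \<bullet> c + f z \<bullet> d + f z \<bullet> g z" for z
    by (simp add: inner_add_left inner_add_right inner_commute[of c "g z"])
  then show ?thesis
    using lin[OF f] lin[OF g] integrable_std_gaussian_linear[OF f g] by simp
qed

lemma integral_std_gaussian_linear_zero:
  fixes f :: "'a::euclidean_space \<Rightarrow> 'b::euclidean_space"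
  assumes f: "linear f"
  shows "integrable std_gaussian f" and "(\<integral>z. f z \<partial>std_gaussian) = 0"
proof -
  interpret prob_space "std_gaussian :: 'a measure" by (rule prob_space_std_gaussian)
  note [measurable] = linear_measurable[OF f]
  show "integrable std_gaussian f"
  proof (rule Bochner_Integration.integrable_bound)
    show "integrable std_gaussian (\<lambda>z. 1 + f z \<bullet> f z)"
      using integrable_std_gaussian_linear[OF f f] by simp
    have "norm (f z) \<le> 1 + f z \<bullet> f z" for z
    proof -
      have "0 \<le> (norm (f z) - 1)\<^sup>2" by simp
      then have "2 * norm (f z) \<le> 1 + (norm (f z))\<^sup>2" by (simp add: power2_diff)
      then show ?thesis unfolding power2_norm_eq_inner[symmetric]
        using norm_ge_zero[of "f z"] by linarith
    qed
    then show "AE z in std_gaussian. norm (f z) \<le> norm (1 + f z \<bullet> f z)" by auto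
  qed measurable
  have o: "orthogonal_transformation (\<lambda>z::'a. - z)"
    using orthogonal_transformation_neg[of "\<lambda>x::'a. x"] by simp
  have "(\<integral>z. f z \<partial>std_gaussian) = (\<integral>z. f z \<partial>distr std_gaussian borel (\<lambda>z. - z))"
    by (simp add: std_gaussian_orthogonal[OF o])
  also have "\<dots> = (\<integral>z. - f z \<partial>std_gaussian)"
    using f by (subst integral_distr) (auto simp: linear_neg)
  finally have "(\<integral>z. f z \<partial>std_gaussian) = - (\<integral>z. f z \<partial>std_gaussian)" by simp
  then have "2 *\<^sub>R (\<integral>z. f z \<partial>std_gaussian) = 0" by (metis scaleR_2 add.right_inverse)
  then show "(\<integral>z. f z \<partial>std_gaussian) = 0" by simp
qed

context entropic_gaussian
begin

lemma opt_coupling: "opt \<in> couplings std_gaussian nu"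
proof -
  interpret g: prob_space "std_gaussian :: 'u measure" by (rule prob_space_std_gaussian)
  interpret g2: prob_space "std_gaussian :: ('x \<times> 'u) measure" by (rule prob_space_std_gaussian)
  have m0: "(\<lambda>(u, z). (u, (0, m + Le u) + cond_factor z)) \<in> borel_measurable borel"
    unfolding case_prod_beta
    by (intro borel_measurable_continuous_onI continuous_intros continuous_on_fst continuous_on_snd)
  have p: "prob_space opt"
    unfolding opt_def using m0 by (intro prob_space.prob_space_distr prob_space_std_gaussian) simp
  have fst: "distr opt borel fst = std_gaussian"
  proof (rule measure_eqI)
    fix A :: "'u set" assume "A \<in> sets (distr opt borel fst)"
    then have [measurable]: "A \<in> sets borel" by simp
    have mf: "(fst :: 'u \<times> 'x \<times> 'u \<Rightarrow> 'u) \<in> borel_measurable borel"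
      by (intro borel_measurable_continuous_onI continuous_intros)
    have "emeasure (distr opt borel fst) A = (\<integral>\<^sup>+u. indicator A u \<partial>distr opt borel fst)"
      by simp
    also have "\<dots> = (\<integral>\<^sup>+w. indicator A (fst w) \<partial>opt)"
      using mf by (subst nn_integral_distr) auto
    also have "\<dots> = (\<integral>\<^sup>+u. \<integral>\<^sup>+w. indicator A u \<partial>kern u \<partial>std_gaussian)"
      using mf by (subst nn_integral_opt) (auto intro: measurable_compose[OF mf])
    also have "\<dots> = emeasure std_gaussian A"
      using prob_space.emeasure_space_1[OF prob_space_kern] by simp
    finally show "emeasure (distr opt borel fst) A = emeasure std_gaussian A" .
  qed simp
  \<comment> \<open>second marginal: \<open>A1\<close> and \<open>B1\<close> have the same covariance because \<open>Le\<^sup>2 + e Le = Lo\<^sup>2\<close>\<close>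
  define A1 :: "'u \<times> 'x \<times> 'u \<Rightarrow> 'x \<times> 'u" where "A1 = (\<lambda>(u, z3, z2). (H z3, F (H z3) + Le u + sqrt e *\<^sub>R Th z2))"
  define B1 :: "'u \<times> 'x \<times> 'u \<Rightarrow> 'x \<times> 'u" where "B1 = (\<lambda>(u, z3, z2). (H z3, F (H z3) + Lo z2))"
  have lin: "linear A1" "linear B1"
    unfolding A1_def B1_def by (auto intro!: linearI simp: linear_simps algebra_simps scaleR_add_right)
  have adjA: "adjoint A1 = (\<lambda>(x, y). (Le y, adjoint H (x + adjoint F y), sqrt e *\<^sub>R Th y))"
    by (rule adjoint_unique)
      (auto simp: A1_def inner_add_left inner_add_right adjoint_works[OF linear(1)] adjoint_works[OF linear(3)] selfadjoint)
  have adjB: "adjoint B1 = (\<lambda>(x, y). (0, adjoint H (x + adjoint F y), Lo y))"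
    by (rule adjoint_unique)
      (auto simp: B1_def inner_add_left inner_add_right adjoint_works[OF linear(1)] adjoint_works[OF linear(3)] selfadjoint)
  have "A1 \<circ> adjoint A1 = B1 \<circ> adjoint B1"
    unfolding adjA adjB using e
    by (auto simp: A1_def B1_def linear_simps Th_Th fun_eq_iff algebra_simps Le_eq[symmetric])
  then obtain Q where Q: "orthogonal_transformation Q" "B1 = A1 \<circ> Q"
    using equal_covariance_factor[OF lin] by blast
  note [measurable] = linear_measurable[OF lin(1)] linear_measurable[OF lin(2)] linear_measurable[OF orthogonal_transformation_linear[OF Q(1)]]
  have ms: "(snd :: 'u \<times> 'x \<times> 'u \<Rightarrow> 'x \<times> 'u) \<in> borel_measurable borel"
    by (intro borel_measurable_continuous_onI continuous_intros)
  have "distr opt borel snd = distr std_gaussian borel (\<lambda>z. (0, m) + A1 z)"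
    unfolding opt_def using m0 ms
    by (subst distr_distr) (auto simp: comp_def A1_def cond_factor_def case_prod_beta algebra_simps)
  also have "\<dots> = distr (distr std_gaussian borel Q) borel (\<lambda>z. (0, m) + A1 z)"
    by (simp add: std_gaussian_orthogonal[OF Q(1)])
  also have "\<dots> = distr std_gaussian borel (\<lambda>z. (0, m) + B1 z)"
    by (subst distr_distr) (auto simp: comp_def Q(2))
  also have "(\<lambda>z. (0, m) + B1 z) = (\<lambda>z. (0, m) + regressor z) \<circ> snd"
    by (auto simp: B1_def regressor_def)
  also have "distr std_gaussian borel \<dots> = distr (distr (std_gaussian :: ('u \<times> 'x \<times> 'u) measure) borel snd) borel (\<lambda>z. (0, m) + regressor z)"
    by (subst distr_distr) (use ms in auto)
  also have "distr (std_gaussian :: ('u \<times> 'x \<times> 'u) measure) borel snd = (std_gaussian :: ('x \<times> 'u) measure)"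
  proof (rule measure_eqI)
    fix A :: "('x \<times> 'u) set" assume "A \<in> sets (distr (std_gaussian :: ('u \<times> 'x \<times> 'u) measure) borel snd)"
    then have A [measurable]: "A \<in> sets borel" by simp
    have "emeasure (distr (std_gaussian :: ('u \<times> 'x \<times> 'u) measure) borel snd) A
        = emeasure ((std_gaussian :: 'u measure) \<Otimes>\<^sub>M (std_gaussian :: ('x \<times> 'u) measure)) (UNIV \<times> A)"
      unfolding std_gaussian_prod[where 'a='u and 'b="'x \<times> 'u", symmetric]
      using ms by (subst emeasure_distr) (auto intro!: arg_cong2[where f=emeasure])
    also have "\<dots> = emeasure std_gaussian A"
      using g.emeasure_space_1 A by (subst g2.emeasure_pair_measure_Times) auto
    finally show "emeasure (distr (std_gaussian :: ('u \<times> 'x \<times> 'u) measure) borel snd) A = emeasure std_gaussian A" .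
  qed simp
  finally have snd: "distr opt borel snd = nu" by (simp add: nu_def)
  show ?thesis unfolding couplings_def using p fst snd by simp
qed

lemma opt_conditional_law: "is_conditional_law opt std_gaussian kern"
  unfolding is_conditional_law_def
proof (intro conjI ballI)
  have "kern \<in> borel \<rightarrow>\<^sub>M subprob_algebra borel"
    unfolding kern_def
  proof (rule measurable_distr2[where M=borel])
    have "(\<lambda>(u, z). (0, m + Le u) + cond_factor z) \<in> borel_measurable borel"
      unfolding case_prod_beta
      by (intro borel_measurable_continuous_onI continuous_intros continuous_on_fst continuous_on_snd)
    then show "(\<lambda>(u, z). (0, m + Le u) + cond_factor z) \<in> borel_measurable (borel \<Otimes>\<^sub>M borel)"
      by (simp only: borel_prod)
    show "(\<lambda>u. std_gaussian) \<in> borel \<rightarrow>\<^sub>M subprob_algebra borel"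
      by (rule measurable_const)
        (simp add: space_subprob_algebra prob_space_imp_subprob_space prob_space_std_gaussian)
  qed
  then show "kern \<in> borel \<rightarrow>\<^sub>M prob_algebra borel"
    using prob_space_kern by (intro measurable_prob_algebraI) auto
  fix A :: "'u set" and B :: "('x \<times> 'u) set" assume AB [measurable]: "A \<in> sets borel" "B \<in> sets borel"
  have AxB: "A \<times> B \<in> sets borel" using AB by (rule borel_Times)
  have "emeasure opt (A \<times> B) = (\<integral>\<^sup>+w. indicator (A \<times> B) w \<partial>opt)"
    by (simp add: AxB)
  also have "\<dots> = (\<integral>\<^sup>+u. \<integral>\<^sup>+w. indicator (A \<times> B) (u, w) \<partial>kern u \<partial>std_gaussian)"
    by (rule nn_integral_opt) (rule borel_measurable_indicator[OF AxB])
  also have "\<dots> = (\<integral>\<^sup>+u\<in>A. emeasure (kern u) B \<partial>std_gaussian)"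
    by (intro nn_integral_cong) (auto simp: indicator_times nn_integral_cmult mult.commute split: split_indicator)
  finally show "emeasure opt (A \<times> B) = (\<integral>\<^sup>+u\<in>A. emeasure (kern u) B \<partial>std_gaussian)" .
qed

lemma kern_mean_zero: "integrable (kern u) fst" "(\<integral>(x, y). x \<partial>kern u) = 0"
proof -
  have lin: "linear (\<lambda>z::'x \<times> 'u. H (fst z))"
    by (intro linearI) (auto simp: linear_simps)
  have m0: "(\<lambda>z. (0, m + Le u) + cond_factor z) \<in> borel_measurable borel" by measurable
  have eq: "fst (cond_factor z) = H (fst z)" for z
    by (simp add: cond_factor_def case_prod_beta)
  have mf: "(fst :: 'x \<times> 'u \<Rightarrow> 'x) \<in> borel_measurable borel"
    by (intro borel_measurable_continuous_onI continuous_intros)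
  show "integrable (kern u) fst"
    unfolding kern_def using m0 mf integral_std_gaussian_linear_zero(1)[OF lin]
    by (subst integrable_distr_eq) (auto simp: eq)
  show "(\<integral>(x, y). x \<partial>kern u) = 0"
    unfolding kern_def case_prod_beta using m0 mf integral_std_gaussian_linear_zero(2)[OF lin]
    by (subst integral_distr) (auto simp: eq)
qed

text \<open>The dual potentials: cost plus \<open>e\<close> times the log-density splits into a function of \<open>u\<close>, a function of
  \<open>(x, y)\<close>, and the term \<open>u \<bullet> F x\<close>, which the constraint annihilates.\<close>
definition pot_u :: "'u \<Rightarrow> real" where
  "pot_u u = (norm u)\<^sup>2 / 2 - u \<bullet> m - u \<bullet> Le u / 2"

definition pot_w :: "'x \<times> 'u \<Rightarrow> real" where
  "pot_w w = (norm (snd w))\<^sup>2 / 2 - (norm (Thi (resid w)))\<^sup>2 / 2 + e / 2 * (norm (Loi (resid w)))\<^sup>2"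

lemma cost_split: "1/2 * (norm (u - y))\<^sup>2 + e * log_ratio u (x, y) = pot_u u + pot_w (x, y) - u \<bullet> F x"
proof -
  have y: "y = resid (x, y) + m + F x" by (simp add: resid_def)
  have "u \<bullet> y = u \<bullet> resid (x, y) + u \<bullet> m + u \<bullet> F x"
    by (subst y) (simp add: inner_add_right)
  moreover have "(norm (u - y))\<^sup>2 = (norm u)\<^sup>2 - 2 * (u \<bullet> y) + (norm y)\<^sup>2"
    by (simp add: power2_norm_eq_inner inner_diff_left inner_diff_right inner_commute[of y u])
  moreover have "e * log_ratio u (x, y) = u \<bullet> resid (x, y) - u \<bullet> Le u / 2
      - (norm (Thi (resid (x, y))))\<^sup>2 / 2 + e / 2 * (norm (Loi (resid (x, y))))\<^sup>2"
    using e by (simp add: log_ratio_def distrib_left)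
  ultimately show ?thesis
    by (simp add: pot_u_def pot_w_def add_divide_distrib diff_divide_distrib)
qed

lemma integrable_pot_u: "integrable std_gaussian pot_u" "integrable std_gaussian (\<lambda>u::'u. (norm u)\<^sup>2)"
proof -
  show 1: "integrable std_gaussian (\<lambda>u::'u. (norm u)\<^sup>2)" by (rule integrable_std_gaussian_norm)
  have "integrable std_gaussian (\<lambda>u::'u. u \<bullet> m)"
    using integrable_std_gaussian_affine[of "\<lambda>u::'u. u" "\<lambda>_. 0" 0 m] by (simp add: linear_zero linear_ident)
  moreover have "integrable std_gaussian (\<lambda>u. u \<bullet> Le u)"
    using integrable_std_gaussian_linear[of "\<lambda>u::'u. u" Le] linear by (simp add: linear_ident)
  ultimately show "integrable std_gaussian pot_u"
    unfolding pot_u_def using 1 by simp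
qed

lemma integrable_pot_w: "integrable nu pot_w" "integrable nu (\<lambda>w. (norm (snd w))\<^sup>2)" "integrable nu (\<lambda>w. (norm (F (fst w)))\<^sup>2)"
proof -
  have int: "integrable nu f" if "f \<in> borel_measurable borel" "integrable std_gaussian (\<lambda>z. f ((0, m) + regressor z))"
    for f :: "'x \<times> 'u \<Rightarrow> real"
    unfolding nu_def using that by (subst integrable_distr_eq) auto
  have c: "f \<in> borel_measurable borel" if "continuous_on UNIV f" for f :: "'x \<times> 'u \<Rightarrow> real"
    using that by (rule borel_measurable_continuous_onI)
  have aff: "integrable std_gaussian (\<lambda>z. (norm (c + f z))\<^sup>2)" if "linear f" for f :: "'x \<times> 'u \<Rightarrow> 'u" and c
    using integrable_std_gaussian_affine[OF that that, of c c] by (simp add: power2_norm_eq_inner)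
  have r: "resid ((0, m) + regressor z) = Lo (snd z)" for z
    by (simp add: resid_def regressor_def case_prod_beta linear_simps)
  show 1: "integrable nu (\<lambda>w. (norm (snd w))\<^sup>2)"
  proof (rule int)
    show "integrable std_gaussian (\<lambda>z. (norm (snd ((0, m) + regressor z)))\<^sup>2)"
      using aff[of "\<lambda>z. snd (regressor z)" m] linear_compose[OF linear_regressor linear_snd]
      by (simp add: comp_def)
  qed (intro c continuous_intros continuous_on_snd)
  have 2: "integrable nu (\<lambda>w. (norm (f (resid w)))\<^sup>2)" if f: "linear f" for f :: "'u \<Rightarrow> 'u"
  proof (rule int)
    show "integrable std_gaussian (\<lambda>z. (norm (f (resid ((0, m) + regressor z))))\<^sup>2)"
      unfolding r using aff[of "\<lambda>z. f (Lo (snd z))" 0] linear_compose[OF linear_compose[OF linear_snd linear(4)] f]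
      by (simp add: comp_def)
  qed (intro c continuous_intros linear_continuous_on_compose[OF f])
  show "integrable nu (\<lambda>w. (norm (F (fst w)))\<^sup>2)"
  proof (rule int)
    show "integrable std_gaussian (\<lambda>z. (norm (F (fst ((0, m) + regressor z))))\<^sup>2)"
      using aff[of "\<lambda>z. F (fst (regressor z))" 0] linear_compose[OF linear_compose[OF linear_regressor linear_fst] linear(3)]
      by (simp add: comp_def)
  qed (intro c continuous_intros continuous_on_fst)
  show "integrable nu pot_w"
    unfolding pot_w_def using 1 2[OF linear(5)] 2[OF linear(8)] by simp
qed

lemma coupling_integrals:
  assumes \<pi>: "\<pi> \<in> couplings std_gaussian nu"
  shows "integrable \<pi> (\<lambda>(u, x, y). 1/2 * (norm (u - y))\<^sup>2)" (is ?cost)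
    and "integrable \<pi> (\<lambda>(u, x, y). u \<bullet> F x)" (is ?cross)
    and "integrable \<pi> (\<lambda>(u, w). C + log_ratio u w)" (is ?log)
    and "(\<integral>(u, x, y). 1/2 * (norm (u - y))\<^sup>2 \<partial>\<pi>) + e * (\<integral>(u, w). C + log_ratio u w \<partial>\<pi>)
      = (\<integral>u. pot_u u \<partial>std_gaussian) + (\<integral>w. pot_w w \<partial>nu) + e * C - (\<integral>(u, x, y). u \<bullet> F x \<partial>\<pi>)" (is ?eq)
proof -
  have sets [simp, measurable_cong]: "sets \<pi> = sets borel" and "prob_space \<pi>"
    and fst: "distr \<pi> borel fst = std_gaussian" and snd: "distr \<pi> borel snd = nu"
    using \<pi> by (auto simp: couplings_def)
  interpret \<pi>: prob_space \<pi> by fact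
  have mf: "fst \<in> \<pi> \<rightarrow>\<^sub>M borel" and ms: "snd \<in> \<pi> \<rightarrow>\<^sub>M borel"
    unfolding measurable_cong_sets[OF sets refl]
    by (intro borel_measurable_continuous_onI continuous_intros)+
  have ifst: "integrable \<pi> (\<lambda>p. f (fst p))" "(\<integral>p. f (fst p) \<partial>\<pi>) = (\<integral>u. f u \<partial>std_gaussian)"
    if "integrable std_gaussian f" for f :: "'u \<Rightarrow> real"
    using integrable_distr[OF mf, of f] integral_distr[OF mf, of f] that borel_measurable_integrable[OF that]
    by (simp_all add: fst)
  have isnd: "integrable \<pi> (\<lambda>p. f (snd p))" "(\<integral>p. f (snd p) \<partial>\<pi>) = (\<integral>u. f u \<partial>nu)"
    if "integrable nu f" for f :: "'x \<times> 'u \<Rightarrow> real"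
    using integrable_distr[OF ms, of f] integral_distr[OF ms, of f] that borel_measurable_integrable[OF that]
    by (simp_all add: snd)
  have mcost: "(\<lambda>(u, x, y). 1/2 * (norm (u - y))\<^sup>2) \<in> borel_measurable \<pi>"
    and mcross: "(\<lambda>(u, x, y). u \<bullet> F x) \<in> borel_measurable \<pi>"
    unfolding case_prod_beta measurable_cong_sets[OF sets refl]
    by (intro borel_measurable_continuous_onI continuous_intros continuous_on_fst continuous_on_snd)+
  have n: "norm (1/2 * (norm (u - y))\<^sup>2) \<le> norm ((norm u)\<^sup>2 + (norm y)\<^sup>2)" for u y :: 'u
    using inner_ge_zero[of "u + y"] inner_ge_zero[of "u - y"] inner_ge_zero[of u] inner_ge_zero[of y]
    by (simp add: power2_norm_eq_inner inner_add_left inner_add_right inner_diff_left inner_diff_right inner_commute[of y u])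
  have n': "norm (u \<bullet> v) \<le> norm ((norm u)\<^sup>2 + (norm v)\<^sup>2)" for u v :: 'u
    using inner_ge_zero[of "u + v"] inner_ge_zero[of "u - v"] inner_ge_zero[of u] inner_ge_zero[of v]
    by (simp add: power2_norm_eq_inner inner_add_left inner_add_right inner_diff_left inner_diff_right inner_commute[of v u])
  show cost: ?cost
    using Bochner_Integration.integrable_add[OF ifst(1)[OF integrable_pot_u(2)] isnd(1)[OF integrable_pot_w(2)]] mcost
    by (rule Bochner_Integration.integrable_bound) (unfold case_prod_beta, intro AE_I2 n)
  show cross: ?cross
    using Bochner_Integration.integrable_add[OF ifst(1)[OF integrable_pot_u(2)] isnd(1)[OF integrable_pot_w(3)]] mcross
    by (rule Bochner_Integration.integrable_bound) (unfold case_prod_beta, intro AE_I2 n')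
  have eq: "(case p of (u, w) \<Rightarrow> C + log_ratio u w) =
    (pot_u (fst p) + pot_w (snd p) - (case p of (u, x, y) \<Rightarrow> u \<bullet> F x)
      - (case p of (u, x, y) \<Rightarrow> 1/2 * (norm (u - y))\<^sup>2)) * (1 / e) + C" for p
    using e cost_split[of "fst p" "snd (snd p)" "fst (snd p)"]
    by (simp add: case_prod_beta field_simps)
  show ?log
    unfolding eq using ifst(1)[OF integrable_pot_u(1)] isnd(1)[OF integrable_pot_w(1)] cost cross
    by (intro Bochner_Integration.integrable_add integrable_mult_left Bochner_Integration.integrable_diff) auto
  have "(\<integral>(u, w). C + log_ratio u w \<partial>\<pi>) = ((\<integral>u. pot_u u \<partial>std_gaussian) + (\<integral>w. pot_w w \<partial>nu)
     - (\<integral>(u, x, y). u \<bullet> F x \<partial>\<pi>) - (\<integral>(u, x, y). 1/2 * (norm (u - y))\<^sup>2 \<partial>\<pi>)) * (1 / e) + C"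
    unfolding eq using ifst[OF integrable_pot_u(1)] isnd[OF integrable_pot_w(1)] cost cross \<pi>.prob_space
    by simp
  then show ?eq using e by (simp add: field_simps)
qed

end

text \<open>For feasible \<open>\<pi>'\<close> the cost plus \<open>e\<close> times the integral of the log-density \<open>h\<close> is a constant \<open>K\<close>, which
  is also the value of the objective at \<open>opt\<close>. So optimality of \<open>\<pi>\<close> means \<open>KL \<pi> \<rho> \<le> \<integral> h d\<pi>\<close>, and
  this forces \<open>\<pi> = opt\<close>.\<close>
lemma evqr_optimal_eq_opt:
  fixes H Hi :: "real^'x \<Rightarrow> real^'x" and F :: "real^'x \<Rightarrow> real^'y" and Lo Loi Le Th Thi :: "real^'y \<Rightarrow> real^'y"
  assumes "entropic_gaussian H Hi F Lo Loi Le Th Thi e"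
    and optimal: "evqr_optimal e std_gaussian (entropic_gaussian.nu H F Lo m) \<pi>"
  shows "\<pi> = entropic_gaussian.opt H F Le Th m e"
proof -
  interpret entropic_gaussian H Hi F Lo Loi Le Th Thi m e by fact
  interpret u: prob_space "std_gaussian :: (real^'y) measure" by (rule prob_space_std_gaussian)
  interpret nu: prob_space nu by (rule prob_space_nu)
  interpret P: pair_prob_space "std_gaussian :: (real^'y) measure" nu ..
  define \<rho> where "\<rho> = (std_gaussian :: (real^'y) measure) \<Otimes>\<^sub>M nu"
  have \<rho>: "prob_space \<rho>" unfolding \<rho>_def by (rule P.prob_space_axioms)
  have sets\<rho>: "sets \<rho> = sets borel"
    unfolding \<rho>_def using sets_pair_measure_cong[OF sets_std_gaussian sets_nu] by (simp only: borel_prod)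
  obtain C where C: "opt = density \<rho> (\<lambda>(u, w). ennreal (exp (C + log_ratio u w)))"
    using opt_density unfolding \<rho>_def by blast
  define h where "h = (\<lambda>(u, w). C + log_ratio u w)"
  have opt_h: "opt = density \<rho> (\<lambda>p. ennreal (exp (h p)))"
    unfolding C h_def by (intro arg_cong[of _ _ "density \<rho>"] ext) auto
  have mh: "h \<in> borel_measurable \<rho>"
    unfolding h_def case_prod_beta measurable_cong_sets[OF sets\<rho> refl]
    by (intro borel_measurable_continuous_onI continuous_intros continuous_on_fst continuous_on_snd)
  define K where "K = (\<integral>u. pot_u u \<partial>std_gaussian) + (\<integral>w. pot_w w \<partial>nu) + e * C"
  let ?cost = "\<lambda>(u :: real^'y, x :: real^'x, y). 1/2 * (norm (u - y))\<^sup>2"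
  have cross: "(\<integral>(u, x, y). u \<bullet> F x \<partial>\<pi>') = 0"
    if feas: "\<pi>' \<in> evqr_feasible std_gaussian nu" for \<pi>'
  proof -
    have coup: "\<pi>' \<in> couplings std_gaussian nu" using feas by (simp add: evqr_feasible_def)
    then have \<pi>': "sets \<pi>' = sets borel" "prob_space \<pi>'" by (auto simp: couplings_def)
    obtain \<kappa> where \<kappa>: "is_conditional_law \<pi>' std_gaussian \<kappa>"
      "AE u in std_gaussian. integrable (\<kappa> u) fst \<and> (\<integral>(x, y). x \<partial>\<kappa> u) = 0"
      using feas by (auto simp: evqr_feasible_def)
    have m: "(\<lambda>(u, x, y). u \<bullet> F x) \<in> borel_measurable (borel :: ((real^'y) \<times> (real^'x) \<times> (real^'y)) measure)"
      unfolding case_prod_beta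
      by (intro borel_measurable_continuous_onI continuous_intros continuous_on_fst continuous_on_snd)
    have "AE u in std_gaussian. integrable (\<kappa> u) (\<lambda>w. case (u, w) of (u, x, y) \<Rightarrow> u \<bullet> F x)
        \<and> (\<integral>w. (case (u, w) of (u, x, y) \<Rightarrow> u \<bullet> F x) \<partial>\<kappa> u) = 0"
      using \<kappa>(2)
    proof eventually_elim
      fix u assume u: "integrable (\<kappa> u) fst \<and> (\<integral>(x, y). x \<partial>\<kappa> u) = 0"
      have "linear (\<lambda>x. u \<bullet> F x)"
        by (intro linearI) (auto simp: linear_simps inner_add_right)
      then have bl: "bounded_linear (\<lambda>x. u \<bullet> F x)" by (simp add: linear_conv_bounded_linear)
      have "integrable (\<kappa> u) (\<lambda>w. u \<bullet> F (fst w))" "(\<integral>w. u \<bullet> F (fst w) \<partial>\<kappa> u) = u \<bullet> F (\<integral>w. fst w \<partial>\<kappa> u)"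
        using u integrable_bounded_linear[OF bl, of "\<kappa> u" fst] integral_bounded_linear[OF bl, of "\<kappa> u" fst] by auto
      then show "integrable (\<kappa> u) (\<lambda>w. case (u, w) of (u, x, y) \<Rightarrow> u \<bullet> F x)
        \<and> (\<integral>w. (case (u, w) of (u, x, y) \<Rightarrow> u \<bullet> F x) \<partial>\<kappa> u) = 0"
        using u by (simp add: case_prod_unfold linear_simps)
    qed
    then show ?thesis
      using integral_conditional_law_zero[OF \<pi>' sets_std_gaussian \<kappa>(1) m coupling_integrals(2)[OF coup]] by simp
  qed
  have sum: "(\<integral>p. ?cost p \<partial>\<pi>') + e * (\<integral>p. h p \<partial>\<pi>') = K"
    if feas: "\<pi>' \<in> evqr_feasible std_gaussian nu" for \<pi>'
    using coupling_integrals(4)[of \<pi>' C] cross[OF feas] feas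
    by (simp add: h_def K_def evqr_feasible_def)
  have cost: "enn2ereal (\<integral>\<^sup>+ (u, x, y). ennreal (1/2 * (norm (u - y))\<^sup>2) \<partial>\<pi>') = ereal (\<integral>p. ?cost p \<partial>\<pi>')"
    if feas: "\<pi>' \<in> evqr_feasible std_gaussian nu" for \<pi>'
  proof -
    have int: "integrable \<pi>' ?cost"
      using feas by (intro coupling_integrals(1)) (simp add: evqr_feasible_def)
    have "(\<integral>\<^sup>+ (u, x, y). ennreal (1/2 * (norm (u - y))\<^sup>2) \<partial>\<pi>') = (\<integral>\<^sup>+p. ennreal (?cost p) \<partial>\<pi>')"
      by (intro nn_integral_cong) (auto split: prod.split)
    also have "\<dots> = ennreal (\<integral>p. ?cost p \<partial>\<pi>')"
      using int by (rule nn_integral_eq_integral) (auto simp: case_prod_beta)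
    finally show ?thesis by (simp add: enn2ereal_ennreal integral_nonneg_AE case_prod_beta)
  qed
  have feas_opt: "opt \<in> evqr_feasible std_gaussian nu"
    unfolding evqr_feasible_def using opt_coupling opt_conditional_law kern_mean_zero by auto
  have feas: "\<pi> \<in> evqr_feasible std_gaussian nu" using optimal by (simp add: evqr_optimal_def)
  have "KL opt \<rho> = ereal (\<integral>p. h p \<partial>opt)"
    using KL_exp_density[OF \<rho> mh] coupling_integrals(3)[OF opt_coupling, of C]
    unfolding opt_h[symmetric] by (simp add: h_def)
  then have "evqr_objective e std_gaussian nu opt = ereal K"
    unfolding evqr_objective_def cost[OF feas_opt] \<rho>_def[symmetric] using sum[OF feas_opt] by simp
  then have "evqr_objective e std_gaussian nu \<pi> \<le> ereal K"
    using optimal feas_opt by (auto simp: evqr_optimal_def)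
  then have le: "ereal (\<integral>p. ?cost p \<partial>\<pi>) + ereal e * KL \<pi> \<rho> \<le> ereal K"
    unfolding evqr_objective_def cost[OF feas] \<rho>_def[symmetric] .
  have fin: "KL \<pi> \<rho> \<noteq> \<infinity>" using le e by auto
  then obtain k where k: "KL \<pi> \<rho> = ereal k" by (auto simp: KL_def split: if_splits)
  have "e * k \<le> e * (\<integral>p. h p \<partial>\<pi>)" using le sum[OF feas] by (simp add: k)
  then have KLle: "KL \<pi> \<rho> \<le> ereal (\<integral>p. h p \<partial>\<pi>)" using e by (simp add: k)
  have \<pi>: "sets \<pi> = sets \<rho>" "prob_space \<pi>" "prob_space opt" "\<pi> \<in> couplings std_gaussian nu"
    using feas opt_coupling by (auto simp: evqr_feasible_def couplings_def sets\<rho>)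
  show ?thesis
    unfolding opt_h
  proof (rule KL_le_imp_eq[OF \<rho> \<pi>(2,1) mh _ _ fin KLle])
    show "prob_space (density \<rho> (\<lambda>p. ennreal (exp (h p))))" using \<pi>(3) by (simp add: opt_h)
    show "integrable \<pi> h" unfolding h_def by (rule coupling_integrals(3)[OF \<pi>(4)])
  qed
qed


section \<open>Wasserstein distance between the Gaussian couplings\<close>

lemma W2_squared: "(W2 a b)\<^sup>2 = enn2real (INF \<gamma>\<in>couplings a b. \<integral>\<^sup>+ (w, w'). ennreal ((dist w w')\<^sup>2) \<partial>\<gamma>)"
  by (simp add: W2_def)

lemma W2_squared_le:
  assumes "\<gamma> \<in> couplings a b" and "(\<integral>\<^sup>+ (w, w'). ennreal ((dist w w')\<^sup>2) \<partial>\<gamma>) \<le> ennreal c" and "0 \<le> c"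
  shows "(W2 a b)\<^sup>2 \<le> c"
proof -
  have "(INF \<gamma>\<in>couplings a b. \<integral>\<^sup>+ (w, w'). ennreal ((dist w w')\<^sup>2) \<partial>\<gamma>) \<le> ennreal c"
    using assms(1,2) by (rule INF_lower2)
  then have "enn2real (INF \<gamma>\<in>couplings a b. \<integral>\<^sup>+ (w, w'). ennreal ((dist w w')\<^sup>2) \<partial>\<gamma>) \<le> enn2real (ennreal c)"
    by (rule enn2real_mono) simp
  then show ?thesis using assms(3) by (simp add: W2_squared)
qed

text \<open>The coupling \<open>\<gamma>0\<close> of finite cost makes the infimum finite: \<open>enn2real\<close> maps \<open>\<infinity>\<close> to \<open>0\<close>.\<close>
lemma W2_squared_ge:
  assumes "\<gamma>0 \<in> couplings a b" "(\<integral>\<^sup>+ (w, w'). ennreal ((dist w w')\<^sup>2) \<partial>\<gamma>0) \<le> ennreal d"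
    and "\<And>\<gamma>. \<gamma> \<in> couplings a b \<Longrightarrow> ennreal c \<le> (\<integral>\<^sup>+ (w, w'). ennreal ((dist w w')\<^sup>2) \<partial>\<gamma>)" and "0 \<le> c"
  shows "c \<le> (W2 a b)\<^sup>2"
proof -
  let ?I = "INF \<gamma>\<in>couplings a b. \<integral>\<^sup>+ (w, w'). ennreal ((dist w w')\<^sup>2) \<partial>\<gamma>"
  have "ennreal c \<le> ?I" using assms(3) by (rule INF_greatest)
  moreover have "?I \<le> ennreal d" using assms(1,2) by (rule INF_lower2)
  then have "?I < top" using ennreal_less_top le_less_trans by blast
  ultimately have "enn2real (ennreal c) \<le> enn2real ?I" by (intro enn2real_mono) auto
  then show ?thesis using assms(4) by (simp add: W2_squared)
qed

text \<open>The Cayley transform \<open>(id + S/2) (id - S/2)\<^sup>-\<^sup>1\<close> of a small skew operator \<open>S\<close> is orthogonal and agrees with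
  \<open>id + S\<close> up to second order.\<close>
lemma cayley_transform:
  fixes S :: "'a::euclidean_space \<Rightarrow> 'a"
  assumes S: "linear S" and skew: "\<And>v w. S v \<bullet> w = - (v \<bullet> S w)" and s: "\<And>v. norm (S v) \<le> s * norm v" "0 \<le> s"
  obtains Q where "orthogonal_transformation Q" "\<And>z. norm (Q z - z - S z) \<le> s\<^sup>2 / 2 * norm z"
proof -
  define P where "P = (\<lambda>v. v - (1/2) *\<^sub>R S v)"
  define R where "R = (\<lambda>v. v + (1/2) *\<^sub>R S v)"
  note Slin = linear_add[OF S] linear_scale[OF S]
  have P: "linear P" and R: "linear R"
    unfolding P_def R_def by (auto intro!: linearI simp: Slin algebra_simps scaleR_add_right)
  have vS: "v \<bullet> S v = 0" for v using skew[of v v] by (simp add: inner_commute[of "S v" v])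
  have nP: "P v \<bullet> P v = v \<bullet> v + (S v \<bullet> S v) / 4" and nR: "R v \<bullet> R v = v \<bullet> v + (S v \<bullet> S v) / 4" for v
    using vS[of v] by (simp_all add: P_def R_def inner_diff_left inner_diff_right inner_add_left inner_add_right inner_commute[of "S v" v])
  have nPR: "norm (P v) = norm (R v)" for v by (simp add: norm_eq_sqrt_inner nP nR)
  have le: "norm v \<le> norm (P v)" for v
    by (simp add: norm_eq_sqrt_inner nP)
  have "inj P"
    unfolding linear_injective_0[OF P] using le by (metis norm_le_zero_iff norm_zero)
  then have bij: "bij P" using P by (simp add: bij_def linear_injective_imp_surjective)
  define t where "t = inv P"
  have t: "linear t" "\<And>z. P (t z) = z"
    unfolding t_def using P bij by (auto simp: bij_def inj_linear_imp_inv_linear surj_f_inv_f)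
  show ?thesis
  proof
    show "orthogonal_transformation (R \<circ> t)"
      unfolding orthogonal_transformation using linear_compose[OF t(1) R] by (simp add: t(2) nPR[symmetric])
    fix z
    have z: "z = t z - (1/2) *\<^sub>R S (t z)" using t(2)[of z] by (simp add: P_def)
    have Sz: "S z = S (t z) - (1/2) *\<^sub>R S (S (t z))"
      by (subst z) (simp add: linear_diff[OF S] Slin)
    have "(R \<circ> t) z - z - S z = (t z + (1/2) *\<^sub>R S (t z)) - (t z - (1/2) *\<^sub>R S (t z)) - (S (t z) - (1/2) *\<^sub>R S (S (t z)))"
      using z Sz by (simp add: R_def)
    also have "\<dots> = (1/2) *\<^sub>R S (S (t z))"
      using scaleR_half_double[of "S (t z)"] by (simp add: algebra_simps)
    finally have "norm ((R \<circ> t) z - z - S z) = norm (S (S (t z))) / 2" by simp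
    also have "\<dots> \<le> s * (s * norm (t z)) / 2"
      using s(1)[of "S (t z)"] mult_left_mono[OF s(1)[of "t z"] s(2)] by simp
    also have "\<dots> \<le> s * (s * norm z) / 2"
      using le[of "t z"] s(2) by (simp add: t(2) mult_left_mono)
    finally show "norm ((R \<circ> t) z - z - S z) \<le> s\<^sup>2 / 2 * norm z" by (simp add: power2_eq_square)
  qed
qed

lemma integral_std_gaussian_bilinear:
  fixes f :: "'a::euclidean_space \<Rightarrow> 'b::euclidean_space" and g :: "'b \<Rightarrow> 'b"
  assumes f: "linear f" and g: "linear g"
  shows "(\<integral>z. f z \<bullet> g (f z) \<partial>std_gaussian) = (\<Sum>b\<in>Basis. f b \<bullet> g (f b))"
proof -
  have "linear (\<lambda>z. adjoint f (g (f z)))"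
    using linear_compose[OF linear_compose[OF f g] adjoint_linear[OF f]] by (simp add: comp_def)
  from integral_std_gaussian_quadratic[OF this] show ?thesis by (simp add: adjoint_works[OF f])
qed

text \<open>Cyclicity of the trace: \<open>tr (T g T) = tr (g T T)\<close> for symmetric \<open>T\<close>.\<close>
lemma sum_Basis_cyclic:
  fixes T g :: "'a::euclidean_space \<Rightarrow> 'a"
  assumes g: "linear g" and sym: "\<And>v w. T v \<bullet> w = v \<bullet> T w"
  shows "(\<Sum>b\<in>Basis. T b \<bullet> g (T b)) = (\<Sum>b\<in>Basis. b \<bullet> g (T (T b)))"
proof -
  have "(\<Sum>b\<in>Basis. T b \<bullet> g (T b)) = (\<Sum>b\<in>Basis. \<Sum>c\<in>Basis. (T b \<bullet> c) * (g (T b) \<bullet> c))"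
    by (simp add: euclidean_inner[symmetric])
  also have "\<dots> = (\<Sum>c\<in>Basis. \<Sum>b\<in>Basis. (T b \<bullet> c) * (g (T b) \<bullet> c))" by (rule sum.swap)
  also have "\<dots> = (\<Sum>c\<in>Basis. \<Sum>b\<in>Basis. (T c \<bullet> b) * (T (adjoint g c) \<bullet> b))"
  proof (intro sum.cong refl)
    fix b c :: 'a
    have "T b \<bullet> c = T c \<bullet> b" using sym[of b c] by (simp add: inner_commute)
    moreover have "g (T b) \<bullet> c = T (adjoint g c) \<bullet> b"
      using sym[of b "adjoint g c"] by (simp add: adjoint_works[OF g, symmetric] inner_commute[of b])
    ultimately show "(T b \<bullet> c) * (g (T b) \<bullet> c) = (T c \<bullet> b) * (T (adjoint g c) \<bullet> b)" by simp
  qed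
  also have "\<dots> = (\<Sum>c\<in>Basis. T c \<bullet> T (adjoint g c))" by (simp add: euclidean_inner[symmetric])
  also have "\<dots> = (\<Sum>c\<in>Basis. c \<bullet> g (T (T c)))"
  proof (intro sum.cong refl)
    fix c :: 'a
    have "T c \<bullet> T (adjoint g c) = T (T c) \<bullet> adjoint g c" by (rule sym[symmetric])
    also have "\<dots> = g (T (T c)) \<bullet> c" by (rule adjoint_works[OF g])
    also have "\<dots> = c \<bullet> g (T (T c))" by (rule inner_commute)
    finally show "T c \<bullet> T (adjoint g c) = c \<bullet> g (T (T c))" .
  qed
  finally show ?thesis .
qed

lemma sum_Basis_prod:
  fixes f :: "'a::euclidean_space \<times> 'b::euclidean_space \<Rightarrow> 'c::comm_monoid_add"
  shows "(\<Sum>b\<in>Basis. f b) = (\<Sum>i\<in>Basis. f (i, 0)) + (\<Sum>j\<in>Basis. f (0, j))"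
proof -
  have "inj_on (\<lambda>u. (u::'a, 0::'b)) Basis" "inj_on (\<lambda>u. (0::'a, u::'b)) Basis"
    by (auto intro!: inj_onI)
  moreover have "(\<lambda>u. (u::'a, 0::'b)) ` Basis \<inter> (\<lambda>u. (0::'a, u::'b)) ` Basis = {}"
    by auto
  ultimately show ?thesis
    unfolding Basis_prod_def by (subst sum.union_disjoint) (simp_all add: sum.reindex)
qed

text \<open>
  In addition to the data of the problem, \<open>Li\<close> is the inverse of \<open>L = id + Lo\<^sup>2 + F F\<^sup>T\<close>. The constants
  \<open>\<alpha>\<close>, \<open>\<beta>\<close>, \<open>\<tau>\<close> bound operator norms; they are parameters so that they can be chosen independently of
  \<open>e\<close>.
\<close>
locale entropic_gaussian_limit = entropic_gaussian H Hi F Lo Loi Le Th Thi m e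
  for H Hi :: "'x::euclidean_space \<Rightarrow> 'x" and F :: "'x \<Rightarrow> 'u::euclidean_space"
    and Lo Loi Le Th Thi :: "'u \<Rightarrow> 'u" and m :: 'u and e :: real +
  fixes Li :: "'u \<Rightarrow> 'u" and \<alpha> \<beta> \<tau> :: real
  assumes linear_Li: "linear Li"
    and L_Li: "\<And>v. Li v + Lo (Lo (Li v)) + F (adjoint F (Li v)) = v"
    and bound_limit: "\<And>u x. norm (u, H x, F (H x) + Lo u) \<le> \<alpha> * norm (u, x)"
    and bound_rotation: "\<And>v. norm (Lo (Li v)) \<le> \<beta> * norm v" "\<And>v. norm (Hi (adjoint F (Li v))) \<le> \<beta> * norm v"
    and bound_Th: "\<And>v. norm (Th v) \<le> \<tau> * norm v"
    and nonneg: "0 \<le> \<alpha>" "0 \<le> \<beta>" "0 \<le> \<tau>"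
    and Le_Lo: "\<And>v. norm (Le v - Lo v) \<le> e / 2 * norm v"
begin

abbreviation "Ft \<equiv> adjoint F"

lemma linear_Ft: "linear Ft" by (rule adjoint_linear[OF linear(3)])
lemmas Li_simps = linear_Li[THEN linear_add] linear_Li[THEN linear_diff] linear_Li[THEN linear_scale] linear_Li[THEN linear_0]
  linear_Ft[THEN linear_add] linear_Ft[THEN linear_diff] linear_Ft[THEN linear_scale] linear_Ft[THEN linear_0]

text \<open>Factors of the covariances of \<open>opt\<close> and of the limit law.\<close>
definition factor :: "'u \<times> 'x \<times> 'u \<Rightarrow> 'u \<times> 'x \<times> 'u" where
  "factor = (\<lambda>(u, z3, z2). (u, H z3, F (H z3) + Le u + sqrt e *\<^sub>R Th z2))"

definition limit_factor :: "'u \<times> 'x \<times> 'u \<Rightarrow> 'u \<times> 'x \<times> 'u" where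
  "limit_factor = (\<lambda>(u, z3, z2). (u, H z3, F (H z3) + Lo u))"

text \<open>The range of \<open>limit_factor\<close> is the kernel of \<open>normal_part\<close>, and \<open>normal_proj\<close> is the orthogonal
  projection onto its orthogonal complement. That complement consists of the vectors
  \<open>(- Lo v, - F\<^sup>T v, v)\<close>, the images of the adjoint of \<open>normal_part\<close>.\<close>
definition normal_part :: "'u \<times> 'x \<times> 'u \<Rightarrow> 'u" where
  "normal_part = (\<lambda>(u, x, y). y - F x - Lo u)"

definition normal_proj :: "'u \<times> 'x \<times> 'u \<Rightarrow> 'u \<times> 'x \<times> 'u" where
  "normal_proj w = (- Lo (Li (normal_part w)), - Ft (Li (normal_part w)), Li (normal_part w))"

text \<open>The expected squared norm of the normal component of the centred \<open>opt\<close>: the trace of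
  \<open>Li ((Le - Lo)\<^sup>2 + e Le)\<close>.\<close>
definition excess :: real where
  "excess = (\<Sum>b\<in>Basis. (Le b - Lo b) \<bullet> Li (Le b - Lo b)) + e * (\<Sum>b\<in>Basis. b \<bullet> Li (Le b))"

lemma linear_factors: "linear factor" "linear limit_factor" "linear normal_part" "linear normal_proj"
  unfolding factor_def limit_factor_def normal_part_def normal_proj_def
  by (auto intro!: linearI simp: linear_simps Li_simps algebra_simps scaleR_add_right)

lemma measurable_limit_factors [measurable]: "factor \<in> borel_measurable borel" "limit_factor \<in> borel_measurable borel"
  "normal_part \<in> borel_measurable borel" "normal_proj \<in> borel_measurable borel" "Li \<in> borel_measurable borel"
  by (intro linear_measurable linear_factors linear_Li)+

lemma normal_pythagoras: "(norm w)\<^sup>2 = normal_part w \<bullet> Li (normal_part w) + (norm (w - normal_proj w))\<^sup>2"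
proof -
  obtain u x y where w: "w = (u, x, y)" by (cases w)
  define v where "v = Li (normal_part w)"
  have p: "normal_proj w = (- Lo v, - Ft v, v)" by (simp add: normal_proj_def v_def)
  have wp: "w \<bullet> normal_proj w = normal_part w \<bullet> v"
    unfolding p by (simp add: w normal_part_def selfadjoint adjoint_works[OF linear(3)] inner_diff_left)
  have "normal_proj w \<bullet> normal_proj w = v \<bullet> (v + Lo (Lo v) + F (Ft v))"
    by (simp add: p selfadjoint inner_add_right adjoint_works[OF linear(3)] linear_neg[OF linear(3)] inner_commute[of v "F (Ft v)"])
  then have pp: "normal_proj w \<bullet> normal_proj w = normal_part w \<bullet> v"
    unfolding v_def L_Li by (simp add: inner_commute)
  show ?thesis
    by (simp add: power2_norm_eq_inner inner_diff_left inner_diff_right pp wp inner_commute[of "normal_proj w" w] v_def[symmetric])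
qed

lemma normal_part_limit: "normal_part (limit_factor z) = 0"
  by (simp add: normal_part_def limit_factor_def case_prod_beta)

lemma normal_part_factor: "normal_part (factor z) = (\<lambda>(u, z3, z2). (Le u - Lo u) + sqrt e *\<^sub>R Th z2) z"
  by (simp add: normal_part_def factor_def case_prod_beta)

lemma excess_integral:
  "integrable std_gaussian (\<lambda>z. normal_part (factor z) \<bullet> Li (normal_part (factor z)))"
  "(\<integral>z. normal_part (factor z) \<bullet> Li (normal_part (factor z)) \<partial>std_gaussian) = excess"
proof -
  have lin: "linear (\<lambda>z. normal_part (factor z))"
    using linear_compose[OF linear_factors(1,3)] by (simp add: comp_def)
  show "integrable std_gaussian (\<lambda>z. normal_part (factor z) \<bullet> Li (normal_part (factor z)))"
    using integrable_std_gaussian_linear[OF lin linear_compose[OF lin linear_Li]] by (simp add: comp_def)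
  have "(\<integral>z. normal_part (factor z) \<bullet> Li (normal_part (factor z)) \<partial>std_gaussian)
     = (\<Sum>b\<in>Basis. (Le b - Lo b) \<bullet> Li (Le b - Lo b)) + e * (\<Sum>b\<in>Basis. Th b \<bullet> Li (Th b))"
    unfolding integral_std_gaussian_bilinear[OF lin linear_Li] unfolding sum_Basis_prod normal_part_factor
    using e by (simp add: linear_simps Li_simps sum_distrib_left zero_prod_def mult.assoc[symmetric])
  also have "(\<Sum>b\<in>Basis. Th b \<bullet> Li (Th b)) = (\<Sum>b\<in>Basis. b \<bullet> Li (Le b))"
    using sum_Basis_cyclic[OF linear_Li selfadjoint(3)] by (simp add: Th_Th)
  finally show "(\<integral>z. normal_part (factor z) \<bullet> Li (normal_part (factor z)) \<partial>std_gaussian) = excess"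
    by (simp add: excess_def)
qed

lemma excess_nonneg: "0 \<le> normal_part w \<bullet> Li (normal_part w)" "0 \<le> excess"
proof -
  have n: "0 \<le> v \<bullet> Li v" for v
  proof -
    have "v \<bullet> Li v = (Li v + Lo (Lo (Li v)) + F (Ft (Li v))) \<bullet> Li v" by (simp only: L_Li)
    also have "\<dots> = Li v \<bullet> Li v + Lo (Li v) \<bullet> Lo (Li v) + Ft (Li v) \<bullet> Ft (Li v)"
      by (simp add: inner_add_left selfadjoint adjoint_works[OF linear(3)])
    finally show ?thesis by simp
  qed
  then show "0 \<le> normal_part w \<bullet> Li (normal_part w)" by simp
  show "0 \<le> excess" unfolding excess_integral(2)[symmetric] using n by (intro Bochner_Integration.integral_nonneg) simp
qed

text \<open>The rotation of the noise that couples the two laws. The operators \<open>B1\<close> and \<open>B3\<close> are chosen such that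
  \<open>limit_factor (S z)\<close> is the tangential part of \<open>(0, 0, sqrt e *\<^sub>R Th z2)\<close>, which is the part of
  \<open>factor z - limit_factor z\<close> of order \<open>sqrt e\<close>. The third component of \<open>S\<close> does not affect
  \<open>limit_factor\<close> and is free to make \<open>S\<close> skew.\<close>
lemma coupling_rotation:
  obtains Q where "orthogonal_transformation Q"
    "\<And>z. norm ((factor z - limit_factor (Q z)) - normal_proj (factor z - limit_factor (Q z)))
        \<le> (\<alpha> * (\<beta> * \<tau>)\<^sup>2 + 1/2) * e * norm z"
proof -
  define B1 where "B1 v = sqrt e *\<^sub>R Lo (Li (Th v))" for v
  define B3 where "B3 v = sqrt e *\<^sub>R Hi (Ft (Li (Th v)))" for v
  have lin: "linear B1" "linear B3"
    unfolding B1_def B3_def by (auto intro!: linearI simp: linear_simps Li_simps algebra_simps scaleR_add_right)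
  note adj = adjoint_works[OF lin(1)] adjoint_works[OF lin(2)]
  note adjlin = lin[THEN adjoint_linear]
  define S where "S = (\<lambda>(z1, z3, z2). (B1 z2, B3 z2, - adjoint B1 z1 - adjoint B3 z3))"
  have S: "linear S"
    unfolding S_def
    by (auto intro!: linearI simp: lin[THEN linear_add] lin[THEN linear_scale] adjlin[THEN linear_add] adjlin[THEN linear_scale]
        algebra_simps scaleR_add_right)
  have skew: "S v \<bullet> w = - (v \<bullet> S w)" for v w
    by (cases v, cases w) (simp add: S_def inner_diff_left inner_diff_right adj inner_commute[of "adjoint B1 _"] inner_commute[of "adjoint B3 _"]
      inner_commute[of "B1 _"] inner_commute[of "B3 _"])
  define k where "k = sqrt e * (\<beta> * \<tau>)"
  have k: "0 \<le> k" using e nonneg by (simp add: k_def)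
  have B1: "norm (B1 v) \<le> k * norm v" and B3: "norm (B3 v) \<le> k * norm v" for v
  proof -
    have "\<beta> * norm (Th v) \<le> \<beta> * (\<tau> * norm v)" using bound_Th nonneg by (intro mult_left_mono) auto
    then have "norm (Lo (Li (Th v))) \<le> \<beta> * (\<tau> * norm v)" "norm (Hi (Ft (Li (Th v)))) \<le> \<beta> * (\<tau> * norm v)"
      using bound_rotation[of "Th v"] by linarith+
    then show "norm (B1 v) \<le> k * norm v" "norm (B3 v) \<le> k * norm v"
      using e by (auto simp: B1_def B3_def k_def mult.assoc intro!: mult_left_mono)
  qed
  have adj_bound: "norm (adjoint B v) \<le> k * norm v" if B: "linear B" "\<And>v. norm (B v) \<le> k * norm v"
    for B :: "'u \<Rightarrow> 'c::euclidean_space" and v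
  proof (cases "adjoint B v = 0")
    case False
    have "norm (adjoint B v) * norm (adjoint B v) = B (adjoint B v) \<bullet> v"
      by (simp add: adjoint_works[OF B(1), symmetric] power2_norm_eq_inner[symmetric] power2_eq_square)
    also have "\<dots> \<le> norm (B (adjoint B v)) * norm v" by (rule norm_cauchy_schwarz)
    also have "\<dots> \<le> k * norm (adjoint B v) * norm v" using B(2) by (intro mult_right_mono) auto
    finally have "norm (adjoint B v) * norm (adjoint B v) \<le> (k * norm v) * norm (adjoint B v)" by (simp add: mult_ac)
    then show ?thesis using False by simp
  qed (use k in simp)
  have Sb: "norm (S z) \<le> sqrt 2 * k * norm z" for z
  proof -
    obtain z1 z3 z2 where z: "z = (z1, z3, z2)" by (cases z)
    have "norm (- adjoint B1 z1 - adjoint B3 z3) \<le> norm (adjoint B1 z1) + norm (adjoint B3 z3)"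
      using norm_triangle_ineq4[of "- adjoint B1 z1" "adjoint B3 z3"] by simp
    also have "\<dots> \<le> k * (norm z1 + norm z3)"
      using adj_bound[OF lin(1) B1, of z1] adj_bound[OF lin(2) B3, of z3] by (simp add: distrib_left)
    finally have "(norm (- adjoint B1 z1 - adjoint B3 z3))\<^sup>2 \<le> (k * (norm z1 + norm z3))\<^sup>2"
      by (intro power_mono) auto
    also have "\<dots> \<le> k\<^sup>2 * (2 * (norm z1)\<^sup>2 + 2 * (norm z3)\<^sup>2)"
      using sum_squares_bound[of "norm z1" "norm z3"]
      by (auto simp: power_mult_distrib power2_sum intro!: mult_left_mono)
    finally have 3: "(norm (- adjoint B1 z1 - adjoint B3 z3))\<^sup>2 \<le> k\<^sup>2 * (2 * (norm z1)\<^sup>2 + 2 * (norm z3)\<^sup>2)" .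
    have 1: "(norm (B1 z2))\<^sup>2 \<le> k\<^sup>2 * (norm z2)\<^sup>2" "(norm (B3 z2))\<^sup>2 \<le> k\<^sup>2 * (norm z2)\<^sup>2"
      using power_mono[OF B1, of z2 2] power_mono[OF B3, of z2 2] by (simp_all add: power_mult_distrib)
    have "(norm (S z))\<^sup>2 = (norm (B1 z2))\<^sup>2 + ((norm (B3 z2))\<^sup>2 + (norm (- adjoint B1 z1 - adjoint B3 z3))\<^sup>2)"
      by (simp add: S_def z norm_Pair)
    also have "\<dots> \<le> 2 * k\<^sup>2 * ((norm z1)\<^sup>2 + ((norm z3)\<^sup>2 + (norm z2)\<^sup>2))"
      using 1 3 by (simp add: algebra_simps)
    also have "\<dots> = (sqrt 2 * k * norm z)\<^sup>2"
      by (simp add: z norm_Pair power_mult_distrib)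
    finally show ?thesis using k by (rule_tac power2_le_imp_le) auto
  qed
  obtain Q where Q: "orthogonal_transformation Q" "\<And>z. norm (Q z - z - S z) \<le> (sqrt 2 * k)\<^sup>2 / 2 * norm z"
    using cayley_transform[OF S skew Sb] k by auto
  have k2: "(sqrt 2 * k)\<^sup>2 / 2 = e * (\<beta> * \<tau>)\<^sup>2"
    using e by (simp add: k_def power_mult_distrib)
  show ?thesis
  proof (rule that[OF Q(1)])
    fix z :: "'u \<times> 'x \<times> 'u"
    obtain z1 z3 z2 where z: "z = (z1, z3, z2)" by (cases z)
    define d where "d = (0 :: 'u, 0 :: 'x, Le z1 - Lo z1)"
    define T where "T w = w - normal_proj w" for w
    have linT: "T (v + w) = T v + T w" for v w
      using linear_add[OF linear_factors(4)] by (simp add: T_def)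
    have Tlim: "T (limit_factor v) = limit_factor v" for v
      by (simp add: T_def normal_proj_def normal_part_limit linear_simps Li_simps zero_prod_def)
    have Trot: "T (0, 0, sqrt e *\<^sub>R Th z2) = limit_factor (S z)"
    proof -
      define t where "t = Li (Th z2)"
      have "Th z2 - t = Lo (Lo t) + F (Ft t)"
        using L_Li[of "Th z2"] by (simp add: t_def algebra_simps)
      then show ?thesis
        by (simp add: T_def normal_proj_def normal_part_def linear_simps Li_simps t_def[symmetric] limit_factor_def S_def z
            B1_def B3_def inverse scaleR_diff_right[symmetric] scaleR_add_right[symmetric] add.commute)
    qed
    have split: "factor z - limit_factor (Q z) = (limit_factor (- (Q z - z - S z)) - limit_factor (S z)) + (0, 0, sqrt e *\<^sub>R Th z2) + d"
    proof -
      have "factor z = limit_factor z + (0, 0, sqrt e *\<^sub>R Th z2) + d"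
        by (simp add: factor_def limit_factor_def z d_def)
      moreover have "limit_factor (- (Q z - z - S z)) = limit_factor z + limit_factor (S z) - limit_factor (Q z)"
        using linear_factors(2) by (simp add: linear_diff linear_neg)
      ultimately show ?thesis by simp
    qed
    have "T (factor z - limit_factor (Q z)) = limit_factor (- (Q z - z - S z)) + T d"
      unfolding split linT Trot linear_diff[OF linear_factors(2), symmetric] Tlim
      by (simp add: linear_diff[OF linear_factors(2)])
    also have "norm \<dots> \<le> norm (limit_factor (- (Q z - z - S z))) + norm (T d)" by (rule norm_triangle_ineq)
    also have "norm (limit_factor (- (Q z - z - S z))) \<le> \<alpha> * (e * (\<beta> * \<tau>)\<^sup>2 * norm z)"
    proof -
      obtain a b c where abc: "- (Q z - z - S z) = (a, b, c)" by (cases "- (Q z - z - S z)")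
      have "norm (a, b) \<le> norm (a, b, c)" by (simp add: norm_Pair)
      then have "norm (limit_factor (- (Q z - z - S z))) \<le> \<alpha> * norm (- (Q z - z - S z))"
        unfolding abc using bound_limit[of a b] nonneg(1) mult_left_mono[of "norm (a, b)" "norm (a, b, c)" \<alpha>]
        by (simp add: limit_factor_def)
      also have "\<dots> \<le> \<alpha> * (e * (\<beta> * \<tau>)\<^sup>2 * norm z)"
        using Q(2)[of z] nonneg(1) unfolding k2 norm_minus_cancel by (intro mult_left_mono) auto
      finally show ?thesis .
    qed
    also have "norm (T d) \<le> e / 2 * norm z"
    proof -
      have "(norm (T d))\<^sup>2 \<le> (norm d)\<^sup>2"
        using normal_pythagoras[of d] excess_nonneg(1)[of d] by (simp add: T_def)
      then have "norm (T d) \<le> norm d" by (simp add: power2_le_iff_abs_le)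
      also have "norm d \<le> e / 2 * norm z1" using Le_Lo by (simp add: d_def norm_Pair)
      also have "\<dots> \<le> e / 2 * norm z" using e norm_fst_le[of z1 "(z3, z2)"] by (intro mult_left_mono) (auto simp: z)
      finally show ?thesis .
    qed
    finally show "norm ((factor z - limit_factor (Q z)) - normal_proj (factor z - limit_factor (Q z)))
        \<le> (\<alpha> * (\<beta> * \<tau>)\<^sup>2 + 1/2) * e * norm z"
      by (simp add: T_def algebra_simps)
  qed
qed

lemma opt_factor: "opt = distr std_gaussian borel (\<lambda>z. (0, 0, m) + factor z)"
  unfolding opt_def factor_def cond_factor_def by (rule distr_cong) (auto simp: algebra_simps)

text \<open>The limit law.\<close>
definition limit :: "('u \<times> 'x \<times> 'u) measure" where
  "limit = distr std_gaussian borel (\<lambda>z. (0, 0, m) + limit_factor z)"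

text \<open>Lower bound: the centred second coordinate of any coupling has no normal component. Upper bound: in the
  coupling of \<open>factor z\<close> with \<open>limit_factor (Q z)\<close> the normal component contributes exactly \<open>excess\<close>.\<close>
lemma W2_opt_limit:
  "excess \<le> (W2 opt limit)\<^sup>2"
  "(W2 opt limit)\<^sup>2 \<le> excess + ((\<alpha> * (\<beta> * \<tau>)\<^sup>2 + 1/2) * e)\<^sup>2 * (\<integral>z. (norm z)\<^sup>2 \<partial>(std_gaussian :: ('u \<times> 'x \<times> 'u) measure))"
proof -
  let ?M = "(0, 0, m) :: 'u \<times> 'x \<times> 'u"
  let ?N = "\<lambda>w. normal_part w \<bullet> Li (normal_part w)"
  define c where "c = (\<alpha> * (\<beta> * \<tau>)\<^sup>2 + 1/2) * e"
  define d where "d = excess + c\<^sup>2 * (\<integral>z. (norm z)\<^sup>2 \<partial>(std_gaussian :: ('u \<times> 'x \<times> 'u) measure))"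
  have d: "0 \<le> d" using excess_nonneg(2) by (simp add: d_def)
  obtain Q where Q: "orthogonal_transformation Q"
    "\<And>z. norm ((factor z - limit_factor (Q z)) - normal_proj (factor z - limit_factor (Q z))) \<le> c * norm z"
    using coupling_rotation unfolding c_def by blast
  note [measurable] = linear_measurable[OF orthogonal_transformation_linear[OF Q(1)]]
  have mN: "(\<lambda>w. ennreal (?N w)) \<in> borel_measurable borel" by measurable
  define \<gamma>0 where "\<gamma>0 = distr std_gaussian borel (\<lambda>z. (?M + factor z, ?M + limit_factor (Q z)))"
  have pair: "(\<lambda>z. (?M + factor z, ?M + limit_factor (Q z))) \<in> borel_measurable borel" by measurable
  have mfs: "(fst :: ('u \<times> 'x \<times> 'u) \<times> ('u \<times> 'x \<times> 'u) \<Rightarrow> _) \<in> borel_measurable borel"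
    "(snd :: ('u \<times> 'x \<times> 'u) \<times> ('u \<times> 'x \<times> 'u) \<Rightarrow> _) \<in> borel_measurable borel"
    by (intro borel_measurable_continuous_onI continuous_intros)+
  have coup: "\<gamma>0 \<in> couplings opt limit"
    unfolding couplings_def mem_Collect_eq
  proof (intro conjI)
    show "sets \<gamma>0 = sets borel" by (simp add: \<gamma>0_def)
    show "prob_space \<gamma>0"
      unfolding \<gamma>0_def using pair by (intro prob_space.prob_space_distr prob_space_std_gaussian) simp
    show "distr \<gamma>0 borel fst = opt"
      unfolding \<gamma>0_def opt_factor using pair mfs by (subst distr_distr) (auto simp: comp_def)
    have "distr \<gamma>0 borel snd = distr std_gaussian borel ((\<lambda>z. ?M + limit_factor z) \<circ> Q)"
      unfolding \<gamma>0_def using pair mfs by (subst distr_distr) (auto simp: comp_def)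
    also have "\<dots> = distr (distr std_gaussian borel Q) borel (\<lambda>z. ?M + limit_factor z)"
      by (subst distr_distr) auto
    finally show "distr \<gamma>0 borel snd = limit" by (simp add: std_gaussian_orthogonal[OF Q(1)] limit_def)
  qed
  have lin0: "linear (\<lambda>z. factor z - limit_factor (Q z))"
    using linear_compose_sub[OF linear_factors(1) linear_compose[OF orthogonal_transformation_linear[OF Q(1)] linear_factors(2)]]
    by (simp add: comp_def)
  have cost: "(\<integral>\<^sup>+ (w, w'). ennreal ((dist w w')\<^sup>2) \<partial>\<gamma>0) \<le> ennreal d"
  proof -
    have pt: "(norm (factor z - limit_factor (Q z)))\<^sup>2 \<le> ?N (factor z) + c\<^sup>2 * (norm z)\<^sup>2" for z
    proof -
      have "normal_part (factor z - limit_factor (Q z)) = normal_part (factor z)"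
        by (simp add: linear_diff[OF linear_factors(3)] normal_part_limit)
      then have "(norm (factor z - limit_factor (Q z)))\<^sup>2 = ?N (factor z) +
          (norm ((factor z - limit_factor (Q z)) - normal_proj (factor z - limit_factor (Q z))))\<^sup>2"
        using normal_pythagoras[of "factor z - limit_factor (Q z)"] by simp
      also have "\<dots> \<le> ?N (factor z) + (c * norm z)\<^sup>2"
        using Q(2)[of z] by (intro add_left_mono power_mono) auto
      finally show ?thesis by (simp add: power_mult_distrib)
    qed
    have md: "(\<lambda>(w, w'). ennreal ((dist w w')\<^sup>2)) \<in> borel_measurable (borel :: (('u \<times> 'x \<times> 'u) \<times> ('u \<times> 'x \<times> 'u)) measure)"
    proof -
      have "(\<lambda>p :: ('u \<times> 'x \<times> 'u) \<times> ('u \<times> 'x \<times> 'u). (dist (fst p) (snd p))\<^sup>2) \<in> borel_measurable borel"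
        by (intro borel_measurable_continuous_onI continuous_intros)
      then show ?thesis unfolding case_prod_beta by measurable
    qed
    have "(\<integral>\<^sup>+ (w, w'). ennreal ((dist w w')\<^sup>2) \<partial>\<gamma>0) = (\<integral>\<^sup>+z. ennreal ((norm (factor z - limit_factor (Q z)))\<^sup>2) \<partial>std_gaussian)"
      unfolding \<gamma>0_def using pair md by (subst nn_integral_distr) (auto simp: dist_norm)
    also have "\<dots> \<le> (\<integral>\<^sup>+z. ennreal (?N (factor z) + c\<^sup>2 * (norm z)\<^sup>2) \<partial>std_gaussian)"
      using pt by (intro nn_integral_mono ennreal_leI) auto
    also have "\<dots> = ennreal (\<integral>z. ?N (factor z) + c\<^sup>2 * (norm z)\<^sup>2 \<partial>std_gaussian)"
      using excess_integral(1) integrable_std_gaussian_norm excess_nonneg(1)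
      by (intro nn_integral_eq_integral Bochner_Integration.integrable_add integrable_mult_right AE_I2 add_nonneg_nonneg) auto
    also have "(\<integral>z. ?N (factor z) + c\<^sup>2 * (norm z)\<^sup>2 \<partial>std_gaussian) = d"
      unfolding d_def excess_integral(2)[symmetric]
      by (subst Bochner_Integration.integral_add)
        (auto intro!: excess_integral(1) integrable_std_gaussian_norm integrable_mult_right)
    finally show ?thesis .
  qed
  show "(W2 opt limit)\<^sup>2 \<le> excess + ((\<alpha> * (\<beta> * \<tau>)\<^sup>2 + 1/2) * e)\<^sup>2 * (\<integral>z. (norm z)\<^sup>2 \<partial>(std_gaussian :: ('u \<times> 'x \<times> 'u) measure))"
    using W2_squared_le[OF coup cost d] by (simp add: d_def c_def)
  have lower: "ennreal excess \<le> (\<integral>\<^sup>+ (w, w'). ennreal ((dist w w')\<^sup>2) \<partial>\<gamma>)" if \<gamma>: "\<gamma> \<in> couplings opt limit" for \<gamma>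
  proof -
    have sets [measurable_cong]: "sets \<gamma> = sets borel" and fst: "distr \<gamma> borel fst = opt" and snd: "distr \<gamma> borel snd = limit"
      using \<gamma> by (auto simp: couplings_def)
    have mf: "fst \<in> \<gamma> \<rightarrow>\<^sub>M borel" and ms: "snd \<in> \<gamma> \<rightarrow>\<^sub>M borel"
      unfolding measurable_cong_sets[OF sets refl] by (rule mfs)+
    have m0: "(\<lambda>z. ?M + limit_factor z) \<in> std_gaussian \<rightarrow>\<^sub>M borel" "(\<lambda>z. ?M + factor z) \<in> std_gaussian \<rightarrow>\<^sub>M borel"
      by measurable
    have "AE w in distr \<gamma> borel snd. normal_part (w - ?M) = 0"
      unfolding snd limit_def by (subst AE_distr_iff[OF m0(1)]) (simp_all add: normal_part_limit)
    then have AE: "AE p in \<gamma>. normal_part (snd p - ?M) = 0"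
      by (subst (asm) AE_distr_iff[OF ms]) simp_all
    have "ennreal excess = (\<integral>\<^sup>+z. ennreal (?N (factor z)) \<partial>std_gaussian)"
      unfolding excess_integral(2)[symmetric]
      using excess_integral(1) excess_nonneg(1) by (intro nn_integral_eq_integral[symmetric]) auto
    also have "\<dots> = (\<integral>\<^sup>+w. ennreal (?N (w - ?M)) \<partial>opt)"
      unfolding opt_factor using m0(2) by (subst nn_integral_distr) auto
    also have "\<dots> = (\<integral>\<^sup>+p. ennreal (?N (fst p - ?M)) \<partial>\<gamma>)"
      unfolding fst[symmetric] using mf by (subst nn_integral_distr) auto
    also have "\<dots> \<le> (\<integral>\<^sup>+p. ennreal ((dist (fst p) (snd p))\<^sup>2) \<partial>\<gamma>)"
    proof (rule nn_integral_mono_AE)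
      show "AE p in \<gamma>. ennreal (?N (fst p - ?M)) \<le> ennreal ((dist (fst p) (snd p))\<^sup>2)"
        using AE
      proof eventually_elim
        fix p :: "('u \<times> 'x \<times> 'u) \<times> ('u \<times> 'x \<times> 'u)"
        assume p: "normal_part (snd p - ?M) = 0"
        have "fst p - snd p = (fst p - ?M) - (snd p - ?M)" by simp
        then have "normal_part (fst p - snd p) = normal_part (fst p - ?M)"
          using p by (metis linear_diff[OF linear_factors(3)] diff_zero)
        then have "?N (fst p - ?M) \<le> (norm (fst p - snd p))\<^sup>2"
          using normal_pythagoras[of "fst p - snd p"] by simp
        then show "ennreal (?N (fst p - ?M)) \<le> ennreal ((dist (fst p) (snd p))\<^sup>2)"
          unfolding dist_norm by (rule ennreal_leI)
      qed
    qed
    finally show ?thesis by (simp only: case_prod_unfold)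
  qed
  show "excess \<le> (W2 opt limit)\<^sup>2"
    by (rule W2_squared_ge[OF coup cost lower excess_nonneg(2)])
qed

end


section \<open>The expansion\<close>

lemma matrix_inv_mult_vector:
  fixes A :: "real^'n^'n"
  assumes "\<And>v. A *v v = 0 \<Longrightarrow> v = 0"
  shows "A *v (matrix_inv A *v v) = v" "matrix_inv A *v (A *v v) = v"
proof -
  have "inj ((*v) A)"
    using assms by (simp add: linear_injective_0[OF matrix_vector_mul_linear])
  then have "invertible A"
    by (simp add: invertible_left_inverse matrix_left_invertible_injective)
  then have "A ** matrix_inv A = mat 1 \<and> matrix_inv A ** A = mat 1"
    unfolding invertible_def matrix_inv_def by (rule someI_ex)
  then show "A *v (matrix_inv A *v v) = v" "matrix_inv A *v (A *v v) = v"
    by (simp_all add: matrix_vector_mul_assoc)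
qed

lemma trace_eq_sum_Basis:
  fixes A :: "real^'n^'n"
  shows "trace A = (\<Sum>b\<in>Basis. b \<bullet> (A *v b))"
proof -
  define ax :: "'n \<Rightarrow> real^'n" where "ax i = axis i 1" for i
  have inj: "inj ax"
    by (auto intro!: injI simp: ax_def axis_eq_axis)
  have Basis: "(Basis :: (real^'n) set) = range ax"
    by (auto simp: Basis_vec_def ax_def)
  have "(\<Sum>b\<in>Basis. b \<bullet> (A *v b)) = (\<Sum>i\<in>UNIV. ax i \<bullet> (A *v ax i))"
    unfolding Basis by (subst sum.reindex[OF inj]) (simp add: comp_def)
  also have "\<dots> = trace A"
    by (simp add: ax_def trace_def matrix_vector_mult_basis inner_axis' column_def)
  finally show ?thesis ..
qed

lemma selfadjoint_transpose:
  fixes A :: "real^'n^'n"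
  assumes "\<And>v w. (A *v v) \<bullet> w = v \<bullet> (A *v w)"
  shows "transpose A = A"
proof -
  have "v \<bullet> (transpose A *v w) = v \<bullet> (A *v w)" for v w
    using assms[of v w] dot_lmul_matrix[of w A v] by (simp add: transpose_matrix_vector inner_commute)
  then have "transpose A *v w = A *v w" for w by (metis vector_eq_ldot)
  then show ?thesis by (simp add: matrix_eq)
qed

text \<open>A nonsingular covariance operator \<open>A A\<^sup>T\<close> is symmetric and positive definite.\<close>
lemma block2_covariance:
  fixes \<Sigma>XX :: "real^'x^'x" and \<Sigma>XY :: "real^'y^'x" and \<Sigma>YX :: "real^'x^'y" and \<Sigma>YY :: "real^'y^'y"
  assumes nu: "is_gaussian \<nu> v0 (block2 \<Sigma>XX \<Sigma>XY \<Sigma>YX \<Sigma>YY)"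
    and nonsingular: "bij (block2 \<Sigma>XX \<Sigma>XY \<Sigma>YX \<Sigma>YY)"
  shows "(\<Sigma>XX *v x) \<bullet> x' = x \<bullet> (\<Sigma>XX *v x')" "(\<Sigma>YX *v x) \<bullet> y = x \<bullet> (\<Sigma>XY *v y)"
    "(\<Sigma>YY *v y) \<bullet> y' = y \<bullet> (\<Sigma>YY *v y')"
    "(x, y) \<noteq> 0 \<Longrightarrow> 0 < (x, y) \<bullet> block2 \<Sigma>XX \<Sigma>XY \<Sigma>YX \<Sigma>YY (x, y)"
proof -
  let ?S = "block2 \<Sigma>XX \<Sigma>XY \<Sigma>YX \<Sigma>YY"
  obtain A :: "(real^'x) \<times> (real^'y) \<Rightarrow> (real^'x) \<times> (real^'y)" where A: "linear A" "A \<circ> adjoint A = ?S"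
    using nu unfolding is_gaussian_def by blast
  have S: "?S v = A (adjoint A v)" for v using A(2) by (metis comp_apply)
  have sym: "?S v \<bullet> w = v \<bullet> ?S w" for v w
    unfolding S by (metis adjoint_works[OF A(1)] inner_commute)
  show "(\<Sigma>XX *v x) \<bullet> x' = x \<bullet> (\<Sigma>XX *v x')"
    using sym[of "(x, 0)" "(x', 0)"] by (simp add: block2_def)
  show "(\<Sigma>YX *v x) \<bullet> y = x \<bullet> (\<Sigma>XY *v y)"
    using sym[of "(x, 0)" "(0, y)"] by (simp add: block2_def)
  show "(\<Sigma>YY *v y) \<bullet> y' = y \<bullet> (\<Sigma>YY *v y')"
    using sym[of "(0, y)" "(0, y')"] by (simp add: block2_def)
  assume ne: "(x, y) \<noteq> 0"
  have "?S 0 = 0" by (simp add: block2_def zero_prod_def)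
  then have "?S (x, y) \<noteq> 0" using ne nonsingular by (metis bij_def injD)
  then have "adjoint A (x, y) \<noteq> 0" unfolding S using linear_0[OF A(1)] by metis
  then have "0 < adjoint A (x, y) \<bullet> adjoint A (x, y)" by simp
  also have "\<dots> = (x, y) \<bullet> ?S (x, y)" unfolding S by (metis adjoint_works[OF A(1)] inner_commute)
  finally show "0 < (x, y) \<bullet> ?S (x, y)" .
qed

text \<open>The positive root \<open>l\<close> of \<open>l\<^sup>2 + e l = t\<close>. Applied to the eigenvalues of the Schur complement it gives
  the cross covariance of the optimal coupling.\<close>
definition entropic_root :: "real \<Rightarrow> real \<Rightarrow> real" where
  "entropic_root e t = sqrt (t + e\<^sup>2 / 4) - e / 2"

lemma entropic_root:
  assumes "0 < e" "0 < t"
  shows "0 < entropic_root e t" and "entropic_root e t * entropic_root e t + e * entropic_root e t = t"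
    and "entropic_root e t \<le> sqrt t" and "\<bar>entropic_root e t - sqrt t\<bar> \<le> e / 2"
proof -
  have e2: "sqrt (e\<^sup>2 / 4) = e / 2" using assms by (simp add: real_sqrt_divide)
  have "sqrt (e\<^sup>2 / 4) < sqrt (t + e\<^sup>2 / 4)" using assms by (intro real_sqrt_less_mono) simp
  then show "0 < entropic_root e t" by (simp add: entropic_root_def e2)
  have "sqrt (t + e\<^sup>2 / 4) * sqrt (t + e\<^sup>2 / 4) = t + e\<^sup>2 / 4" using assms by (simp add: add_nonneg_nonneg)
  then show "entropic_root e t * entropic_root e t + e * entropic_root e t = t"
    by (simp add: entropic_root_def algebra_simps power2_eq_square)
  have "sqrt (t + e\<^sup>2 / 4) \<le> sqrt t + sqrt (e\<^sup>2 / 4)" using assms by (intro sqrt_add_le_add_sqrt) auto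
  then show le: "entropic_root e t \<le> sqrt t" by (simp add: entropic_root_def e2)
  have "sqrt t \<le> sqrt (t + e\<^sup>2 / 4)" by simp
  then show "\<bar>entropic_root e t - sqrt t\<bar> \<le> e / 2" using le by (simp add: entropic_root_def)
qed

theorem proposition3p2:
  fixes \<mu> :: "(real^'y) measure"
    and \<nu> :: "((real^'x) \<times> (real^'y)) measure"
    and \<pi> :: "real \<Rightarrow> ((real^'y) \<times> (real^'x) \<times> (real^'y)) measure"
    and \<pi>o :: "((real^'y) \<times> (real^'x) \<times> (real^'y)) measure"
    and mY :: "real^'y"
    and \<Sigma>XX :: "real^'x^'x" and \<Sigma>XY :: "real^'y^'x"
    and \<Sigma>YX :: "real^'x^'y" and \<Sigma>YY :: "real^'y^'y"
    and \<Lambda>o L :: "real^'y^'y"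
  assumes mu: "is_gaussian \<mu> 0 (\<lambda>u. u)"
    and nu: "is_gaussian \<nu> (0, mY) (block2 \<Sigma>XX \<Sigma>XY
                                          \<Sigma>YX \<Sigma>YY)"
    and nonsingular: "bij (block2 \<Sigma>XX \<Sigma>XY \<Sigma>YX \<Sigma>YY)"
    and optimal: "\<And>\<epsilon>. \<epsilon> > 0 \<Longrightarrow> evqr_optimal \<epsilon> \<mu> \<nu> (\<pi> \<epsilon>)"
    and Lambda_o: "\<Lambda>o = psd_sqrt (\<Sigma>YY - \<Sigma>YX ** matrix_inv \<Sigma>XX ** \<Sigma>XY)"
    and pi_o: "is_gaussian \<pi>o (0, 0, mY) (block3 (mat 1)  0   \<Lambda>o
                                                 0       \<Sigma>XX \<Sigma>XY
                                                 \<Lambda>o      \<Sigma>YX \<Sigma>YY)"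
    and L: "L = mat 1 + \<Lambda>o ** \<Lambda>o + \<Sigma>YX ** matrix_inv \<Sigma>XX ** matrix_inv \<Sigma>XX ** \<Sigma>XY"
  shows "(\<lambda>\<epsilon>. (W2 (\<pi> \<epsilon>) \<pi>o)\<^sup>2 - \<epsilon> * trace (matrix_inv L ** \<Lambda>o)) \<in> O[at_right 0](\<lambda>\<epsilon>. \<epsilon>\<^sup>2)"
proof -
  note cov = block2_covariance[OF nu nonsingular]
  define S where "S = \<Sigma>YY - \<Sigma>YX ** matrix_inv \<Sigma>XX ** \<Sigma>XY"
  let ?X = "\<lambda>x. \<Sigma>XX *v x" and ?Xi = "\<lambda>x. matrix_inv \<Sigma>XX *v x" and ?s = "\<lambda>v. S *v v"

  have X_pos: "0 < x \<bullet> ?X x" if "x \<noteq> 0" for x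
    using cov(4)[of x 0] that by (simp add: block2_def zero_prod_def)
  have X_inv: "?X (?Xi x) = x" "?Xi (?X x) = x" for x
    using matrix_inv_mult_vector[of \<Sigma>XX] X_pos by (metis inner_zero_right less_irrefl)+
  have Xi_sym: "?Xi x \<bullet> x' = x \<bullet> ?Xi x'" for x x'
    using cov(1)[of "?Xi x" "?Xi x'"] by (simp add: X_inv)

  have s_eq: "?s v = \<Sigma>YY *v v - \<Sigma>YX *v (?Xi (\<Sigma>XY *v v))" for v
    by (simp add: S_def matrix_vector_mult_diff_rdistrib matrix_vector_mul_assoc[symmetric])
  have s_sym: "?s v \<bullet> w = v \<bullet> ?s w" for v w
    unfolding s_eq inner_diff_left inner_diff_right cov(2,3) Xi_sym
    by (metis cov(2) inner_commute Xi_sym)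
  have s_pos: "0 < v \<bullet> ?s v" if "v \<noteq> 0" for v
  proof -
    \<comment> \<open>eliminating \<open>X\<close>: on these vectors the quadratic form of the covariance is that of \<open>S\<close>\<close>
    have "block2 \<Sigma>XX \<Sigma>XY \<Sigma>YX \<Sigma>YY (- ?Xi (\<Sigma>XY *v v), v) = (0, ?s v)"
      by (simp add: block2_def s_eq X_inv linear_neg[OF matrix_vector_mul_linear])
    then show ?thesis using cov(4)[of "- ?Xi (\<Sigma>XY *v v)" v] that by (simp add: zero_prod_def)
  qed

  obtain BX where BX: "eigenbasis ?X BX" using eigenbasis_exists[OF matrix_vector_mul_linear cov(1)] by blast
  obtain B where B: "eigenbasis ?s B" using eigenbasis_exists[OF matrix_vector_mul_linear s_sym] by blast
  have BX_pos: "0 < b \<bullet> ?X b" if "b \<in> BX" for b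
    using that BX by (intro X_pos) (auto simp: eigenbasis_def)
  have B_pos: "0 < b \<bullet> ?s b" if "b \<in> B" for b
    using that B by (intro s_pos) (auto simp: eigenbasis_def)

  \<comment> \<open>\<open>Lo\<close>, \<open>Le\<close> and \<open>Th\<close> are functions of the same operator \<open>S\<close>, so that their relations reduce to
    relations between eigenvalues\<close>
  define H where "H = fun_calc ?X BX sqrt"
  define Hi where "Hi = fun_calc ?X BX (\<lambda>t. 1 / sqrt t)"
  define F where "F x = \<Sigma>YX *v (?Xi x)" for x
  define Lo where "Lo = fun_calc ?s B sqrt"
  define Loi where "Loi = fun_calc ?s B (\<lambda>t. 1 / sqrt t)"
  define Le where "Le e = fun_calc ?s B (entropic_root e)" for e
  define Th where "Th e = fun_calc ?s B (\<lambda>t. sqrt (entropic_root e t))" for e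
  define Thi where "Thi e = fun_calc ?s B (\<lambda>t. 1 / sqrt (entropic_root e t))" for e
  define Li where "Li v = matrix_inv L *v v" for v
  let ?Ft = "\<lambda>v. ?Xi (\<Sigma>XY *v v)"

  have cong1: "fun_calc ?s B \<phi> v = v" if "\<And>b. b \<in> B \<Longrightarrow> \<phi> (b \<bullet> ?s b) = 1" for \<phi> v
    using fun_calc_cong[of B \<phi> ?s "\<lambda>_. 1" v] that fun_calc_one[OF B] by simp
  have congX1: "fun_calc ?X BX \<phi> v = v" if "\<And>b. b \<in> BX \<Longrightarrow> \<phi> (b \<bullet> ?X b) = 1" for \<phi> v
    using fun_calc_cong[of BX \<phi> ?X "\<lambda>_. 1" v] that fun_calc_one[OF BX] by simp
  have congs: "fun_calc ?s B \<phi> v = ?s v" if "\<And>b. b \<in> B \<Longrightarrow> \<phi> (b \<bullet> ?s b) = b \<bullet> ?s b" for \<phi> v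
    using fun_calc_cong[of B \<phi> ?s "\<lambda>t. t" v] that fun_calc_id[OF B matrix_vector_mul_linear] by simp
  have HH: "H (H x) = ?X x" for x
    using fun_calc_cong[of BX "\<lambda>t. sqrt t * sqrt t" ?X "\<lambda>t. t" x] fun_calc_id[OF BX matrix_vector_mul_linear] BX_pos
    by (simp add: H_def fun_calc_compose[OF BX] less_imp_le)
  have LoLo: "Lo (Lo v) = ?s v" for v
    unfolding Lo_def fun_calc_compose[OF B] using B_pos by (intro congs) (simp add: less_imp_le)
  have H_sym: "H v \<bullet> w = v \<bullet> H w" for v w unfolding H_def by (rule fun_calc_selfadjoint)
  have linF: "linear F"
    unfolding F_def by (intro linearI) (simp_all add: matrix_vector_right_distrib matrix_vector_mult_scaleR)
  have adjF: "adjoint F = ?Ft"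
    by (rule adjoint_unique) (simp add: F_def cov(2) Xi_sym)
  have adjH: "adjoint H = H"
    by (rule adjoint_unique) (simp add: H_sym)

  have Lambda: "\<Lambda>o = matrix Lo"
    unfolding Lambda_o S_def[symmetric]
  proof (rule psd_sqrt_eqI)
    have mv: "matrix Lo *v v = Lo v" for v
      unfolding Lo_def by (rule fun_cong[OF matrix_vector_mul(2)[OF linear_fun_calc]])
    show "transpose (matrix Lo) = matrix Lo"
      by (rule selfadjoint_transpose, unfold mv, unfold Lo_def) (rule fun_calc_selfadjoint)
    show "0 \<le> v \<bullet> (matrix Lo *v v)" for v
      unfolding mv unfolding Lo_def using B_pos by (intro fun_calc_psd) (simp add: less_imp_le)
    show "matrix Lo ** matrix Lo = S"
      unfolding matrix_eq by (simp add: matrix_vector_mul_assoc[symmetric] mv LoLo)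
  qed
  have Lo_mv: "\<Lambda>o *v v = Lo v" for v
    unfolding Lambda Lo_def by (rule fun_cong[OF matrix_vector_mul(2)[OF linear_fun_calc]])
  have L_mv: "L *v v = v + Lo (Lo v) + F (adjoint F v)" for v
    by (simp add: L matrix_vector_mult_add_rdistrib matrix_vector_mul_assoc[symmetric] Lo_mv F_def adjF)
  have L_Li: "L *v (Li v) = v" for v
    unfolding Li_def
  proof (rule matrix_inv_mult_vector)
    fix v assume "L *v v = 0"
    then have "0 = (v + Lo (Lo v) + F (adjoint F v)) \<bullet> v" by (simp add: L_mv)
    also have "\<dots> = v \<bullet> v + Lo v \<bullet> Lo v + adjoint F v \<bullet> adjoint F v"
      by (simp add: inner_add_left adjoint_works[OF linF] Lo_def fun_calc_selfadjoint)
    finally have "v \<bullet> v \<le> 0" using inner_ge_zero[of "Lo v"] inner_ge_zero[of "adjoint F v"] by linarith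
    then show "v = 0" by (metis inner_ge_zero inner_eq_zero_iff order_antisym)
  qed
  have linLi: "linear Li" unfolding Li_def by simp

  have EG: "entropic_gaussian H Hi F Lo Loi (Le e) (Th e) (Thi e) e" if e: "0 < e" for e
  proof (rule entropic_gaussian.intro)
    show "linear H" "linear Hi" "linear Lo" "linear Loi" "linear (Le e)" "linear (Th e)" "linear (Thi e)"
      by (simp_all add: H_def Hi_def Lo_def Loi_def Le_def Th_def Thi_def linear_fun_calc)
    show "linear F" by (rule linF)
    show "H (Hi x) = x" "Hi (H x) = x" for x
      unfolding H_def Hi_def fun_calc_compose[OF BX] using BX_pos by (auto intro!: congX1 simp: less_le)
    show "Lo (Loi v) = v" "Loi (Lo v) = v" for v
      unfolding Lo_def Loi_def fun_calc_compose[OF B] using B_pos by (auto intro!: cong1 simp: less_le)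
    show "Th e (Thi e v) = v" "Thi e (Th e v) = v" for v
      unfolding Th_def Thi_def fun_calc_compose[OF B] using entropic_root(1)[OF e B_pos]
      by (auto intro!: cong1 simp: less_le)
    show "Lo v \<bullet> w = v \<bullet> Lo w" "Le e v \<bullet> w = v \<bullet> Le e w" "Th e v \<bullet> w = v \<bullet> Th e w" for v w
      unfolding Lo_def Le_def Th_def by (rule fun_calc_selfadjoint)+
    show "Th e (Th e v) = Le e v" for v
      unfolding Th_def Le_def fun_calc_compose[OF B] using entropic_root(1)[OF e B_pos]
      by (intro fun_calc_cong) (simp add: less_imp_le)
    show "Le e (Le e v) + e *\<^sub>R Le e v = Lo (Lo v)" for v
      unfolding LoLo Le_def fun_calc_compose[OF B] fun_calc_scale fun_calc_add
      using entropic_root(2)[OF e B_pos] by (intro congs) simp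
    show "0 < e" by fact
  qed

  \<comment> \<open>\<open>nu\<close> does not depend on the regularization parameter; the value \<open>1\<close> is arbitrary\<close>
  interpret one: entropic_gaussian H Hi F Lo Loi "Le 1" "Th 1" "Thi 1" mY 1
    by (rule EG) simp
  have mu_std: "\<mu> = std_gaussian"
  proof -
    have "adjoint (\<lambda>u::real^'y. u) = (\<lambda>u. u)" by (rule adjoint_unique) simp
    then have "\<mu> = distr std_gaussian borel (\<lambda>z. 0 + z)"
      by (intro is_gaussian_eq_distr[OF mu]) (simp_all add: linear_ident)
    then show ?thesis by (simp add: distr_id2[OF sets_std_gaussian[symmetric]])
  qed
  have nu_eq: "\<nu> = one.nu"
    unfolding one.nu_def
  proof (rule is_gaussian_eq_distr[OF nu one.linear_regressor])
    have adj: "adjoint one.regressor = (\<lambda>(x, y). (H (x + ?Ft y), Lo y))"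
      by (rule adjoint_unique)
        (auto simp: one.regressor_def one.linear_simps inner_add_left inner_add_right one.selfadjoint H_sym adjoint_works[OF linF, unfolded adjF, symmetric])
    fix w :: "(real^'x) \<times> (real^'y)"
    show "one.regressor (adjoint one.regressor w) = block2 \<Sigma>XX \<Sigma>XY \<Sigma>YX \<Sigma>YY w"
      by (cases w, simp only: adj)
        (simp add: one.regressor_def block2_def HH LoLo s_eq F_def X_inv matrix_vector_right_distrib)
  qed

  \<comment> \<open>operator bounds that do not depend on the regularization parameter\<close>
  define \<alpha>map where "\<alpha>map = (\<lambda>(u, x). (u, H x, F (H x) + Lo u))"
  have "linear \<alpha>map"
    unfolding \<alpha>map_def by (auto intro!: linearI simp: one.linear_simps algebra_simps)
  then obtain \<alpha> where \<alpha>: "0 < \<alpha>" "\<And>p. norm (\<alpha>map p) \<le> \<alpha> * norm p" by (metis linear_bounded_pos)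
  have "linear (\<lambda>v. Lo (Li v))" "linear (\<lambda>v. Hi (adjoint F (Li v)))"
    using linear_compose[OF linLi one.linear(4)]
      linear_compose[OF linear_compose[OF linLi adjoint_linear[OF linF]] one.linear(2)] by (simp_all add: comp_def)
  then obtain \<beta>1 \<beta>2 where \<beta>12: "0 < \<beta>1" "\<And>v. norm (Lo (Li v)) \<le> \<beta>1 * norm v"
    "0 < \<beta>2" "\<And>v. norm (Hi (adjoint F (Li v))) \<le> \<beta>2 * norm v" by (metis linear_bounded_pos)
  define \<beta> where "\<beta> = max \<beta>1 \<beta>2"
  have \<beta>: "0 \<le> \<beta>" "norm (Lo (Li v)) \<le> \<beta> * norm v" "norm (Hi (adjoint F (Li v))) \<le> \<beta> * norm v" for v
  proof -
    have "\<beta>1 * norm v \<le> \<beta> * norm v" "\<beta>2 * norm v \<le> \<beta> * norm v"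
      by (auto simp: \<beta>_def intro: mult_right_mono)
    then show "norm (Lo (Li v)) \<le> \<beta> * norm v" "norm (Hi (adjoint F (Li v))) \<le> \<beta> * norm v"
      using \<beta>12(2,4)[of v] by linarith+
    show "0 \<le> \<beta>" using \<beta>12(1) by (simp add: \<beta>_def)
  qed
  define \<tau> where "\<tau> = (\<Sum>b\<in>B. sqrt (sqrt (b \<bullet> ?s b)))"
  have \<tau>0: "0 \<le> \<tau>" unfolding \<tau>_def using B_pos by (intro sum_nonneg) (simp add: less_imp_le)
  have Th_bound: "norm (Th e v) \<le> \<tau> * norm v" if e: "0 < e" for e v
    unfolding Th_def
  proof (rule fun_calc_norm_le[OF B _ \<tau>0])
    fix b assume b: "b \<in> B"
    have "\<bar>sqrt (entropic_root e (b \<bullet> ?s b))\<bar> \<le> sqrt (sqrt (b \<bullet> ?s b))"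
      using entropic_root(1,3)[OF e B_pos[OF b]] by simp
    also have "\<dots> \<le> \<tau>"
      unfolding \<tau>_def using b B_pos eigenbasis_finite[OF B]
      by (intro member_le_sum) (auto simp: less_imp_le)
    finally show "\<bar>sqrt (entropic_root e (b \<bullet> ?s b))\<bar> \<le> \<tau>" .
  qed
  have Le_Lo_bound: "norm (Le e v - Lo v) \<le> e / 2 * norm v" if e: "0 < e" for e v
    unfolding Le_def Lo_def fun_calc_diff
    using entropic_root(4)[OF e B_pos] e by (intro fun_calc_norm_le[OF B]) auto
  obtain k where k: "0 < k" "\<And>v. norm (Li v) \<le> k * norm v" using linear_bounded_pos[OF linLi] by blast

  define tr where "tr = trace (matrix_inv L ** \<Lambda>o)"
  have tr: "tr = (\<Sum>b\<in>Basis. b \<bullet> Li (Lo b))"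
    by (simp add: tr_def trace_eq_sum_Basis matrix_vector_mul_assoc[symmetric] Lo_mv Li_def)
  define N where "N = real DIM(real^'y)"
  define K1 where "K1 = N * k"
  define K2 where "K2 = (\<alpha> * (\<beta> * \<tau>)\<^sup>2 + 1/2)\<^sup>2 * (\<integral>z. (norm z)\<^sup>2 \<partial>(std_gaussian :: ((real^'y) \<times> (real^'x) \<times> (real^'y)) measure))"

  have bound: "norm ((W2 (\<pi> e) \<pi>o)\<^sup>2 - e * tr) \<le> (K1 + K2) * norm (e\<^sup>2)" if e: "0 < e" for e
  proof -
    interpret entropic_gaussian_limit H Hi F Lo Loi "Le e" "Th e" "Thi e" mY e Li \<alpha> \<beta> \<tau>
    proof -
      show "entropic_gaussian_limit H Hi F Lo Loi (Le e) (Th e) (Thi e) e Li \<alpha> \<beta> \<tau>"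
      proof (intro entropic_gaussian_limit.intro entropic_gaussian_limit_axioms.intro)
        show "entropic_gaussian H Hi F Lo Loi (Le e) (Th e) (Thi e) e" by (rule EG[OF e])
        show "Li v + Lo (Lo (Li v)) + F (adjoint F (Li v)) = v" for v using L_Li[of v] by (simp only: L_mv)
        show "norm (u, H x, F (H x) + Lo u) \<le> \<alpha> * norm (u, x)" for u x
          using \<alpha>(2)[of "(u, x)"] by (simp add: \<alpha>map_def)
      qed (use linLi \<beta> \<alpha>(1) \<tau>0 Th_bound[OF e] Le_Lo_bound[OF e] in auto)
    qed
    have nu': "nu = \<nu>" unfolding nu_eq nu_def one.nu_def regressor_def one.regressor_def ..
    have "\<pi> e = opt"
      using optimal[OF e] by (intro evqr_optimal_eq_opt[OF EG[OF e]]) (simp add: mu_std nu')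
    moreover have "\<pi>o = limit"
      unfolding limit_def
    proof (rule is_gaussian_eq_distr[OF pi_o linear_factors(2)])
      have adj: "adjoint limit_factor = (\<lambda>(u, x, y). (u + Lo y, H (x + ?Ft y), 0))"
        by (rule adjoint_unique)
          (auto simp: limit_factor_def linear_simps inner_add_left inner_add_right selfadjoint H_sym adjoint_works[OF linF, unfolded adjF, symmetric])
      fix w :: "(real^'y) \<times> (real^'x) \<times> (real^'y)"
      show "limit_factor (adjoint limit_factor w) = block3 (mat 1) 0 \<Lambda>o 0 \<Sigma>XX \<Sigma>XY \<Lambda>o \<Sigma>YX \<Sigma>YY w"
        by (cases w, simp only: adj)
          (simp add: limit_factor_def block3_def HH LoLo s_eq Lo_mv F_def X_inv matrix_vector_right_distrib linear_simps)
    qed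
    ultimately have W: "excess \<le> (W2 (\<pi> e) \<pi>o)\<^sup>2" "(W2 (\<pi> e) \<pi>o)\<^sup>2 \<le> excess + K2 * e\<^sup>2"
      using W2_opt_limit by (simp_all add: K2_def power_mult_distrib mult_ac)
    define D where "D v = Le e v - Lo v" for v
    have D: "norm (D b) \<le> e / 2" if "b \<in> Basis" for b
      using Le_Lo_bound[OF e, of b] that by (simp add: D_def)
    have LiD: "norm (Li (D b)) \<le> k * (e / 2)" if "b \<in> Basis" for b
      using k(2)[of "D b"] mult_left_mono[OF D[OF that], of k] k(1) by linarith
    \<comment> \<open>\<open>excess\<close> is \<open>e * tr\<close> up to second order because \<open>D = O(e)\<close>\<close>
    have eq: "excess - e * tr = (\<Sum>b\<in>Basis. D b \<bullet> Li (D b)) + e * (\<Sum>b\<in>Basis. b \<bullet> Li (D b))"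
      unfolding excess_def tr D_def
      by (simp add: linear_diff[OF linLi] inner_diff_right sum_subtractf right_diff_distrib)
    have "\<bar>\<Sum>b\<in>Basis. D b \<bullet> Li (D b)\<bar> \<le> (\<Sum>b\<in>(Basis :: (real^'y) set). e / 2 * (k * (e / 2)))"
    proof (rule sum_abs[THEN order_trans], rule sum_mono)
      fix b :: "real^'y" assume b: "b \<in> Basis"
      have "\<bar>D b \<bullet> Li (D b)\<bar> \<le> norm (D b) * norm (Li (D b))" by (rule Cauchy_Schwarz_ineq2)
      also have "\<dots> \<le> e / 2 * (k * (e / 2))" using D[OF b] LiD[OF b] e by (intro mult_mono) auto
      finally show "\<bar>D b \<bullet> Li (D b)\<bar> \<le> e / 2 * (k * (e / 2))" .
    qed
    then have 1: "\<bar>\<Sum>b\<in>Basis. D b \<bullet> Li (D b)\<bar> \<le> N * k * e\<^sup>2 / 4"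
      by (simp add: N_def power2_eq_square mult_ac)
    have "\<bar>\<Sum>b\<in>Basis. b \<bullet> Li (D b)\<bar> \<le> (\<Sum>b\<in>(Basis :: (real^'y) set). k * (e / 2))"
    proof (rule sum_abs[THEN order_trans], rule sum_mono)
      fix b :: "real^'y" assume b: "b \<in> Basis"
      have "\<bar>b \<bullet> Li (D b)\<bar> \<le> norm b * norm (Li (D b))" by (rule Cauchy_Schwarz_ineq2)
      then show "\<bar>b \<bullet> Li (D b)\<bar> \<le> k * (e / 2)" using b LiD[OF b] by simp
    qed
    then have "e * \<bar>\<Sum>b\<in>Basis. b \<bullet> Li (D b)\<bar> \<le> e * (N * (k * (e / 2)))"
      using e by (intro mult_left_mono) (auto simp: N_def)
    then have 2: "\<bar>e * (\<Sum>b\<in>Basis. b \<bullet> Li (D b))\<bar> \<le> N * k * e\<^sup>2 / 2"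
      using e by (simp add: abs_mult power2_eq_square mult_ac)
    have Nk: "0 \<le> N * k * e\<^sup>2" using k(1) by (simp add: N_def)
    have "\<bar>excess - e * tr\<bar> \<le> K1 * e\<^sup>2"
      using eq 1 2 Nk unfolding K1_def by linarith
    moreover have "0 \<le> K2 * e\<^sup>2"
      unfolding K2_def by (intro mult_nonneg_nonneg Bochner_Integration.integral_nonneg) auto
    ultimately show ?thesis using W by (simp add: distrib_right abs_le_iff)
  qed
  have "eventually (\<lambda>e. norm ((W2 (\<pi> e) \<pi>o)\<^sup>2 - e * tr) \<le> (K1 + K2) * norm (e\<^sup>2)) (at_right 0)"
    using bound by (auto simp: eventually_at_right_less intro: eventually_mono[OF eventually_at_right_less])
  then show ?thesis unfolding tr_def by (rule bigoI)
qed

end
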